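(* Let $E_1,E_2\in\mathbb{P}_{\rm n}$ or $E_1,E_2\in\mathbb{P}_{\rm p}$, let $E\in\mathbb{P}$, $\approx\,\in\{\approx_{\rm pw},\approx_{\rm pb}\}$, and $\mathcal{P}\in\{\mathrm{SBSNNI}_\approx,\mathrm{P\_BNDC}_\approx,\mathrm{SBNDC}_\approx\}$. Then: 1. $E\in\mathcal{P}\Longrightarrow a.E\in\mathcal{P}$ for all $a\in\mathcal{A}_{\mathcal{L}}\cup\{\tau\}$, when $E\in\mathbb{P}_{\rm p}$. 2. $E_1,E_2\in\mathcal{P}\Longrightarrow E_1\|_LE_2\in\mathcal{P}$ for all $L\subseteq\mathcal{A}_{\mathcal{L}}$ if $\mathcal{P}\in\{\mathrm{SBSNNI}_\approx,\mathrm{P\_BNDC}_\approx\}$, or for all $L\subseteq\mathcal{A}$ if $\mathcal{P}=\mathrm{SBNDC}_\approx$, provided that $\approx\;=\;\approx_{\rm pb}$. 3. $E\in\mathcal{P}\Longrightarrow E\setminus L\in\mathcal{P}$ for all $L\subseteq\mathcal{A}$. 4. $E\in\mathcal{P}\Longrightarrow E/L\in\mathcal{P}$ for all $L\subseteq\mathcal{A}_{\mathcal{L}}$.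
   Context: **Processes.** $\mathcal{A}$ is a countable set of observable actions, partitioned into the disjoint sets $\mathcal{A}_{\mathcal{H}}$ (high-level actions) and $\mathcal{A}_{\mathcal{L}}$ (low-level actions); $\tau \notin \mathcal{A}$ is the unobservable action; $\mathcal{A}_\tau = \mathcal{A} \cup \{\tau\}$. The process terms form $\mathbb{P} = \mathbb{P}_{\rm n} \cup \mathbb{P}_{\rm p}$ (disjoint), where nondeterministic terms $N \in \mathbb{P}_{\rm n}$ and probabilistic terms $P \in \mathbb{P}_{\rm p}$ are given by $N ::= \underline{0} \mid a.P \mid N + N \mid N \|_L N \mid N \setminus L \mid N / L \mid NK$ and $P ::= \bigoplus_{i \in I}[p_i]N_i \mid P \|_L P \mid P \setminus L \mid P / L \mid PK$, with $a \in \mathcal{A}_\tau$, $L \subseteq \mathcal{A}$, $I$ finite nonempty, $p_i \in (0,1]$, $\sum_{i\in I} p_i = 1$ ($[1]N$ is the one-summand case). $NK, PK$ are process constants with defining equations $NK \triangleq N$, $PK \triangleq P$ in whose right-hand sides every constant occurs in the scope of an action prefix (recursion allowed). **Semantics.** Action transitions $\xrightarrow{a}_{\rm a}\ \subseteq \mathbb{P}_{\rm n}\times\mathbb{P}_{\rm p}$ are the least relations with: $a.P \xrightarrow{a}_{\rm a} P$; if $N_1 \xrightarrow{a}_{\rm a} P_1$ then $N_1+N_2 \xrightarrow{a}_{\rm a} P_1$ and $N_2+N_1 \xrightarrow{a}_{\rm a} P_1$; if $N_1 \xrightarrow{a}_{\rm a} P_1$ and $a \notin L$ then $N_1 \|_L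 N_2 \xrightarrow{a}_{\rm a} P_1 \|_L [1]N_2$ and $N_2 \|_L N_1 \xrightarrow{a}_{\rm a} [1]N_2 \|_L P_1$; if $N_i \xrightarrow{a}_{\rm a} P_i$ for $i=1,2$ and $a\in L$ then $N_1 \|_L N_2 \xrightarrow{a}_{\rm a} P_1 \|_L P_2$; if $N \xrightarrow{a}_{\rm a} P$ then $N \setminus L \xrightarrow{a}_{\rm a} P \setminus L$ when $a\notin L$, $N/L \xrightarrow{a}_{\rm a} P/L$ when $a \notin L$, $N/L \xrightarrow{\tau}_{\rm a} P/L$ when $a\in L$, and $NK \xrightarrow{a}_{\rm a} P$ when $NK \triangleq N$. Probabilistic transitions from $\mathbb{P}_{\rm p}$ to $\mathbb{P}_{\rm n}$ form a multirelation (multiplicity = number of different derivations): $\bigoplus_{i\in I}[p_i]N_i \xrightarrow{p_j}_{\rm p} N_j$ for $j \in I$; if $P_i \xrightarrow{p_i}_{\rm p} N_i$ for $i=1,2$ then $P_1\|_L P_2 \xrightarrow{p_1\cdot p_2}_{\rm p} N_1\|_L N_2$; if $P \xrightarrow{p}_{\rm p} N$ then $P\setminus L \xrightarrow{p}_{\rm p} N\setminus L$, $P/L \xrightarrow{p}_{\rm p} N/L$, and $PK \xrightarrow{p}_{\rm p} N$ when $PK \triangleq P$. States in $\mathbb{P}_{\rm n}$ are called nondeterministic, those in $\mathbb{P}_{\rm p}$ probabilistic. A computation is a finite alternating sequence of states and labels following consecutive transitions; $\varepsilon_s$ is the empty computation from $s$. $reach(E)$ is the set of processes reachable from $E$ by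 a computation (including $E$), with the convention that $[1]N \in reach(E)$ whenever $N \in reach(E)$. $s \Longrightarrow s'$ means that $s'=s$ or there is a finite sequence of transitions from $s$ to $s'$ consisting only of $\tau$-transitions alternating with probabilistic transitions. **One-step probabilities.** $prob(s,s') = \sum_{s \xrightarrow{p}_{\rm p} s'} p$ if $s$ is probabilistic; $prob(s,s')=1$ if $s$ is nondeterministic and $s'=s$; $prob(s,s')=0$ otherwise. $prob(s,C)=\sum_{s'\in C} prob(s,s')$. **Schedulers.** A deterministic scheduler $\sigma \in sched(s)$ assigns to each computation $\theta$ from $s$ a value: if the last state $t$ of $\theta$ is nondeterministic, $\sigma(\theta)$ is either $\bot$ (halt) or an action transition with source $t$; if $t$ is probabilistic, $\sigma(\theta)$ is $\bot$ (halt) or $\triangleright$ (continue). For $\Phi \subseteq \mathcal{A}_\tau^*$ and a set $C$ of states, $prob_\sigma(t,\Phi,C,\theta)$ ($\theta$ ending in $t$) is the smallest solution of: $X_\sigma(t,\Phi,C,\theta)=\sum_{t \xrightarrow{p}_{\rm p} t'} p\cdot X_\sigma(t',\Phi,C,\theta\,p\,t')$ if $t$ is probabilistic and $\sigma(\theta)=\triangleright$; $X_\sigma(t',\Phi-a,C,\theta\,a\,t')$ if $\sigma(\theta)= t\xrightarrow{a}_{\rm a}t'$; $1$ if $\sigma(\theta)=\bot$, $\varepsilon\in\Phi$ and $t\in C$; $0$ if $\sigma(\theta)=\bot$ and ($\varepsilon\notin\Phi$ or $t\notin C$). Here $\Phi-a=\{\alpha \mid a\alpha\in\Phi\}$. The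 expression $\tau^*\hat a\tau^*$ denotes $\tau^*a\tau^*$ if $a\neq\tau$ and $\tau^*$ if $a=\tau$. **Weak probabilistic bisimilarity $\approx_{\rm pw}$.** An equivalence relation $\mathcal{B}$ over states is a weak probabilistic bisimulation iff $(s_1,s_2)\in\mathcal{B}$ implies: for each $s_1\xrightarrow{a}_{\rm a}s_1'$ there is $\sigma\in sched(s_2)$ with $prob_\sigma(s_2,\tau^*\hat a\tau^*,[s_1']_{\mathcal{B}},\varepsilon_{s_2})=1$; and $prob(s_1,C)=prob(s_2,C)$ for all equivalence classes $C$ of $\mathcal{B}$. $s_1\approx_{\rm pw}s_2$ iff $(s_1,s_2)$ belongs to some weak probabilistic bisimulation. **Probabilistic branching bisimilarity $\approx_{\rm pb}$.** An equivalence relation $\mathcal{B}$ over states is a probabilistic branching bisimulation iff $(s_1,s_2)\in\mathcal{B}$ implies: for each $s_1\xrightarrow{a}_{\rm a}s_1'$ either $a=\tau$ and $(s_1',s_2)\in\mathcal{B}$, or there is $s_2\Longrightarrow\bar s_2\xrightarrow{a}_{\rm a}s_2'$ with $(s_1,\bar s_2)\in\mathcal{B}$ and $(s_1',s_2')\in\mathcal{B}$; and $prob(s_1,C)=prob(s_2,C)$ for all equivalence classes $C$ of $\mathcal{B}$. $s_1\approx_{\rm pb}s_2$ iff $(s_1,s_2)$ belongs to some probabilistic branching bisimulation. **Security properties.** For $E\in\mathbb{P}$ and $\approx\,\in\{\approx_{\rm pw},\approx_{\rm pb}\}$: $E\in\mathrm{BSNNI}_\approx$ iff $E\setminus\mathcal{A}_{\mathcal{H}}\approx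 E/\mathcal{A}_{\mathcal{H}}$. $E\in\mathrm{BNDC}_\approx$ iff for all $F\in\mathbb{P}$ such that each action occurring in $F$ belongs to $\mathcal{A}_{\mathcal{H}}$ and all $L\subseteq\mathcal{A}_{\mathcal{H}}$, $E\setminus\mathcal{A}_{\mathcal{H}}\approx((E\|_LF)/L)\setminus\mathcal{A}_{\mathcal{H}}$ when $E,F\in\mathbb{P}_{\rm n}$ or $E,F\in\mathbb{P}_{\rm p}$. $E\in\mathrm{SBSNNI}_\approx$ (resp. $\mathrm{P\_BNDC}_\approx$) iff every $E'\in reach(E)$ is in $\mathrm{BSNNI}_\approx$ (resp. $\mathrm{BNDC}_\approx$). $E\in\mathrm{SBNDC}_\approx$ iff for all $E',E''\in reach(E)$ and $h\in\mathcal{A}_{\mathcal{H}}$ with $E'\xrightarrow{h}_{\rm a}E''$, $E'\setminus\mathcal{A}_{\mathcal{H}}\approx E''\setminus\mathcal{A}_{\mathcal{H}}$. *)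

theory Defs
  imports "HOL-Analysis.Analysis"
begin

section \<open>Process terms\<close>

text \<open>The type \<open>'a\<close> is the set of observable actions, \<open>'c\<close> and \<open>'d\<close> are the names of the
  nondeterministic and of the probabilistic process constants.\<close>

datatype 'a act = Tau | Obs 'a

text \<open>The family \<open>([p\<^sub>i]N\<^sub>i)\<^sub>i\<^sub>\<in>\<^sub>I\<close> below a probabilistic choice is a list, so \<open>I = {0..<n}\<close>
  and equal summands may be repeated.\<close>

datatype ('a, 'c, 'd) nterm =
    NZero
  | NPrefix "'a act" "('a, 'c, 'd) pterm"
  | NPlus "('a, 'c, 'd) nterm" "('a, 'c, 'd) nterm"
  | NPar "('a, 'c, 'd) nterm" "'a set" "('a, 'c, 'd) nterm"
  | NRes "('a, 'c, 'd) nterm" "'a set"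
  | NHide "('a, 'c, 'd) nterm" "'a set"
  | NConst 'c
and ('a, 'c, 'd) pterm =
    PChoice "(real \<times> ('a, 'c, 'd) nterm) list"
  | PPar "('a, 'c, 'd) pterm" "'a set" "('a, 'c, 'd) pterm"
  | PRes "('a, 'c, 'd) pterm" "'a set"
  | PHide "('a, 'c, 'd) pterm" "'a set"
  | PConst 'd

abbreviation PDirac :: "('a, 'c, 'd) nterm \<Rightarrow> ('a, 'c, 'd) pterm" where
  "PDirac N \<equiv> PChoice [(1, N)]"

text \<open>The datatypes allow arbitrary weights; the terms of the calculus are the following ones.\<close>

inductive wf_nterm :: "('a, 'c, 'd) nterm \<Rightarrow> bool"
  and wf_pterm :: "('a, 'c, 'd) pterm \<Rightarrow> bool" where
  "wf_nterm NZero"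
| "wf_pterm P \<Longrightarrow> wf_nterm (NPrefix a P)"
| "wf_nterm N1 \<Longrightarrow> wf_nterm N2 \<Longrightarrow> wf_nterm (NPlus N1 N2)"
| "wf_nterm N1 \<Longrightarrow> wf_nterm N2 \<Longrightarrow> wf_nterm (NPar N1 L N2)"
| "wf_nterm N \<Longrightarrow> wf_nterm (NRes N L)"
| "wf_nterm N \<Longrightarrow> wf_nterm (NHide N L)"
| "wf_nterm (NConst K)"
| "xs \<noteq> [] \<Longrightarrow> (\<And>p N. (p, N) \<in> set xs \<Longrightarrow> 0 < p \<and> p \<le> 1) \<Longrightarrow> sum_list (map fst xs) = 1
    \<Longrightarrow> (\<And>p N. (p, N) \<in> set xs \<Longrightarrow> wf_nterm N) \<Longrightarrow> wf_pterm (PChoice xs)"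
| "wf_pterm P1 \<Longrightarrow> wf_pterm P2 \<Longrightarrow> wf_pterm (PPar P1 L P2)"
| "wf_pterm P \<Longrightarrow> wf_pterm (PRes P L)"
| "wf_pterm P \<Longrightarrow> wf_pterm (PHide P L)"
| "wf_pterm (PConst K)"

text \<open>Every constant of the term occurs in the scope of an action prefix.\<close>

inductive guarded_nterm :: "('a, 'c, 'd) nterm \<Rightarrow> bool"
  and guarded_pterm :: "('a, 'c, 'd) pterm \<Rightarrow> bool" where
  "guarded_nterm NZero"
| "guarded_nterm (NPrefix a P)"
| "guarded_nterm N1 \<Longrightarrow> guarded_nterm N2 \<Longrightarrow> guarded_nterm (NPlus N1 N2)"
| "guarded_nterm N1 \<Longrightarrow> guarded_nterm N2 \<Longrightarrow> guarded_nterm (NPar N1 L N2)"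
| "guarded_nterm N \<Longrightarrow> guarded_nterm (NRes N L)"
| "guarded_nterm N \<Longrightarrow> guarded_nterm (NHide N L)"
| "(\<And>p N. (p, N) \<in> set xs \<Longrightarrow> guarded_nterm N) \<Longrightarrow> guarded_pterm (PChoice xs)"
| "guarded_pterm P1 \<Longrightarrow> guarded_pterm P2 \<Longrightarrow> guarded_pterm (PPar P1 L P2)"
| "guarded_pterm P \<Longrightarrow> guarded_pterm (PRes P L)"
| "guarded_pterm P \<Longrightarrow> guarded_pterm (PHide P L)"

text \<open>An environment gives the right-hand sides of the defining equations of all constants.\<close>

type_synonym ('a, 'c, 'd) env = "('c \<Rightarrow> ('a, 'c, 'd) nterm) \<times> ('d \<Rightarrow> ('a, 'c, 'd) pterm)"

definition wf_env :: "('a, 'c, 'd) env \<Rightarrow> bool" where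
  "wf_env \<Gamma> \<longleftrightarrow> (\<forall>K. wf_nterm (fst \<Gamma> K) \<and> guarded_nterm (fst \<Gamma> K))
     \<and> (\<forall>K. wf_pterm (snd \<Gamma> K) \<and> guarded_pterm (snd \<Gamma> K))"

datatype ('a, 'c, 'd) proc = Nd "('a, 'c, 'd) nterm" | Pr "('a, 'c, 'd) pterm"

definition nprocs :: "('a, 'c, 'd) proc set" where
  "nprocs = {Nd N | N. wf_nterm N}"

definition pprocs :: "('a, 'c, 'd) proc set" where
  "pprocs = {Pr P | P. wf_pterm P}"

definition procs :: "('a, 'c, 'd) proc set" where
  "procs = nprocs \<union> pprocs"

fun res :: "('a, 'c, 'd) proc \<Rightarrow> 'a set \<Rightarrow> ('a, 'c, 'd) proc" where
  "res (Nd N) L = Nd (NRes N L)"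
| "res (Pr P) L = Pr (PRes P L)"

fun hide :: "('a, 'c, 'd) proc \<Rightarrow> 'a set \<Rightarrow> ('a, 'c, 'd) proc" where
  "hide (Nd N) L = Nd (NHide N L)"
| "hide (Pr P) L = Pr (PHide P L)"

text \<open>Parallel composition is meaningful only for two processes of the same kind.\<close>

fun par :: "('a, 'c, 'd) proc \<Rightarrow> 'a set \<Rightarrow> ('a, 'c, 'd) proc \<Rightarrow> ('a, 'c, 'd) proc" where
  "par (Nd N1) L (Nd N2) = Nd (NPar N1 L N2)"
| "par (Pr P1) L (Pr P2) = Pr (PPar P1 L P2)"
| "par _ _ _ = undefined"


section \<open>Semantics\<close>

inductive atrans ::
  "('a, 'c, 'd) env \<Rightarrow> ('a, 'c, 'd) nterm \<Rightarrow> 'a act \<Rightarrow> ('a, 'c, 'd) pterm \<Rightarrow> bool"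
  for \<Gamma> :: "('a, 'c, 'd) env" where
  "atrans \<Gamma> (NPrefix a P) a P"
| "atrans \<Gamma> N1 a P1 \<Longrightarrow> atrans \<Gamma> (NPlus N1 N2) a P1"
| "atrans \<Gamma> N1 a P1 \<Longrightarrow> atrans \<Gamma> (NPlus N2 N1) a P1"
| "atrans \<Gamma> N1 a P1 \<Longrightarrow> a \<notin> Obs ` L \<Longrightarrow> atrans \<Gamma> (NPar N1 L N2) a (PPar P1 L (PDirac N2))"
| "atrans \<Gamma> N1 a P1 \<Longrightarrow> a \<notin> Obs ` L \<Longrightarrow> atrans \<Gamma> (NPar N2 L N1) a (PPar (PDirac N2) L P1)"
| "atrans \<Gamma> N1 a P1 \<Longrightarrow> atrans \<Gamma> N2 a P2 \<Longrightarrow> a \<in> Obs ` L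
    \<Longrightarrow> atrans \<Gamma> (NPar N1 L N2) a (PPar P1 L P2)"
| "atrans \<Gamma> N a P \<Longrightarrow> a \<notin> Obs ` L \<Longrightarrow> atrans \<Gamma> (NRes N L) a (PRes P L)"
| "atrans \<Gamma> N a P \<Longrightarrow> a \<notin> Obs ` L \<Longrightarrow> atrans \<Gamma> (NHide N L) a (PHide P L)"
| "atrans \<Gamma> N a P \<Longrightarrow> a \<in> Obs ` L \<Longrightarrow> atrans \<Gamma> (NHide N L) Tau (PHide P L)"
| "atrans \<Gamma> (fst \<Gamma> K) a P \<Longrightarrow> atrans \<Gamma> (NConst K) a P"

text \<open>The probabilistic transitions form a multirelation. This is rendered by an additional
  argument that records the derivation, so that the multiplicity of a transition from
  \<open>P\<close> to \<open>N\<close> with probability \<open>p\<close> is the number of \<open>d\<close> with \<open>ptrans \<Gamma> P d p N\<close>.\<close>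

datatype deriv = DChoice nat | DPar deriv deriv | DRes deriv | DHide deriv | DConst deriv

inductive ptrans ::
  "('a, 'c, 'd) env \<Rightarrow> ('a, 'c, 'd) pterm \<Rightarrow> deriv \<Rightarrow> real \<Rightarrow> ('a, 'c, 'd) nterm \<Rightarrow> bool"
  for \<Gamma> :: "('a, 'c, 'd) env" where
  "j < length xs \<Longrightarrow> xs ! j = (p, N) \<Longrightarrow> ptrans \<Gamma> (PChoice xs) (DChoice j) p N"
| "ptrans \<Gamma> P1 d1 p1 N1 \<Longrightarrow> ptrans \<Gamma> P2 d2 p2 N2
    \<Longrightarrow> ptrans \<Gamma> (PPar P1 L P2) (DPar d1 d2) (p1 * p2) (NPar N1 L N2)"
| "ptrans \<Gamma> P d p N \<Longrightarrow> ptrans \<Gamma> (PRes P L) (DRes d) p (NRes N L)"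
| "ptrans \<Gamma> P d p N \<Longrightarrow> ptrans \<Gamma> (PHide P L) (DHide d) p (NHide N L)"
| "ptrans \<Gamma> (snd \<Gamma> K) d p N \<Longrightarrow> ptrans \<Gamma> (PConst K) (DConst d) p N"

datatype 'a label = LAct "'a act" | LProb real

inductive step ::
  "('a, 'c, 'd) env \<Rightarrow> ('a, 'c, 'd) proc \<Rightarrow> 'a label \<Rightarrow> ('a, 'c, 'd) proc \<Rightarrow> bool"
  for \<Gamma> :: "('a, 'c, 'd) env" where
  "atrans \<Gamma> N a P \<Longrightarrow> step \<Gamma> (Nd N) (LAct a) (Pr P)"
| "ptrans \<Gamma> P d p N \<Longrightarrow> step \<Gamma> (Pr P) (LProb p) (Nd N)"

text \<open>A computation is its first state together with the list of the subsequent labels and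
  states.\<close>

type_synonym ('a, 'c, 'd) comp =
  "('a, 'c, 'd) proc \<times> ('a label \<times> ('a, 'c, 'd) proc) list"

abbreviation empty_comp :: "('a, 'c, 'd) proc \<Rightarrow> ('a, 'c, 'd) comp" where
  "empty_comp s \<equiv> (s, [])"

definition last_state :: "('a, 'c, 'd) comp \<Rightarrow> ('a, 'c, 'd) proc" where
  "last_state \<theta> = last (fst \<theta> # map snd (snd \<theta>))"

definition extend ::
  "('a, 'c, 'd) comp \<Rightarrow> 'a label \<Rightarrow> ('a, 'c, 'd) proc \<Rightarrow> ('a, 'c, 'd) comp" where
  "extend \<theta> l s = (fst \<theta>, snd \<theta> @ [(l, s)])"

inductive_set comps :: "('a, 'c, 'd) env \<Rightarrow> ('a, 'c, 'd) proc \<Rightarrow> ('a, 'c, 'd) comp set"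
  for \<Gamma> :: "('a, 'c, 'd) env" and s :: "('a, 'c, 'd) proc" where
  "empty_comp s \<in> comps \<Gamma> s"
| "\<theta> \<in> comps \<Gamma> s \<Longrightarrow> step \<Gamma> (last_state \<theta>) l t \<Longrightarrow> extend \<theta> l t \<in> comps \<Gamma> s"

definition reach :: "('a, 'c, 'd) env \<Rightarrow> ('a, 'c, 'd) proc \<Rightarrow> ('a, 'c, 'd) proc set" where
  "reach \<Gamma> E = last_state ` comps \<Gamma> E \<union> {Pr (PDirac N) | N. Nd N \<in> last_state ` comps \<Gamma> E}"

text \<open>The alternation in the definition of \<open>s \<Longrightarrow> s'\<close> is automatic, because action transitions lead
  from nondeterministic to probabilistic states and vice versa.\<close>

definition silent_step ::
  "('a, 'c, 'd) env \<Rightarrow> ('a, 'c, 'd) proc \<Rightarrow> ('a, 'c, 'd) proc \<Rightarrow> bool" where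
  "silent_step \<Gamma> s s' \<longleftrightarrow> step \<Gamma> s (LAct Tau) s' \<or> (\<exists>p. step \<Gamma> s (LProb p) s')"

definition silent_reach ::
  "('a, 'c, 'd) env \<Rightarrow> ('a, 'c, 'd) proc \<Rightarrow> ('a, 'c, 'd) proc \<Rightarrow> bool" where
  "silent_reach \<Gamma> = (silent_step \<Gamma>)\<^sup>*\<^sup>*"


section \<open>Probabilities and schedulers\<close>

text \<open>For an environment with guarded equations, a probabilistic state has finitely many
  outgoing transitions, so the sums below are finite.\<close>

fun step_prob :: "('a, 'c, 'd) env \<Rightarrow> ('a, 'c, 'd) proc \<Rightarrow> ('a, 'c, 'd) proc \<Rightarrow> real" where
  "step_prob \<Gamma> (Pr P) (Nd N) = (\<Sum>(d, p)\<in>{(d, p). ptrans \<Gamma> P d p N}. p)"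
| "step_prob \<Gamma> (Pr P) (Pr Q) = 0"
| "step_prob \<Gamma> (Nd N) s' = (if s' = Nd N then 1 else 0)"

text \<open>The set \<open>C\<close> may be infinite, for which \<^const>\<open>sum\<close> is not suitable.\<close>

definition class_prob ::
  "('a, 'c, 'd) env \<Rightarrow> ('a, 'c, 'd) proc \<Rightarrow> ('a, 'c, 'd) proc set \<Rightarrow> real" where
  "class_prob \<Gamma> s C = (\<Sum>\<^sub>\<infinity>s'\<in>C. step_prob \<Gamma> s s')"

text \<open>The source of the action transition chosen by a scheduler is the last state of the
  computation; \<open>Fire a P\<close> records its label and its target.\<close>

datatype ('a, 'c, 'd) decision = Halt | Continue | Fire "'a act" "('a, 'c, 'd) pterm"

type_synonym ('a, 'c, 'd) scheduler = "('a, 'c, 'd) comp \<Rightarrow> ('a, 'c, 'd) decision"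

definition sched ::
  "('a, 'c, 'd) env \<Rightarrow> ('a, 'c, 'd) proc \<Rightarrow> ('a, 'c, 'd) scheduler set" where
  "sched \<Gamma> s = {\<sigma>. \<forall>\<theta>\<in>comps \<Gamma> s.
     (case last_state \<theta> of
        Nd N \<Rightarrow> \<sigma> \<theta> = Halt \<or> (\<exists>a P. atrans \<Gamma> N a P \<and> \<sigma> \<theta> = Fire a P)
      | Pr P \<Rightarrow> \<sigma> \<theta> = Halt \<or> \<sigma> \<theta> = Continue)}"

text \<open>The right-hand side of the equation system for \<open>prob\<^sub>\<sigma>(t, \<Phi>, C, \<theta>)\<close>. The state \<open>t\<close> is always the
  last one of \<open>\<theta>\<close> and is not a separate argument; \<open>C\<close> is the same in all equations. The last
  case does not occur for a scheduler and a computation from its initial state. The smallest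
  solution is taken in the complete lattice of functions into \<^typ>\<open>ennreal\<close>.\<close>

definition sched_eqs ::
  "('a, 'c, 'd) env \<Rightarrow> ('a, 'c, 'd) scheduler \<Rightarrow> ('a, 'c, 'd) proc set
    \<Rightarrow> ('a act list set \<Rightarrow> ('a, 'c, 'd) comp \<Rightarrow> ennreal)
    \<Rightarrow> ('a act list set \<Rightarrow> ('a, 'c, 'd) comp \<Rightarrow> ennreal)" where
  "sched_eqs \<Gamma> \<sigma> C X \<Phi> \<theta> =
     (case (last_state \<theta>, \<sigma> \<theta>) of
        (Pr P, Continue) \<Rightarrow>
          (\<Sum>(d, p, N)\<in>{(d, p, N). ptrans \<Gamma> P d p N}.
             ennreal p * X \<Phi> (extend \<theta> (LProb p) (Nd N)))
      | (Nd N, Fire a P) \<Rightarrow> X {\<alpha>. a # \<alpha> \<in> \<Phi>} (extend \<theta> (LAct a) (Pr P))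
      | (t, Halt) \<Rightarrow> if [] \<in> \<Phi> \<and> t \<in> C then 1 else 0
      | _ \<Rightarrow> 0)"

definition sched_prob ::
  "('a, 'c, 'd) env \<Rightarrow> ('a, 'c, 'd) scheduler \<Rightarrow> 'a act list set \<Rightarrow> ('a, 'c, 'd) proc set
    \<Rightarrow> ('a, 'c, 'd) comp \<Rightarrow> ennreal" where
  "sched_prob \<Gamma> \<sigma> \<Phi> C \<theta> = lfp (sched_eqs \<Gamma> \<sigma> C) \<Phi> \<theta>"

definition weak_words :: "'a act \<Rightarrow> 'a act list set" where
  "weak_words a =
     (if a = Tau then {replicate m Tau | m. True}
      else {replicate m Tau @ [a] @ replicate n Tau | m n. True})"


section \<open>Bisimilarities\<close>

definition weak_prob_bisimulation ::
  "('a, 'c, 'd) env \<Rightarrow> ('a, 'c, 'd) proc rel \<Rightarrow> bool" where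
  "weak_prob_bisimulation \<Gamma> B \<longleftrightarrow> equiv procs B \<and>
     (\<forall>(s1, s2)\<in>B.
        (\<forall>a s1'. step \<Gamma> s1 (LAct a) s1' \<longrightarrow>
           (\<exists>\<sigma>\<in>sched \<Gamma> s2. sched_prob \<Gamma> \<sigma> (weak_words a) (B `` {s1'}) (empty_comp s2) = 1)) \<and>
        (\<forall>C\<in>procs // B. class_prob \<Gamma> s1 C = class_prob \<Gamma> s2 C))"

definition weak_prob_bisimilarity :: "('a, 'c, 'd) env \<Rightarrow> ('a, 'c, 'd) proc rel" where
  "weak_prob_bisimilarity \<Gamma> = \<Union>{B. weak_prob_bisimulation \<Gamma> B}"

definition prob_branching_bisimulation ::
  "('a, 'c, 'd) env \<Rightarrow> ('a, 'c, 'd) proc rel \<Rightarrow> bool" where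
  "prob_branching_bisimulation \<Gamma> B \<longleftrightarrow> equiv procs B \<and>
     (\<forall>(s1, s2)\<in>B.
        (\<forall>a s1'. step \<Gamma> s1 (LAct a) s1' \<longrightarrow>
           a = Tau \<and> (s1', s2) \<in> B \<or>
           (\<exists>s2_bar s2'. silent_reach \<Gamma> s2 s2_bar \<and> step \<Gamma> s2_bar (LAct a) s2' \<and>
              (s1, s2_bar) \<in> B \<and> (s1', s2') \<in> B)) \<and>
        (\<forall>C\<in>procs // B. class_prob \<Gamma> s1 C = class_prob \<Gamma> s2 C))"

definition prob_branching_bisimilarity :: "('a, 'c, 'd) env \<Rightarrow> ('a, 'c, 'd) proc rel" where
  "prob_branching_bisimilarity \<Gamma> = \<Union>{B. prob_branching_bisimulation \<Gamma> B}"


section \<open>Security properties\<close>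

text \<open>The actions occurring in a process are those in its action prefixes, including the
  prefixes in the defining equations of the constants that it uses (directly or not). An
  occurrence of \<open>\<tau>\<close> counts, so a process all of whose actions are high-level contains no
  \<open>\<tau>\<close>-prefix.\<close>

inductive occurs_n :: "('a, 'c, 'd) env \<Rightarrow> 'a act \<Rightarrow> ('a, 'c, 'd) nterm \<Rightarrow> bool"
  and occurs_p :: "('a, 'c, 'd) env \<Rightarrow> 'a act \<Rightarrow> ('a, 'c, 'd) pterm \<Rightarrow> bool"
  for \<Gamma> :: "('a, 'c, 'd) env" where
  "occurs_n \<Gamma> a (NPrefix a P)"
| "occurs_p \<Gamma> a P \<Longrightarrow> occurs_n \<Gamma> a (NPrefix b P)"
| "occurs_n \<Gamma> a N1 \<or> occurs_n \<Gamma> a N2 \<Longrightarrow> occurs_n \<Gamma> a (NPlus N1 N2)"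
| "occurs_n \<Gamma> a N1 \<or> occurs_n \<Gamma> a N2 \<Longrightarrow> occurs_n \<Gamma> a (NPar N1 L N2)"
| "occurs_n \<Gamma> a N \<Longrightarrow> occurs_n \<Gamma> a (NRes N L)"
| "occurs_n \<Gamma> a N \<Longrightarrow> occurs_n \<Gamma> a (NHide N L)"
| "occurs_n \<Gamma> a (fst \<Gamma> K) \<Longrightarrow> occurs_n \<Gamma> a (NConst K)"
| "(p, N) \<in> set xs \<Longrightarrow> occurs_n \<Gamma> a N \<Longrightarrow> occurs_p \<Gamma> a (PChoice xs)"
| "occurs_p \<Gamma> a P1 \<or> occurs_p \<Gamma> a P2 \<Longrightarrow> occurs_p \<Gamma> a (PPar P1 L P2)"
| "occurs_p \<Gamma> a P \<Longrightarrow> occurs_p \<Gamma> a (PRes P L)"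
| "occurs_p \<Gamma> a P \<Longrightarrow> occurs_p \<Gamma> a (PHide P L)"
| "occurs_p \<Gamma> a (snd \<Gamma> K) \<Longrightarrow> occurs_p \<Gamma> a (PConst K)"

fun occurs :: "('a, 'c, 'd) env \<Rightarrow> 'a act \<Rightarrow> ('a, 'c, 'd) proc \<Rightarrow> bool" where
  "occurs \<Gamma> a (Nd N) = occurs_n \<Gamma> a N"
| "occurs \<Gamma> a (Pr P) = occurs_p \<Gamma> a P"

text \<open>In the following definitions, \<open>AH\<close> is the set of high-level actions and \<open>R\<close> is the
  bisimilarity.\<close>

definition BSNNI :: "'a set \<Rightarrow> ('a, 'c, 'd) proc rel \<Rightarrow> ('a, 'c, 'd) proc set" where
  "BSNNI AH R = {E \<in> procs. (res E AH, hide E AH) \<in> R}"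

definition BNDC ::
  "('a, 'c, 'd) env \<Rightarrow> 'a set \<Rightarrow> ('a, 'c, 'd) proc rel \<Rightarrow> ('a, 'c, 'd) proc set" where
  "BNDC \<Gamma> AH R = {E \<in> procs. \<forall>F\<in>procs. \<forall>L.
     (\<forall>a. occurs \<Gamma> a F \<longrightarrow> a \<in> Obs ` AH) \<longrightarrow> L \<subseteq> AH \<longrightarrow>
     (E \<in> nprocs \<and> F \<in> nprocs \<or> E \<in> pprocs \<and> F \<in> pprocs) \<longrightarrow>
     (res E AH, res (hide (par E L F) L) AH) \<in> R}"

definition SBSNNI ::
  "('a, 'c, 'd) env \<Rightarrow> 'a set \<Rightarrow> ('a, 'c, 'd) proc rel \<Rightarrow> ('a, 'c, 'd) proc set" where
  "SBSNNI \<Gamma> AH R = {E \<in> procs. \<forall>E'\<in>reach \<Gamma> E. E' \<in> BSNNI AH R}"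

definition P_BNDC ::
  "('a, 'c, 'd) env \<Rightarrow> 'a set \<Rightarrow> ('a, 'c, 'd) proc rel \<Rightarrow> ('a, 'c, 'd) proc set" where
  "P_BNDC \<Gamma> AH R = {E \<in> procs. \<forall>E'\<in>reach \<Gamma> E. E' \<in> BNDC \<Gamma> AH R}"

definition SBNDC ::
  "('a, 'c, 'd) env \<Rightarrow> 'a set \<Rightarrow> ('a, 'c, 'd) proc rel \<Rightarrow> ('a, 'c, 'd) proc set" where
  "SBNDC \<Gamma> AH R = {E \<in> procs. \<forall>E'\<in>reach \<Gamma> E. \<forall>E''\<in>reach \<Gamma> E. \<forall>h\<in>AH.
     step \<Gamma> E' (LAct (Obs h)) E'' \<longrightarrow> (res E' AH, res E'' AH) \<in> R}"

end

theory Submission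
  imports Defs "HOL-Probability.Probability"
begin

text \<open>All three security properties amount to unwinding conditions on the reachable high-level
  transitions \<open>s --h--> t\<close>: for SBSNNI and P-BNDC, the restriction of \<open>s\<close> to low-level actions can
  match a silent transition into the bisimilarity class of the restriction of \<open>t\<close>; for SBNDC, the two
  restrictions are bisimilar. Such conditions carry over to any context under which bisimilarity
  is compatible with the restriction.

  In the weak case, a scheduler that reaches a class with probability 1 cannot be imitated
  branch by branch, because a bisimilar state may have fewer branches and schedulers are
  deterministic. Instead, having such a scheduler is shown to be equivalent to a coinductive
  property of the state: the configurations with the property have reachability value 1 in the game
  that never leaves them. This property is invariant under bisimilarity because values are monotone
  along couplings.\<close>

section \<open>Transitions and one-step distributions\<close>

text \<open>A move of \<open>hide X AH\<close>, or of \<open>X\<close> composed with a high-level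
  process, is a low or silent move of \<open>X\<close>, a silent move of the high-level process
  alone, or a high move of \<open>X\<close> made silent. \<open>res X AH\<close> can make the first
  itself, answers the second by staying, and answers the third by the unwinding condition.
  Conversely, both kinds of context can provoke every high move, so SBSNNI and P-BNDC have the same
  unwinding condition. Bisimilarity is a union of equivalences, which need not be transitive. Its
  transitive closure must be shown to be a bisimulation, and for this the ability to answer a move
  has to be invariant under bisimulation. In the weak case this is the hard point. Parallel
  composition relies on the branching condition: an answer is given from a state bisimilar to the
  starting one, so one component can advance silently while the pair stays in its class. The idle
  component then becomes \<open>PDirac N\<close>, which has to be identified with \<open>N\<close>
  up to bisimilarity.\<close>

inductive_cases guarded_ptermE:
  "guarded_pterm (PChoice xs)" "guarded_pterm (PPar P1 L P2)" "guarded_pterm (PRes P L)"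
  "guarded_pterm (PHide P L)" "guarded_pterm (PConst K)"
inductive_cases ptransE:
  "ptrans \<Gamma> (PChoice xs) d p N" "ptrans \<Gamma> (PPar P1 L P2) d p N" "ptrans \<Gamma> (PRes P L) d p N"
  "ptrans \<Gamma> (PHide P L) d p N" "ptrans \<Gamma> (PConst K) d p N"

lemma wf_simps [simp]:
  "wf_nterm NZero" "wf_nterm (NConst K)" "wf_pterm (PConst K')"
  "wf_nterm (NPrefix a P) \<longleftrightarrow> wf_pterm P"
  "wf_nterm (NPlus N1 N2) \<longleftrightarrow> wf_nterm N1 \<and> wf_nterm N2"
  "wf_nterm (NPar N1 L N2) \<longleftrightarrow> wf_nterm N1 \<and> wf_nterm N2"
  "wf_nterm (NRes N1 L) \<longleftrightarrow> wf_nterm N1"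
  "wf_nterm (NHide N1 L) \<longleftrightarrow> wf_nterm N1"
  "wf_pterm (PPar P1 L P2) \<longleftrightarrow> wf_pterm P1 \<and> wf_pterm P2"
  "wf_pterm (PRes P1 L) \<longleftrightarrow> wf_pterm P1"
  "wf_pterm (PHide P1 L) \<longleftrightarrow> wf_pterm P1"
  by (subst wf_nterm.simps wf_pterm.simps, simp)+

lemma wf_PChoice: "wf_pterm (PChoice xs) \<longleftrightarrow> xs \<noteq> [] \<and>
    (\<forall>(p, N)\<in>set xs. 0 < p \<and> p \<le> 1 \<and> wf_nterm N) \<and> sum_list (map fst xs) = 1"
  by (subst wf_pterm.simps) auto

lemma wf_PDirac [simp]: "wf_pterm (PDirac N) \<longleftrightarrow> wf_nterm N"
  by (simp add: wf_PChoice)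

section \<open>Derivations of probabilistic transitions and their weighted sums\<close>

definition derivs :: "('a, 'c, 'd) env \<Rightarrow> ('a, 'c, 'd) pterm \<Rightarrow> (deriv \<times> real \<times> ('a, 'c, 'd) nterm) set"
  where "derivs \<Gamma> P = {(d, p, N). ptrans \<Gamma> P d p N}"

lemma derivs_PChoice: "derivs \<Gamma> (PChoice xs) = (\<lambda>j. (DChoice j, xs ! j)) ` {..<length xs}"
  by (auto simp: derivs_def image_iff elim!: ptransE intro: ptrans.intros)

lemma derivs_PPar: "derivs \<Gamma> (PPar P1 L P2) =
   (\<lambda>((d1, p1, N1), (d2, p2, N2)). (DPar d1 d2, p1 * p2, NPar N1 L N2)) ` (derivs \<Gamma> P1 \<times> derivs \<Gamma> P2)"
  by (force simp: derivs_def image_iff elim!: ptransE intro: ptrans.intros)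

lemma derivs_PRes: "derivs \<Gamma> (PRes P L) = (\<lambda>(d, p, N). (DRes d, p, NRes N L)) ` derivs \<Gamma> P"
  by (force simp: derivs_def image_iff elim!: ptransE intro: ptrans.intros)

lemma derivs_PHide: "derivs \<Gamma> (PHide P L) = (\<lambda>(d, p, N). (DHide d, p, NHide N L)) ` derivs \<Gamma> P"
  by (force simp: derivs_def image_iff elim!: ptransE intro: ptrans.intros)

lemma derivs_PConst: "derivs \<Gamma> (PConst K) = (\<lambda>(d, p, N). (DConst d, p, N)) ` derivs \<Gamma> (snd \<Gamma> K)"
  by (force simp: derivs_def image_iff elim!: ptransE intro: ptrans.intros)

text \<open>Needed for injectivity of pairing derivations in a parallel composition: the combined
  triple keeps only the product of the two probabilities, but the two derivations determine the
  factors.\<close>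

lemma ptrans_unique: "ptrans \<Gamma> P d p N \<Longrightarrow> ptrans \<Gamma> P d p' N' \<Longrightarrow> p' = p \<and> N' = N"
proof (induction arbitrary: p' N' rule: ptrans.induct)
  case (1 j xs p N)
  show ?case using "1.prems" "1.hyps" by (cases rule: ptrans.cases) auto
next
  case (2 P1 d1 p1 N1 P2 d2 p2 N2 L)
  show ?case using "2.prems" by (cases rule: ptrans.cases) (auto dest: "2.IH")
next
  case (3 P d p N L)
  show ?case using "3.prems" by (cases rule: ptrans.cases) (auto dest: "3.IH")
next
  case (4 P d p N L)
  show ?case using "4.prems" by (cases rule: ptrans.cases) (auto dest: "4.IH")
next
  case (5 K d p N)
  show ?case using "5.prems" by (cases rule: ptrans.cases) (auto dest: "5.IH")
qed

text \<open>The expectation of \<open>f\<close> after one probabilistic step. Summing over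
  derivations instead of targets accounts for multiplicities.\<close>

definition weighted_sum ::
  "('a, 'c, 'd) env \<Rightarrow> ('a, 'c, 'd) pterm \<Rightarrow> (('a, 'c, 'd) nterm \<Rightarrow> ennreal) \<Rightarrow> ennreal" where
  "weighted_sum \<Gamma> P f = (\<Sum>(d, p, N)\<in>derivs \<Gamma> P. ennreal p * f N)"

definition stochastic :: "('a, 'c, 'd) env \<Rightarrow> ('a, 'c, 'd) pterm \<Rightarrow> bool" where
  "stochastic \<Gamma> P \<longleftrightarrow> finite (derivs \<Gamma> P) \<and> (\<forall>(d, p, N)\<in>derivs \<Gamma> P. 0 < p \<and> wf_nterm N) \<and>
     weighted_sum \<Gamma> P (\<lambda>_. 1) = 1"

lemma weighted_sum_PChoice:
  "weighted_sum \<Gamma> (PChoice xs) f = (\<Sum>j<length xs. ennreal (fst (xs ! j)) * f (snd (xs ! j)))"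
  unfolding weighted_sum_def derivs_PChoice
  by (subst sum.reindex) (auto simp: inj_on_def case_prod_beta)

text \<open>The sign condition makes \<open>ennreal\<close>, which truncates negative reals to 0,
  multiplicative on the weights. The iterated sum is the expectation under two independent
  draws.\<close>

lemma weighted_sum_PPar:
  assumes "\<forall>(d, p, N)\<in>derivs \<Gamma> P1. 0 < p"
  shows "weighted_sum \<Gamma> (PPar P1 L P2) f =
    weighted_sum \<Gamma> P1 (\<lambda>N1. weighted_sum \<Gamma> P2 (\<lambda>N2. f (NPar N1 L N2)))"
proof -
  have "weighted_sum \<Gamma> (PPar P1 L P2) f =
      (\<Sum>x\<in>derivs \<Gamma> P1 \<times> derivs \<Gamma> P2. (case x of ((d1, p1, N1), (d2, p2, N2)) \<Rightarrow> ennreal (p1 * p2) * f (NPar N1 L N2)))"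
    unfolding weighted_sum_def derivs_PPar
    apply (subst sum.reindex)
    subgoal by (clarsimp simp: inj_on_def derivs_def) (metis ptrans_unique)
    by (simp add: case_prod_beta)
  also have "\<dots> = (\<Sum>x\<in>derivs \<Gamma> P1. \<Sum>y\<in>derivs \<Gamma> P2. (case (x, y) of ((d1, p1, N1), (d2, p2, N2)) \<Rightarrow> ennreal (p1 * p2) * f (NPar N1 L N2)))"
    by (simp add: sum.cartesian_product)
  also have "\<dots> = weighted_sum \<Gamma> P1 (\<lambda>N1. weighted_sum \<Gamma> P2 (\<lambda>N2. f (NPar N1 L N2)))"
    unfolding weighted_sum_def using assms
    by (intro sum.cong refl)
      (auto simp: sum_distrib_left ennreal_mult'' ennreal_mult' mult.assoc case_prod_beta intro!: sum.cong)
  finally show ?thesis .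
qed

lemma weighted_sum_PRes: "weighted_sum \<Gamma> (PRes P L) f = weighted_sum \<Gamma> P (\<lambda>N. f (NRes N L))"
  unfolding weighted_sum_def derivs_PRes
  by (subst sum.reindex) (auto simp: inj_on_def case_prod_beta)

lemma weighted_sum_PHide: "weighted_sum \<Gamma> (PHide P L) f = weighted_sum \<Gamma> P (\<lambda>N. f (NHide N L))"
  unfolding weighted_sum_def derivs_PHide
  by (subst sum.reindex) (auto simp: inj_on_def case_prod_beta)

lemma weighted_sum_PConst: "weighted_sum \<Gamma> (PConst K) f = weighted_sum \<Gamma> (snd \<Gamma> K) f"
  unfolding weighted_sum_def derivs_PConst
  by (subst sum.reindex) (auto simp: inj_on_def case_prod_beta)

lemma stochastic_PChoice:
  assumes "wf_pterm (PChoice xs)"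
  shows "stochastic \<Gamma> (PChoice xs)"
proof -
  have pos: "0 < fst (xs ! j) \<and> wf_nterm (snd (xs ! j))" if "j < length xs" for j
    using assms that nth_mem[OF that] by (auto simp: wf_PChoice case_prod_beta)
  have "(\<Sum>j<length xs. ennreal (fst (xs ! j))) = ennreal (\<Sum>j<length xs. fst (xs ! j))"
    using pos by (intro sum_ennreal) (auto intro: less_imp_le)
  also have "(\<Sum>j<length xs. fst (xs ! j)) = sum_list (map fst xs)"
    by (simp add: sum_list_sum_nth atLeast0LessThan)
  finally have "weighted_sum \<Gamma> (PChoice xs) (\<lambda>_. 1) = 1"
    using assms by (simp add: weighted_sum_PChoice wf_PChoice)
  then show ?thesis
    using pos by (auto simp: stochastic_def derivs_PChoice prod_eq_iff)
qed

lemma stochastic_PPar: "stochastic \<Gamma> P1 \<Longrightarrow> stochastic \<Gamma> P2 \<Longrightarrow> stochastic \<Gamma> (PPar P1 L P2)"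
proof -
  assume 1: "stochastic \<Gamma> P1" and 2: "stochastic \<Gamma> P2"
  then have "\<forall>(d, p, N)\<in>derivs \<Gamma> P1. 0 < p" by (auto simp: stochastic_def)
  from weighted_sum_PPar[OF this] 1 2 show ?thesis
    by (fastforce simp: stochastic_def derivs_PPar)
qed

lemma stochastic_PRes: "stochastic \<Gamma> P \<Longrightarrow> stochastic \<Gamma> (PRes P L)"
  by (fastforce simp: stochastic_def derivs_PRes weighted_sum_PRes)

lemma stochastic_PHide: "stochastic \<Gamma> P \<Longrightarrow> stochastic \<Gamma> (PHide P L)"
  by (fastforce simp: stochastic_def derivs_PHide weighted_sum_PHide)

lemma stochastic_PConst: "stochastic \<Gamma> (snd \<Gamma> K) \<Longrightarrow> stochastic \<Gamma> (PConst K)"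
  by (fastforce simp: stochastic_def derivs_PConst weighted_sum_PConst)

text \<open>Constants are unfolded only once: a guarded term has no constant outside an action
  prefix, so induction on the right-hand side of an equation never meets the constant case.
  \<open>stochastic\<close> then reduces a constant to its right-hand side. Finiteness of
  \<open>moves\<close> follows the same pattern.\<close>

lemma stochastic_guarded: "wf_pterm P \<Longrightarrow> guarded_pterm P \<Longrightarrow> stochastic \<Gamma> P"
proof (induction P rule: wf_nterm_wf_pterm.inducts(2)[where ?P1.0 = "\<lambda>_. True"])
  case (8 xs)
  then show ?case by (intro stochastic_PChoice) (auto simp: wf_PChoice)
qed (auto intro: stochastic_PPar stochastic_PRes stochastic_PHide elim: guarded_ptermE)

lemma stochastic: "wf_pterm P \<Longrightarrow> wf_env \<Gamma> \<Longrightarrow> stochastic \<Gamma> P"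
proof (induction P rule: wf_nterm_wf_pterm.inducts(2)[where ?P1.0 = "\<lambda>_. True"])
  case (8 xs)
  then show ?case by (intro stochastic_PChoice) (auto simp: wf_PChoice)
next
  case (12 K)
  then show ?case by (intro stochastic_PConst stochastic_guarded) (simp_all add: wf_env_def)
qed (auto intro: stochastic_PPar stochastic_PRes stochastic_PHide)

section \<open>Action transitions and finite branching\<close>

lemma atrans_simps:
  "atrans \<Gamma> NZero a P \<longleftrightarrow> False"
  "atrans \<Gamma> (NPrefix b P') a P \<longleftrightarrow> a = b \<and> P = P'"
  "atrans \<Gamma> (NPlus N1 N2) a P \<longleftrightarrow> atrans \<Gamma> N1 a P \<or> atrans \<Gamma> N2 a P"
  "atrans \<Gamma> (NConst K) a P \<longleftrightarrow> atrans \<Gamma> (fst \<Gamma> K) a P"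
  by (subst atrans.simps, auto; fail)+

lemma atrans_NPar: "atrans \<Gamma> (NPar N1 L N2) a P \<longleftrightarrow>
    (\<exists>P1. atrans \<Gamma> N1 a P1 \<and> a \<notin> Obs ` L \<and> P = PPar P1 L (PDirac N2)) \<or>
    (\<exists>P2. atrans \<Gamma> N2 a P2 \<and> a \<notin> Obs ` L \<and> P = PPar (PDirac N1) L P2) \<or>
    (\<exists>P1 P2. atrans \<Gamma> N1 a P1 \<and> atrans \<Gamma> N2 a P2 \<and> a \<in> Obs ` L \<and> P = PPar P1 L P2)"
  by (subst atrans.simps, auto)

lemma atrans_NRes: "atrans \<Gamma> (NRes N L) a P \<longleftrightarrow> (\<exists>P'. atrans \<Gamma> N a P' \<and> a \<notin> Obs ` L \<and> P = PRes P' L)"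
  by (subst atrans.simps, auto)

lemma atrans_NHide: "atrans \<Gamma> (NHide N L) a P \<longleftrightarrow>
   (\<exists>b P'. atrans \<Gamma> N b P' \<and> a = (if b \<in> Obs ` L then Tau else b) \<and> P = PHide P' L)"
  by (subst atrans.simps, auto)

definition moves :: "('a, 'c, 'd) env \<Rightarrow> ('a, 'c, 'd) nterm \<Rightarrow> ('a act \<times> ('a, 'c, 'd) pterm) set" where
  "moves \<Gamma> N = {(a, P). atrans \<Gamma> N a P}"

lemma finite_moves_NPar:
  assumes "finite (moves \<Gamma> N1)" "finite (moves \<Gamma> N2)"
  shows "finite (moves \<Gamma> (NPar N1 L N2))"
proof (rule finite_subset)
  show "moves \<Gamma> (NPar N1 L N2) \<subseteq> (\<lambda>(a, P1). (a, PPar P1 L (PDirac N2))) ` moves \<Gamma> N1 \<union>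
     (\<lambda>(a, P2). (a, PPar (PDirac N1) L P2)) ` moves \<Gamma> N2 \<union>
     (\<lambda>((a, P1), (b, P2)). (a, PPar P1 L P2)) ` (moves \<Gamma> N1 \<times> moves \<Gamma> N2)"
    by (force simp: moves_def atrans_NPar image_iff)
qed (use assms in auto)

lemma finite_moves_simps:
  "finite (moves \<Gamma> NZero)" "finite (moves \<Gamma> (NPrefix b P'))"
  "finite (moves \<Gamma> N1) \<Longrightarrow> finite (moves \<Gamma> N2) \<Longrightarrow> finite (moves \<Gamma> (NPlus N1 N2))"
  "finite (moves \<Gamma> (fst \<Gamma> K)) \<Longrightarrow> finite (moves \<Gamma> (NConst K))"
proof -
  show "finite (moves \<Gamma> NZero)" "finite (moves \<Gamma> (NPrefix b P'))"
    by (simp_all add: moves_def atrans_simps)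
  show "finite (moves \<Gamma> (NConst K))" if "finite (moves \<Gamma> (fst \<Gamma> K))"
    using that by (simp add: moves_def atrans_simps)
  have "moves \<Gamma> (NPlus N1 N2) = moves \<Gamma> N1 \<union> moves \<Gamma> N2"
    by (auto simp: moves_def atrans_simps)
  then show "finite (moves \<Gamma> (NPlus N1 N2))" if "finite (moves \<Gamma> N1)" "finite (moves \<Gamma> N2)"
    using that by simp
qed

lemma finite_moves_NRes: "finite (moves \<Gamma> N) \<Longrightarrow> finite (moves \<Gamma> (NRes N L))"
  by (rule finite_subset[of _ "(\<lambda>(a, P). (a, PRes P L)) ` moves \<Gamma> N"])
    (auto simp: moves_def atrans_NRes)

lemma finite_moves_NHide: "finite (moves \<Gamma> N) \<Longrightarrow> finite (moves \<Gamma> (NHide N L))"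
  by (rule finite_subset[of _ "(\<lambda>(a, P). (if a \<in> Obs ` L then Tau else a, PHide P L)) ` moves \<Gamma> N"])
    (force simp: moves_def atrans_NHide image_iff)+

lemmas finite_moves_intros =
  finite_moves_simps finite_moves_NPar finite_moves_NRes finite_moves_NHide

lemma finite_moves_guarded: "guarded_nterm N \<Longrightarrow> finite (moves \<Gamma> N)"
  by (induction N rule: guarded_nterm_guarded_pterm.inducts(1)[where ?P2.0 = "\<lambda>_. True"])
    (auto intro: finite_moves_intros)

text \<open>Finite branching makes the supremum in \<open>game_round\<close> below a maximum, so
  that a scheduler can choose a best move.\<close>

lemma finite_moves: "wf_nterm N \<Longrightarrow> wf_env \<Gamma> \<Longrightarrow> finite (moves \<Gamma> N)"
proof (induction N rule: wf_nterm_wf_pterm.inducts(1)[where ?P2.0 = "\<lambda>_. True"])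
  case (7 K)
  then show ?case by (intro finite_moves_simps(4) finite_moves_guarded) (simp add: wf_env_def)
qed (auto intro: finite_moves_intros)

lemma wf_atrans: "atrans \<Gamma> N a P \<Longrightarrow> wf_env \<Gamma> \<Longrightarrow> wf_nterm N \<Longrightarrow> wf_pterm P"
  by (induction rule: atrans.induct) (auto simp: wf_env_def)

lemma wf_ptrans: "wf_env \<Gamma> \<Longrightarrow> wf_pterm P \<Longrightarrow> ptrans \<Gamma> P d p N \<Longrightarrow> 0 < p \<and> wf_nterm N"
  using stochastic[of P \<Gamma>] by (auto simp: stochastic_def derivs_def)

text \<open>The distribution is built on derivations and pushed forward to targets, so
  \<open>map_pmf\<close> adds up the weights of different derivations of one target.\<close>

definition next_dist :: "('a, 'c, 'd) env \<Rightarrow> ('a, 'c, 'd) pterm \<Rightarrow> ('a, 'c, 'd) proc pmf" where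
  "next_dist \<Gamma> P = map_pmf (\<lambda>(d, p, N). Nd N)
     (embed_pmf (\<lambda>x. if x \<in> derivs \<Gamma> P then fst (snd x) else 0))"

text \<open>The point mass for nondeterministic states follows the convention of
  \<open>step_prob\<close>. It makes states of different kinds comparable by couplings, so
  \<open>Nd N\<close> may be bisimilar to a probabilistic state.\<close>

fun pdist :: "('a, 'c, 'd) env \<Rightarrow> ('a, 'c, 'd) proc \<Rightarrow> ('a, 'c, 'd) proc pmf" where
  "pdist \<Gamma> (Nd N) = return_pmf (Nd N)"
| "pdist \<Gamma> (Pr P) = next_dist \<Gamma> P"

lemma nn_integral_next_dist:
  assumes "stochastic \<Gamma> P"
  shows "(\<integral>\<^sup>+x. f x \<partial>next_dist \<Gamma> P) = weighted_sum \<Gamma> P (\<lambda>N. f (Nd N))"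
proof -
  let ?w = "\<lambda>x. if x \<in> derivs \<Gamma> P then fst (snd x) else 0"
  have fin: "finite (derivs \<Gamma> P)" and pos: "x \<in> derivs \<Gamma> P \<Longrightarrow> 0 < fst (snd x)" for x
    using assms by (auto simp: stochastic_def)
  have "(\<integral>\<^sup>+x. ennreal (?w x) \<partial>count_space UNIV) = (\<integral>\<^sup>+x. ennreal (fst (snd x)) \<partial>count_space (derivs \<Gamma> P))"
    by (subst nn_integral_count_space_indicator) (auto intro!: nn_integral_cong simp: indicator_def)
  also have "\<dots> = weighted_sum \<Gamma> P (\<lambda>_. 1)"
    using fin by (simp add: nn_integral_count_space_finite weighted_sum_def case_prod_beta)
  finally have one: "(\<integral>\<^sup>+x. ennreal (?w x) \<partial>count_space UNIV) = 1"
    using assms by (simp add: stochastic_def)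
  have pmf: "pmf (embed_pmf ?w) x = ?w x" for x
    by (rule pmf_embed_pmf) (use one pos in \<open>auto intro: less_imp_le\<close>)
  have supp: "set_pmf (embed_pmf ?w) = derivs \<Gamma> P"
    using pos by (force simp: set_pmf_eq pmf)
  show ?thesis
    unfolding next_dist_def
    by (simp add: nn_integral_measure_pmf_finite supp fin pmf weighted_sum_def case_prod_beta mult.commute)
qed

text \<open>Indicators of singletons recover the point masses. The effect of each operator on
  distributions can thus be read off from its \<open>weighted_sum\<close> equation.\<close>

lemma pmf_eqI_nn_integral:
  assumes "\<And>f. (\<integral>\<^sup>+x. f x \<partial>measure_pmf p) = (\<integral>\<^sup>+x. f x \<partial>measure_pmf q)"
  shows "p = q"
proof (rule pmf_eqI)
  fix i
  have "emeasure p {i} = emeasure q {i}"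
    using assms[of "indicator {i}"] by simp
  then show "pmf p i = pmf q i"
    by (simp add: emeasure_pmf_single)
qed

declare pdist.simps(2) [simp del]

definition same_kind :: "('a, 'c, 'd) proc \<Rightarrow> ('a, 'c, 'd) proc \<Rightarrow> bool" where
  "same_kind s t \<longleftrightarrow> (s \<in> range Nd \<longleftrightarrow> t \<in> range Nd)"

lemma same_kind_simps [simp]: "same_kind (Nd M) (Nd N)" "same_kind (Pr P) (Pr Q)"
  "\<not> same_kind (Nd N) (Pr P)" "\<not> same_kind (Pr P) (Nd N)"
  by (auto simp: same_kind_def)

lemma in_procs [simp]: "Nd N \<in> procs \<longleftrightarrow> wf_nterm N" "Pr P \<in> procs \<longleftrightarrow> wf_pterm P"
  by (auto simp: procs_def nprocs_def pprocs_def)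

context
  fixes \<Gamma> :: "('a, 'c, 'd) env"
  assumes wf: "wf_env \<Gamma>"
begin

lemma nn_integral_dist:
  "wf_pterm P \<Longrightarrow> (\<integral>\<^sup>+x. f x \<partial>pdist \<Gamma> (Pr P)) = weighted_sum \<Gamma> P (\<lambda>N. f (Nd N))"
  by (simp add: pdist.simps(2) nn_integral_next_dist stochastic wf)

lemma set_dist_Pr:
  assumes "wf_pterm P"
  shows "set_pmf (pdist \<Gamma> (Pr P)) = {Nd N | d p N. ptrans \<Gamma> P d p N}"
proof -
  have fin: "finite (derivs \<Gamma> P)"
    using stochastic[OF assms wf] by (auto simp: stochastic_def)
  have "x \<in> set_pmf (pdist \<Gamma> (Pr P)) \<longleftrightarrow> (\<exists>N d p. x = Nd N \<and> ptrans \<Gamma> P d p N)" for x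
  proof -
    have "x \<in> set_pmf (pdist \<Gamma> (Pr P)) \<longleftrightarrow> (\<integral>\<^sup>+y. indicator {x} y \<partial>pdist \<Gamma> (Pr P)) \<noteq> 0"
      by (simp add: emeasure_pmf_single set_pmf_iff)
    also have "\<dots> \<longleftrightarrow> (\<exists>(d, p, N)\<in>derivs \<Gamma> P. x = Nd N)"
      using assms wf_ptrans[OF wf assms] fin
      unfolding nn_integral_dist[OF assms] weighted_sum_def
      by (fastforce simp: sum_eq_0_iff derivs_def indicator_def split: if_splits)
    finally show ?thesis by (auto simp: derivs_def)
  qed
  then show ?thesis by blast
qed

lemma pdist_PRes: "wf_pterm P \<Longrightarrow> pdist \<Gamma> (Pr (PRes P L)) = map_pmf (\<lambda>u. res u L) (pdist \<Gamma> (Pr P))"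
  by (rule pmf_eqI_nn_integral) (simp only: nn_integral_map_pmf, simp add: nn_integral_dist weighted_sum_PRes)

lemma pdist_PHide: "wf_pterm P \<Longrightarrow> pdist \<Gamma> (Pr (PHide P L)) = map_pmf (\<lambda>u. hide u L) (pdist \<Gamma> (Pr P))"
  by (rule pmf_eqI_nn_integral) (simp only: nn_integral_map_pmf, simp add: nn_integral_dist weighted_sum_PHide)

lemma pdist_PDirac: "wf_nterm N \<Longrightarrow> pdist \<Gamma> (Pr (PDirac N)) = return_pmf (Nd N)"
  by (rule pmf_eqI_nn_integral) (simp add: nn_integral_dist weighted_sum_PChoice)

lemma pdist_PPar:
  assumes "wf_pterm P1" "wf_pterm P2"
  shows "pdist \<Gamma> (Pr (PPar P1 L P2)) =
    map_pmf (\<lambda>(u, v). par u L v) (pair_pmf (pdist \<Gamma> (Pr P1)) (pdist \<Gamma> (Pr P2)))"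
proof (rule pmf_eqI_nn_integral)
  fix f :: "('a, 'c, 'd) proc \<Rightarrow> ennreal"
  have "\<forall>(d, p, N)\<in>derivs \<Gamma> P1. 0 < p"
    using wf_ptrans[OF wf assms(1)] by (auto simp: derivs_def)
  then show "(\<integral>\<^sup>+x. f x \<partial>pdist \<Gamma> (Pr (PPar P1 L P2))) =
    (\<integral>\<^sup>+x. f x \<partial>map_pmf (\<lambda>(u, v). par u L v) (pair_pmf (pdist \<Gamma> (Pr P1)) (pdist \<Gamma> (Pr P2))))"
    using assms
    by (simp only: nn_integral_map_pmf, simp add: nn_integral_pair_pmf' nn_integral_dist weighted_sum_PPar)
qed

lemma pdist_res: "s \<in> procs \<Longrightarrow> pdist \<Gamma> (res s L) = map_pmf (\<lambda>u. res u L) (pdist \<Gamma> s)"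
  by (cases s) (simp_all add: pdist_PRes)

lemma pdist_hide: "s \<in> procs \<Longrightarrow> pdist \<Gamma> (hide s L) = map_pmf (\<lambda>u. hide u L) (pdist \<Gamma> s)"
  by (cases s) (simp_all add: pdist_PHide)

lemma pdist_par: "s \<in> procs \<Longrightarrow> t \<in> procs \<Longrightarrow> same_kind s t \<Longrightarrow>
    pdist \<Gamma> (par s L t) = map_pmf (\<lambda>(u, v). par u L v) (pair_pmf (pdist \<Gamma> s) (pdist \<Gamma> t))"
  by (cases s; cases t) (simp_all add: pdist_PPar pair_return_pmf1)

lemma set_dist: "s \<in> procs \<Longrightarrow> u \<in> set_pmf (pdist \<Gamma> s) \<Longrightarrow> u \<in> procs \<and> (\<exists>N. u = Nd N)"
  by (cases s) (auto simp: set_dist_Pr wf_ptrans[OF wf])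

lemma step_procs: "step \<Gamma> s l t \<Longrightarrow> s \<in> procs \<Longrightarrow> t \<in> procs"
  by (auto elim!: step.cases dest: wf_atrans[OF _ wf] wf_ptrans[OF wf])

end

section \<open>Almost sure reachability\<close>

definition needs_after :: "'a act \<Rightarrow> 'a act \<Rightarrow> 'a act" where
  "needs_after n x = (if x = Tau then n else Tau)"

text \<open>The residual of a language \<open>weak_words n\<close> is empty or again of this form.
  The remaining word set can therefore be recorded by a single action, which is \<open>Tau\<close>
  once the visible move has been made.\<close>

lemma weak_words_deriv:
  "{\<alpha>. x # \<alpha> \<in> weak_words n} = (if x \<in> {Tau, n} then weak_words (needs_after n x) else {})"
proof -
  have rep: "x # \<alpha> = replicate m y \<longleftrightarrow> x = y \<and> (\<exists>k. m = Suc k \<and> \<alpha> = replicate k y)" for x y :: "'a act" and \<alpha> m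
    by (cases m) auto
  have app: "x # \<alpha> = replicate m Tau @ n # \<beta> \<longleftrightarrow>
      m = 0 \<and> x = n \<and> \<alpha> = \<beta> \<or> x = Tau \<and> (\<exists>k. m = Suc k \<and> \<alpha> = replicate k Tau @ n # \<beta>)" for x :: "'a act" and \<alpha> \<beta> m
    by (cases m) auto
  show ?thesis
    by (auto simp: weak_words_def needs_after_def rep app)
qed

lemma Nil_in_weak_words: "[] \<in> weak_words n \<longleftrightarrow> n = Tau"
  by (auto simp: weak_words_def)

text \<open>One round of the reachability game on configurations \<open>(s, n)\<close>: an \<open>n\<close>-labelled transition is
  still to be made before \<open>C\<close> counts, or nothing but silent moves are allowed if \<open>n = \<tau>\<close>. A
  play that leaves the set \<open>W\<close> has value 0.\<close>

definition game_round ::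
  "('a, 'c, 'd) env \<Rightarrow> (('a, 'c, 'd) proc \<Rightarrow> 'a act \<Rightarrow> bool) \<Rightarrow> ('a, 'c, 'd) proc set
    \<Rightarrow> (('a, 'c, 'd) proc \<Rightarrow> 'a act \<Rightarrow> ennreal) \<Rightarrow> ('a, 'c, 'd) proc \<Rightarrow> 'a act \<Rightarrow> ennreal" where
  "game_round \<Gamma> W C V s n =
     (if \<not> W s n then 0 else if n = Tau \<and> s \<in> C then 1
      else case s of
        Nd N \<Rightarrow> (SUP (x, P)\<in>{(x, P). (x, P) \<in> moves \<Gamma> N \<and> x \<in> {Tau, n}}. V (Pr P) (needs_after n x))
      | Pr P \<Rightarrow> if \<forall>u\<in>set_pmf (pdist \<Gamma> s). W u n then \<integral>\<^sup>+u. V u n \<partial>pdist \<Gamma> s else 0)"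

definition reach_value where "reach_value \<Gamma> W C = lfp (game_round \<Gamma> W C)"

text \<open>A value 1 that is only a supremum need not be attained: gambles of success probability
  tending to 1 may be offered one after the other in infinitely many states. Here a lost gamble that
  leads to a hopeless state leaves \<open>W\<close> and makes the gamble worthless, so that a play
  inside \<open>W\<close> can be broken off at any time and resumed with value 1.\<close>

definition almost_sure ::
  "('a, 'c, 'd) env \<Rightarrow> ('a, 'c, 'd) proc set \<Rightarrow> ('a, 'c, 'd) proc \<Rightarrow> 'a act \<Rightarrow> bool" where
  "almost_sure \<Gamma> C s n \<longleftrightarrow>
     (\<exists>W. W s n \<and> (\<forall>s n. W s n \<longrightarrow> s \<in> procs \<and> reach_value \<Gamma> W C s n = 1))"

lemma game_round_mono: "V \<le> V' \<Longrightarrow> (\<And>s n. W s n \<Longrightarrow> W' s n) \<Longrightarrow> game_round \<Gamma> W C V \<le> game_round \<Gamma> W' C V'"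
  unfolding le_fun_def game_round_def
  by (auto intro!: SUP_subset_mono nn_integral_mono split: proc.splits)

text \<open>Continuity gives the value as a supremum over bounded numbers of rounds, so that
  estimates can be proved by induction on rounds.\<close>

lemma game_round_sup_continuous:
  fixes \<Gamma> :: "('a, 'c, 'd) env"
  shows "sup_continuous (game_round \<Gamma> W C)"
unfolding sup_continuous_def
proof (intro allI impI)
  fix M :: "nat \<Rightarrow> ('a, 'c, 'd) proc \<Rightarrow> 'a act \<Rightarrow> ennreal"
  assume M: "incseq M"
  have inc: "incseq (\<lambda>i u. M i u n)" for n
    using M by (auto simp: incseq_def le_fun_def)
  have int: "(\<integral>\<^sup>+u. (SUP i. M i u n) \<partial>measure_pmf p) = (SUP i. \<integral>\<^sup>+u. M i u n \<partial>measure_pmf p)" for p n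
    using inc by (intro nn_integral_monotone_convergence_SUP) auto
  have "game_round \<Gamma> W C (\<Squnion>i. M i) s n = (SUP i. game_round \<Gamma> W C (M i) s n)" for s n
  proof (cases s)
    case (Nd N)
    have "(SUP y\<in>A. SUP i. M i (f y) (g y)) = (SUP i. SUP y\<in>A. M i (f y) (g y))"
      for A and f :: "'a act \<times> ('a, 'c, 'd) pterm \<Rightarrow> _" and g
      by (rule SUP_commute)
    with Nd show ?thesis
      by (auto simp: game_round_def case_prod_beta image_image)
  next
    case (Pr P)
    then show ?thesis by (auto simp: game_round_def int image_image)
  qed
  then show "game_round \<Gamma> W C (\<Squnion>i. M i) = (\<Squnion>i. game_round \<Gamma> W C (M i))"
    by (auto simp: fun_eq_iff image_image)
qed

definition game_rounds where "game_rounds \<Gamma> W C i = (game_round \<Gamma> W C ^^ i) bot"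

lemma game_rounds_simps [simp]:
  "game_rounds \<Gamma> W C 0 s n = 0"
  "game_rounds \<Gamma> W C (Suc i) = game_round \<Gamma> W C (game_rounds \<Gamma> W C i)"
  by (simp_all add: game_rounds_def bot_ennreal)

lemma reach_value_SUP: "reach_value \<Gamma> W C s n = (SUP i. game_rounds \<Gamma> W C i s n)"
  by (simp add: reach_value_def sup_continuous_lfp[OF game_round_sup_continuous] image_image game_rounds_def)

lemma reach_value_unfold: "reach_value \<Gamma> W C = game_round \<Gamma> W C (reach_value \<Gamma> W C)"
  unfolding reach_value_def
  by (rule lfp_unfold) (rule sup_continuous_mono[OF game_round_sup_continuous])

text \<open>The factor \<open>v\<close> bounds from below what can still be gained after success. It
  serves to play two games in sequence, where values multiply; \<open>v = 1\<close> is the plain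
  one-round estimate.\<close>

lemma game_round_mult_le:
  assumes "W s n \<Longrightarrow> n = Tau \<Longrightarrow> s \<in> C \<Longrightarrow> v \<le> b"
    and "\<And>N x P. W s n \<Longrightarrow> s = Nd N \<Longrightarrow> atrans \<Gamma> N x P \<Longrightarrow> x \<in> {Tau, n} \<Longrightarrow> V (Pr P) (needs_after n x) * v \<le> b"
    and "\<And>P. W s n \<Longrightarrow> s = Pr P \<Longrightarrow> \<forall>u\<in>set_pmf (pdist \<Gamma> s). W u n \<Longrightarrow> (\<integral>\<^sup>+u. V u n * v \<partial>pdist \<Gamma> s) \<le> b"
  shows "game_round \<Gamma> W C V s n * v \<le> (b :: ennreal)"
proof (cases "W s n")
  case False
  then show ?thesis by (simp add: game_round_def)
next
  case W: True
  show ?thesis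
  proof (cases s)
    case (Nd N)
    then show ?thesis
      using assms(1,2) W
      by (auto simp: game_round_def SUP_mult_right_ennreal moves_def intro!: SUP_least)
  next
    case (Pr P)
    then show ?thesis
      using assms(1,3) W by (auto simp: game_round_def nn_integral_multc)
  qed
qed

lemmas game_round_le = game_round_mult_le[where v = 1, unfolded mult_1_right]

lemma reach_value_le_1: "reach_value \<Gamma> W C s n \<le> 1"
proof -
  have "reach_value \<Gamma> W C \<le> (\<lambda>_ _. 1)"
    unfolding reach_value_def
    by (rule lfp_lowerbound) (auto simp: le_fun_def intro!: game_round_le)
  then show ?thesis by (auto simp: le_fun_def)
qed

lemma reach_value_success: "W s Tau \<Longrightarrow> s \<in> C \<Longrightarrow> reach_value \<Gamma> W C s Tau = 1"
  by (subst reach_value_unfold) (simp add: game_round_def)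

lemma reach_value_move:
  assumes "W (Nd N) n" "atrans \<Gamma> N x P" "x \<in> {Tau, n}"
  shows "reach_value \<Gamma> W C (Pr P) (needs_after n x) \<le> reach_value \<Gamma> W C (Nd N) n"
proof (cases "n = Tau \<and> Nd N \<in> C")
  case True
  then show ?thesis using assms by (simp add: reach_value_success reach_value_le_1)
next
  case False
  then show ?thesis
    using assms
    by (subst (2) reach_value_unfold) (auto simp: game_round_def moves_def intro!: SUP_upper2[of "(x, P)"])
qed

lemma reach_value_prob:
  assumes "W (Pr P) n" "\<And>u. u \<in> set_pmf (pdist \<Gamma> (Pr P)) \<Longrightarrow> W u n"
  shows "(\<integral>\<^sup>+u. reach_value \<Gamma> W C u n \<partial>pdist \<Gamma> (Pr P)) \<le> reach_value \<Gamma> W C (Pr P) n"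
proof (cases "n = Tau \<and> Pr P \<in> C")
  case True
  have "(\<integral>\<^sup>+u. reach_value \<Gamma> W C u n \<partial>pdist \<Gamma> (Pr P)) \<le> (\<integral>\<^sup>+u. 1 \<partial>pdist \<Gamma> (Pr P))"
    by (intro nn_integral_mono reach_value_le_1)
  also have "\<dots> = 1" by simp
  finally show ?thesis using assms True by (simp add: reach_value_success)
next
  case False
  then show ?thesis
    using assms by (subst (2) reach_value_unfold) (auto simp: game_round_def)
qed

lemma almost_sure_coinduct:
  assumes "W s n" "\<And>s n. W s n \<Longrightarrow> s \<in> procs" "\<And>s n. W s n \<Longrightarrow> 1 \<le> reach_value \<Gamma> W C s n"
  shows "almost_sure \<Gamma> C s n"
  unfolding almost_sure_def using assms
  by (intro exI[of _ W]) (auto intro: antisym[OF reach_value_le_1])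

text \<open>Enlarging \<open>W\<close> only removes penalties and so raises values. Hence the union
  of all witnesses, which is \<open>almost_sure\<close> itself, is again a witness.\<close>

lemma almost_sure_value:
  assumes "almost_sure \<Gamma> C s n"
  shows "s \<in> procs" "reach_value \<Gamma> (almost_sure \<Gamma> C) C s n = 1"
proof -
  from assms obtain W where W: "W s n"
    "\<And>s n. W s n \<Longrightarrow> s \<in> procs" "\<And>s n. W s n \<Longrightarrow> reach_value \<Gamma> W C s n = 1"
    by (auto simp: almost_sure_def)
  have "reach_value \<Gamma> W C \<le> reach_value \<Gamma> (almost_sure \<Gamma> C) C"
    unfolding reach_value_def
  proof (rule lfp_mono, rule game_round_mono)
    show "almost_sure \<Gamma> C s n" if "W s n" for s n
      using that W by (auto simp: almost_sure_def)
  qed simp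
  then have "1 \<le> reach_value \<Gamma> (almost_sure \<Gamma> C) C s n"
    using W(3)[OF W(1)] by (metis le_funD)
  then show "reach_value \<Gamma> (almost_sure \<Gamma> C) C s n = 1"
    by (intro antisym reach_value_le_1)
  show "s \<in> procs" using W by auto
qed

lemma almost_sure_success: "s \<in> C \<Longrightarrow> s \<in> procs \<Longrightarrow> almost_sure \<Gamma> C s Tau"
  by (rule almost_sure_coinduct[where W = "\<lambda>t m. t = s \<and> m = Tau"]) (auto simp: reach_value_success)

lemma rel_pmf_nn_integral_mono:
  assumes "rel_pmf R p q" "\<And>x y. R x y \<Longrightarrow> f x \<le> g y"
  shows "(\<integral>\<^sup>+x. f x \<partial>measure_pmf p) \<le> (\<integral>\<^sup>+y. g y \<partial>measure_pmf q)"
proof -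
  from assms(1) obtain pq where pq: "\<And>x y. (x, y) \<in> set_pmf pq \<Longrightarrow> R x y"
      "p = map_pmf fst pq" "q = map_pmf snd pq"
    by (auto elim: rel_pmf.cases)
  have "(\<integral>\<^sup>+z. f (fst z) \<partial>measure_pmf pq) \<le> (\<integral>\<^sup>+z. g (snd z) \<partial>measure_pmf pq)"
    using assms(2) pq(1) by (intro nn_integral_mono_AE) (auto simp: AE_measure_pmf_iff)
  then show ?thesis by (simp add: pq(2,3))
qed

text \<open>The set \<open>C\<close> is reached from \<open>t\<close> in two phases: reach a state related to \<open>s\<close>, then imitate the
  moves that lead from \<open>s\<close> to \<open>C\<close>. The predicate says which requirement \<open>k\<close> is left when \<open>m\<close> is left
  of the first phase and \<open>l\<close> is required in the second one.\<close>

definition joint_need :: "'a act \<Rightarrow> 'a act \<Rightarrow> 'a act \<Rightarrow> bool" where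
  "joint_need m l k \<longleftrightarrow> m = Tau \<and> k = l \<or> l = Tau \<and> k = m"

lemma joint_need_step:
  "joint_need m l k \<Longrightarrow> x \<in> {Tau, m} \<Longrightarrow> x \<in> {Tau, k} \<and> joint_need (needs_after m x) l (needs_after k x)"
  by (auto simp: joint_need_def needs_after_def)

context
  fixes \<Gamma> :: "('a, 'c, 'd) env"
  assumes wf: "wf_env \<Gamma>"
begin

text \<open>\<open>S\<close> is a simulation whose steps are answered by almost sure plans and whose
  probabilistic moves are answered by couplings; \<open>lam\<close> renames labels, being the
  identity for bisimulations and the renaming made by a context otherwise. Two nested inductions on
  rounds compare values only: the outer one follows the play from \<open>s\<close>, the inner one
  the plan by which \<open>t\<close> catches up with one step of \<open>s\<close>. Thus no branch of
  \<open>t\<close> has to be assigned to a branch of \<open>s\<close>.\<close>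

lemma almost_sure_transfer:
  fixes lam :: "'a act \<Rightarrow> 'a act"
  assumes S: "\<And>s t. (s, t) \<in> S \<Longrightarrow> t \<in> procs"
    and S_pdist: "\<And>s t. (s, t) \<in> S \<Longrightarrow> rel_pmf (\<lambda>x y. (x, y) \<in> S) (pdist \<Gamma> s) (pdist \<Gamma> t)"
    and S_step: "\<And>s t x s'. (s, t) \<in> S \<Longrightarrow> step \<Gamma> s (LAct x) s' \<Longrightarrow> x \<in> {Tau, a}
        \<Longrightarrow> almost_sure \<Gamma> (S `` {s'}) t (lam x)"
    and lam: "lam Tau = Tau" and C: "S `` C \<subseteq> C'"
    and init: "almost_sure \<Gamma> C s0 n0" "n0 \<in> {Tau, a}" "(s0, t0) \<in> S"
  shows "almost_sure \<Gamma> C' t0 (lam n0)"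
proof -
  \<comment> \<open>These are the positions in the middle of catching up: \<open>t\<close> is on its
    way to a state related to \<open>s\<close> with \<open>m\<close> left, and from \<open>s\<close>
    the requirement \<open>n\<close> is still open.\<close>
  define W' where "W' t k \<longleftrightarrow> (\<exists>s m n. almost_sure \<Gamma> (S `` {s}) t m \<and> almost_sure \<Gamma> C s n \<and> n \<in> {Tau, a} \<and>
     joint_need m (lam n) k)" for t k
  define V' where "V' = reach_value \<Gamma> W' C'"
  have W'I: "W' t (lam n)" if "(s, t) \<in> S" "almost_sure \<Gamma> C s n" "n \<in> {Tau, a}" for s t n
    unfolding W'_def using that S
    by (intro exI[of _ s] exI[of _ Tau] exI[of _ n]) (auto simp: joint_need_def intro: almost_sure_success)
  \<comment> \<open>\<open>v\<close> is a common lower bound for the second phase from all states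
    related to \<open>s\<close>, so the two phases together are worth at least the product.\<close>
  have phase1: "game_rounds \<Gamma> (almost_sure \<Gamma> (S `` {s})) (S `` {s}) i t m * v \<le> V' t k"
    if s: "almost_sure \<Gamma> C s n" "n \<in> {Tau, a}" and v: "\<And>u. (s, u) \<in> S \<Longrightarrow> v \<le> V' u (lam n)"
      and need: "joint_need m (lam n) k" for s n v i t m k
    using need
  proof (induction i arbitrary: t m k)
    case 0
    then show ?case by simp
  next
    case (Suc i)
    let ?A = "almost_sure \<Gamma> (S `` {s})"
    have W': "W' u k" if "?A u m" for u
      using that s Suc.prems unfolding W'_def by auto
    show ?case unfolding game_rounds_simps
    proof (rule game_round_mult_le)
      assume "m = Tau" "t \<in> S `` {s}"
      then show "v \<le> V' t k" using v Suc.prems by (auto simp: joint_need_def)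
    next
      fix N x P assume t: "?A t m" "t = Nd N" and x: "atrans \<Gamma> N x P" "x \<in> {Tau, m}"
      have "game_rounds \<Gamma> ?A (S `` {s}) i (Pr P) (needs_after m x) * v \<le> V' (Pr P) (needs_after k x)"
        using joint_need_step[OF Suc.prems x(2)] by (intro Suc.IH) auto
      also have "\<dots> \<le> V' t k"
        unfolding V'_def t(2)
        using joint_need_step[OF Suc.prems x(2)] x W'[OF t(1)] t(2) by (intro reach_value_move) auto
      finally show "game_rounds \<Gamma> ?A (S `` {s}) i (Pr P) (needs_after m x) * v \<le> V' t k" .
    next
      fix P assume t: "?A t m" "t = Pr P" and u: "\<forall>u\<in>set_pmf (pdist \<Gamma> t). ?A u m"
      have "(\<integral>\<^sup>+u. game_rounds \<Gamma> ?A (S `` {s}) i u m * v \<partial>pdist \<Gamma> t) \<le> (\<integral>\<^sup>+u. V' u k \<partial>pdist \<Gamma> t)"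
        by (intro nn_integral_mono Suc.IH Suc.prems)
      also have "\<dots> \<le> V' t k"
        unfolding V'_def t(2) using W' t u by (intro reach_value_prob) auto
      finally show "(\<integral>\<^sup>+u. game_rounds \<Gamma> ?A (S `` {s}) i u m * v \<partial>pdist \<Gamma> t) \<le> V' t k" .
    qed
  qed
  have phase1': "v \<le> V' t k"
    if "almost_sure \<Gamma> (S `` {s}) t m" "almost_sure \<Gamma> C s n" "n \<in> {Tau, a}"
      "\<And>u. (s, u) \<in> S \<Longrightarrow> v \<le> V' u (lam n)" "joint_need m (lam n) k" for s n v t m k
  proof -
    have "(SUP i. game_rounds \<Gamma> (almost_sure \<Gamma> (S `` {s})) (S `` {s}) i t m) * v \<le> V' t k"
      unfolding SUP_mult_right_ennreal using phase1[OF that(2-5)] by (intro SUP_least)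
    then show ?thesis
      using almost_sure_value(2)[OF that(1)] by (simp add: reach_value_SUP)
  qed
  have phase2: "game_rounds \<Gamma> (almost_sure \<Gamma> C) C i s n \<le> V' t (lam n)"
    if "(s, t) \<in> S" "n \<in> {Tau, a}" for i s t n
    using that
  proof (induction i arbitrary: s t n)
    case 0
    then show ?case by simp
  next
    case (Suc i)
    let ?A = "almost_sure \<Gamma> C"
    show ?case unfolding game_rounds_simps
    proof (rule game_round_le)
      assume "?A s n" "n = Tau" "s \<in> C"
      then have "W' t Tau" "t \<in> C'"
        using W'I[OF Suc.prems(1), of Tau] Suc.prems C lam by auto
      then show "1 \<le> V' t (lam n)"
        using \<open>n = Tau\<close> by (simp add: lam V'_def reach_value_success)
    next
      fix N x P assume s: "?A s n" "s = Nd N" and x: "atrans \<Gamma> N x P" "x \<in> {Tau, n}"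
      let ?n = "needs_after n x"
      have n: "?n \<in> {Tau, a}" using Suc.prems(2) by (auto simp: needs_after_def)
      \<comment> \<open>If the successor is not almost sure, it lies outside the witness and has
        value 0. Otherwise \<open>t\<close> first carries out its answer to the step, and the
        induction hypothesis bounds what follows.\<close>
      show "game_rounds \<Gamma> ?A C i (Pr P) ?n \<le> V' t (lam n)"
      proof (cases "?A (Pr P) ?n")
        case True
        show ?thesis
        proof (rule phase1')
          show "almost_sure \<Gamma> (S `` {Pr P}) t (lam x)"
            using Suc.prems x s by (intro S_step) (auto intro: step.intros)
          show "joint_need (lam x) (lam ?n) (lam n)"
            using x lam by (auto simp: joint_need_def needs_after_def)
        qed (use True n Suc.IH in auto)
      next
        case False
        then have "game_rounds \<Gamma> ?A C i (Pr P) ?n = 0"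
          by (cases i) (auto simp: game_round_def)
        then show ?thesis by simp
      qed
    next
      fix P assume s: "?A s n" "s = Pr P" and u: "\<forall>u\<in>set_pmf (pdist \<Gamma> s). ?A u n"
      note rel = S_pdist[OF Suc.prems(1)]
      have "(\<integral>\<^sup>+u. game_rounds \<Gamma> ?A C i u n \<partial>pdist \<Gamma> s) \<le> (\<integral>\<^sup>+u. V' u (lam n) \<partial>pdist \<Gamma> t)"
        using Suc.IH Suc.prems by (intro rel_pmf_nn_integral_mono[OF rel]) auto
      also have "\<dots> \<le> V' t (lam n)"
      proof (cases t)
        case (Pr Q)
        have "W' v (lam n)" if "v \<in> set_pmf (pdist \<Gamma> t)" for v
        proof -
          from rel_pmf_imp_rel_set[OF rel] that obtain w where "w \<in> set_pmf (pdist \<Gamma> s)" "(w, v) \<in> S"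
            by (auto simp: rel_set_def)
          with u Suc.prems show ?thesis by (auto intro: W'I)
        qed
        with Pr W'I[OF Suc.prems(1) s(1) Suc.prems(2)] show ?thesis
          unfolding V'_def by (auto intro: reach_value_prob)
      qed simp
      finally show "(\<integral>\<^sup>+u. game_rounds \<Gamma> ?A C i u n \<partial>pdist \<Gamma> s) \<le> V' t (lam n)" .
    qed
  qed
  have phase2': "1 \<le> V' t (lam n)" if "(s, t) \<in> S" "almost_sure \<Gamma> C s n" "n \<in> {Tau, a}" for s t n
    using phase2[OF that(1,3)] almost_sure_value(2)[OF that(2)]
    by (metis SUP_least reach_value_SUP)
  show ?thesis
  proof (rule almost_sure_coinduct[where W = W'])
    show "W' t0 (lam n0)" using init by (intro W'I)
    show "1 \<le> reach_value \<Gamma> W' C' t k" if "W' t k" for t k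
      using that phase2' unfolding W'_def V'_def[symmetric] by (blast intro: phase1')
    show "t \<in> procs" if "W' t k" for t k
      using that unfolding W'_def by (blast intro: almost_sure_value(1))
  qed
qed

lemma almost_sure_mono: "almost_sure \<Gamma> C s n \<Longrightarrow> C \<subseteq> C' \<Longrightarrow> almost_sure \<Gamma> C' s n"
proof -
  assume s: "almost_sure \<Gamma> C s n" and C: "C \<subseteq> C'"
  obtain W where W: "W s n"
    "\<And>s n. W s n \<Longrightarrow> s \<in> procs" "\<And>s n. W s n \<Longrightarrow> reach_value \<Gamma> W C s n = 1"
    using s by (auto simp: almost_sure_def)
  have "reach_value \<Gamma> W C \<le> reach_value \<Gamma> W C'"
    unfolding reach_value_def[of \<Gamma> W C]
  proof (rule lfp_lowerbound, intro le_funI)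
    fix s n show "game_round \<Gamma> W C (reach_value \<Gamma> W C') s n \<le> reach_value \<Gamma> W C' s n"
      using C by (intro game_round_le) (auto simp: reach_value_success reach_value_move reach_value_prob)
  qed
  then have "reach_value \<Gamma> W C s n \<le> reach_value \<Gamma> W C' s n" for s n
    by (simp add: le_fun_def)
  with W show ?thesis
    by (metis almost_sure_coinduct)
qed

text \<open>Adding the configuration \<open>(Pr P, n)\<close> to the largest witness leaves it a
  witness, since its value is at least an average of values 1.\<close>

lemma almost_sure_prob:
  assumes "Pr P \<in> procs" "\<And>u. u \<in> set_pmf (pdist \<Gamma> (Pr P)) \<Longrightarrow> almost_sure \<Gamma> C u n"
  shows "almost_sure \<Gamma> C (Pr P) n"
proof -
  let ?W = "\<lambda>s m. s = Pr P \<and> m = n \<or> almost_sure \<Gamma> C s m"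
  have mono: "reach_value \<Gamma> (almost_sure \<Gamma> C) C \<le> reach_value \<Gamma> ?W C"
    unfolding reach_value_def by (rule lfp_mono, rule game_round_mono) auto
  have 1: "1 \<le> reach_value \<Gamma> ?W C u m" if "almost_sure \<Gamma> C u m" for u m
    by (rule order_trans[OF _ le_funD[OF le_funD[OF mono]]]) (simp add: almost_sure_value(2)[OF that])
  have "1 = (\<integral>\<^sup>+u. 1 \<partial>pdist \<Gamma> (Pr P))" by simp
  also have "\<dots> \<le> (\<integral>\<^sup>+u. reach_value \<Gamma> ?W C u n \<partial>pdist \<Gamma> (Pr P))"
    using 1 assms(2) by (intro nn_integral_mono_AE) (auto simp: AE_measure_pmf_iff)
  also have "\<dots> \<le> reach_value \<Gamma> ?W C (Pr P) n"
    using assms(2) by (intro reach_value_prob) auto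
  finally show ?thesis
    using 1 assms(1) by (intro almost_sure_coinduct[where W = ?W]) (auto intro: almost_sure_value(1))
qed

lemma almost_sure_move:
  assumes "Nd N \<in> procs" "atrans \<Gamma> N x P" "Pr P \<in> C"
  shows "almost_sure \<Gamma> C (Nd N) x"
proof -
  let ?W = "\<lambda>s m. s = Nd N \<and> m = x \<or> s = Pr P \<and> m = Tau"
  have "reach_value \<Gamma> ?W C (Pr P) Tau = 1"
    using assms by (intro reach_value_success) auto
  then have "1 \<le> reach_value \<Gamma> ?W C (Nd N) x"
    using reach_value_move[of ?W N x \<Gamma> x P C] assms by (auto simp: needs_after_def split: if_splits)
  then show ?thesis
    using assms wf_atrans[OF assms(2) wf] \<open>reach_value \<Gamma> ?W C (Pr P) Tau = 1\<close>
    by (intro almost_sure_coinduct[where W = ?W]) auto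
qed

end

section \<open>Schedulers\<close>

lemma extend_simps [simp]: "last_state (extend \<theta> l t) = t" "fst (extend \<theta> l t) = fst \<theta>"
  "last_state (empty_comp s) = s"
  by (simp_all add: last_state_def extend_def)

lemma sched_eqs_mono: "X \<le> Y \<Longrightarrow> sched_eqs \<Gamma> \<sigma> C X \<le> sched_eqs \<Gamma> \<sigma> C Y"
proof (intro le_funI)
  fix \<Phi> \<theta>
  assume "X \<le> Y"
  then have le: "X \<Phi> \<theta> \<le> Y \<Phi> \<theta>" for \<Phi> \<theta> by (metis le_funD)
  show "sched_eqs \<Gamma> \<sigma> C X \<Phi> \<theta> \<le> sched_eqs \<Gamma> \<sigma> C Y \<Phi> \<theta>"
    unfolding sched_eqs_def
    by (auto intro!: sum_mono mult_left_mono le split: proc.splits decision.splits)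
qed

lemma sched_prob_unfold:
  "sched_prob \<Gamma> \<sigma> \<Phi> C \<theta> = sched_eqs \<Gamma> \<sigma> C (\<lambda>\<Phi>. sched_prob \<Gamma> \<sigma> \<Phi> C) \<Phi> \<theta>"
proof -
  have "mono (sched_eqs \<Gamma> \<sigma> C)"
    by (intro monoI sched_eqs_mono)
  from lfp_unfold[OF this] show ?thesis
    unfolding sched_prob_def by metis
qed

lemma sched_prob_lowerbound:
  assumes "\<And>\<Phi> \<theta>. sched_eqs \<Gamma> \<sigma> C U \<Phi> \<theta> \<le> U \<Phi> \<theta>"
  shows "sched_prob \<Gamma> \<sigma> \<Phi> C \<theta> \<le> U \<Phi> \<theta>"
proof -
  have "lfp (sched_eqs \<Gamma> \<sigma> C) \<le> U"
    using assms by (intro lfp_lowerbound le_funI)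
  then show ?thesis unfolding sched_prob_def le_fun_def by blast
qed

text \<open>Residuals of the empty set are empty, so the function that is 0 there and
  \<open>top\<close> elsewhere is a pre-fixed point. This excludes that a scheduler of success
  probability 1 fires a label that the requirement forbids.\<close>

lemma sched_prob_no_words:
  fixes \<theta> :: "('a, 'c, 'd) comp"
  shows "sched_prob \<Gamma> \<sigma> {} C \<theta> = 0"
proof -
  define U where "U \<Phi> (\<xi> :: ('a, 'c, 'd) comp) = (if \<Phi> = {} then 0 else top :: ennreal)"
    for \<Phi> :: "'a act list set" and \<xi>
  have "sched_prob \<Gamma> \<sigma> {} C \<theta> \<le> U {} \<theta>"
    by (rule sched_prob_lowerbound)
      (auto simp: sched_eqs_def U_def split: proc.splits decision.splits)
  then show ?thesis by (simp add: U_def)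
qed

lemma sched_eqs_simps:
  "\<sigma> \<theta> = Halt \<Longrightarrow> sched_eqs \<Gamma> \<sigma> C X \<Phi> \<theta> = (if [] \<in> \<Phi> \<and> last_state \<theta> \<in> C then 1 else 0)"
  "last_state \<theta> = Nd N \<Longrightarrow> \<sigma> \<theta> = Fire a P \<Longrightarrow>
    sched_eqs \<Gamma> \<sigma> C X \<Phi> \<theta> = X {\<alpha>. a # \<alpha> \<in> \<Phi>} (extend \<theta> (LAct a) (Pr P))"
  "last_state \<theta> = Pr Q \<Longrightarrow> \<sigma> \<theta> = Continue \<Longrightarrow> sched_eqs \<Gamma> \<sigma> C X \<Phi> \<theta> =
    (\<Sum>(d, p, N)\<in>derivs \<Gamma> Q. ennreal p * X \<Phi> (extend \<theta> (LProb p) (Nd N)))"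
  by (auto simp: sched_eqs_def derivs_def split: proc.splits)

lemma sched_cases:
  assumes "\<sigma> \<in> sched \<Gamma> s" "\<theta> \<in> comps \<Gamma> s"
  obtains "\<sigma> \<theta> = Halt"
  | N a P where "last_state \<theta> = Nd N" "\<sigma> \<theta> = Fire a P" "atrans \<Gamma> N a P"
  | P where "last_state \<theta> = Pr P" "\<sigma> \<theta> = Continue"
  using assms by (cases "last_state \<theta>") (fastforce simp: sched_def)+

lemma comps_move:
  "\<theta> \<in> comps \<Gamma> s \<Longrightarrow> last_state \<theta> = Nd N \<Longrightarrow> atrans \<Gamma> N a P \<Longrightarrow> extend \<theta> (LAct a) (Pr P) \<in> comps \<Gamma> s"
  by (rule comps.intros(2)) (auto intro: step.intros)

lemma comps_prob: "\<theta> \<in> comps \<Gamma> s \<Longrightarrow> last_state \<theta> = Pr P \<Longrightarrow> (d, p, N) \<in> derivs \<Gamma> P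
    \<Longrightarrow> extend \<theta> (LProb p) (Nd N) \<in> comps \<Gamma> s"
  by (rule comps.intros(2)) (auto simp: derivs_def intro: step.intros)

lemma sched_prob_halt:
  "\<sigma> \<theta> = Halt \<Longrightarrow> sched_prob \<Gamma> \<sigma> \<Phi> C \<theta> = (if [] \<in> \<Phi> \<and> last_state \<theta> \<in> C then 1 else 0)"
  by (subst sched_prob_unfold) (simp add: sched_eqs_simps)

lemma sched_prob_fire: "last_state \<theta> = Nd N \<Longrightarrow> \<sigma> \<theta> = Fire a P \<Longrightarrow>
    sched_prob \<Gamma> \<sigma> \<Phi> C \<theta> = sched_prob \<Gamma> \<sigma> {\<alpha>. a # \<alpha> \<in> \<Phi>} C (extend \<theta> (LAct a) (Pr P))"
  by (subst sched_prob_unfold) (simp add: sched_eqs_simps)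

lemma sched_prob_continue: "last_state \<theta> = Pr Q \<Longrightarrow> \<sigma> \<theta> = Continue \<Longrightarrow> sched_prob \<Gamma> \<sigma> \<Phi> C \<theta> =
    (\<Sum>(d, p, N)\<in>derivs \<Gamma> Q. ennreal p * sched_prob \<Gamma> \<sigma> \<Phi> C (extend \<theta> (LProb p) (Nd N)))"
  by (subst sched_prob_unfold) (simp add: sched_eqs_simps)

text \<open>Probability 1 at a probabilistic state is thereby inherited by every branch, so that
  histories of success probability 1 stay such histories along the play.\<close>

lemma ennreal_convex_sum_eq_1:
  fixes f :: "'x \<Rightarrow> ennreal"
  assumes "finite A" "(\<Sum>x\<in>A. ennreal (w x) * f x) = 1" "(\<Sum>x\<in>A. ennreal (w x)) = 1"
    and "\<And>x. x \<in> A \<Longrightarrow> f x \<le> 1" "\<And>x. x \<in> A \<Longrightarrow> 0 < w x" "x \<in> A"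
  shows "f x = 1"
proof (rule ccontr)
  assume "f x \<noteq> 1"
  with assms(4,6) have "f x < 1" by (simp add: order.strict_iff_order)
  then have "ennreal (w x) * f x < ennreal (w x) * 1"
    using assms(5,6) by (intro ennreal_mult_strict_left_mono) auto
  moreover have "(\<Sum>y\<in>A - {x}. ennreal (w y) * f y) \<le> (\<Sum>y\<in>A - {x}. ennreal (w y))"
    using assms(4) by (intro sum_mono) (auto intro: mult_left_le)
  moreover have "(\<Sum>y\<in>A - {x}. ennreal (w y)) < top"
    using assms(1) by (auto simp: less_top[symmetric])
  moreover have "a + c < b + d" if "a < b" "c \<le> d" "d < top" for a b c d :: ennreal
  proof -
    have "a + c \<le> d + a" using that(2) by (simp add: add.commute add_left_mono)
    also have "d + a < d + b" using that by (simp add: ennreal_add_left_cancel_less)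
    finally show ?thesis by (simp add: add.commute)
  qed
  ultimately have "ennreal (w x) * f x + (\<Sum>y\<in>A - {x}. ennreal (w y) * f y) < ennreal (w x) * 1 + (\<Sum>y\<in>A - {x}. ennreal (w y))"
    by blast
  then have "(\<Sum>x\<in>A. ennreal (w x) * f x) < (\<Sum>x\<in>A. ennreal (w x))"
    using assms(1,6) by (simp add: sum.remove)
  with assms(2,3) show False by simp
qed

context
  fixes \<Gamma> :: "('a, 'c, 'd) env"
  assumes wf: "wf_env \<Gamma>"
begin

lemma comps_procs: "\<theta> \<in> comps \<Gamma> s \<Longrightarrow> s \<in> procs \<Longrightarrow> last_state \<theta> \<in> procs"
  by (induction rule: comps.induct) (auto intro: step_procs[OF wf])

text \<open>The pre-fixed point is 1 on computations and \<open>top\<close> elsewhere, because a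
  scheduler is unconstrained outside the computations from \<open>s0\<close>.\<close>

lemma sched_prob_le_1:
  assumes s0: "s0 \<in> procs" and \<sigma>: "\<sigma> \<in> sched \<Gamma> s0" and \<theta>: "\<theta> \<in> comps \<Gamma> s0"
  shows "sched_prob \<Gamma> \<sigma> \<Phi> C \<theta> \<le> 1"
proof -
  define U :: "'a act list set \<Rightarrow> ('a, 'c, 'd) comp \<Rightarrow> ennreal"
    where "U = (\<lambda>_ \<theta>. if \<theta> \<in> comps \<Gamma> s0 then 1 else top)"
  have "sched_prob \<Gamma> \<sigma> \<Phi> C \<theta> \<le> U \<Phi> \<theta>"
  proof (rule sched_prob_lowerbound)
    fix \<Phi> \<theta>
    show "sched_eqs \<Gamma> \<sigma> C U \<Phi> \<theta> \<le> U \<Phi> \<theta>"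
    proof (cases "\<theta> \<in> comps \<Gamma> s0")
      case True
      from \<sigma> True show ?thesis
      proof (cases rule: sched_cases)
        case 1
        then show ?thesis by (simp add: sched_eqs_simps U_def)
      next
        case (2 N a P)
        then have "extend \<theta> (LAct a) (Pr P) \<in> comps \<Gamma> s0"
          using True by (auto intro: comps_move)
        with 2 True show ?thesis by (simp add: sched_eqs_simps U_def)
      next
        case (3 P)
        have st: "stochastic \<Gamma> P"
          using comps_procs[OF True s0] 3 by (auto intro: stochastic wf)
        have "sched_eqs \<Gamma> \<sigma> C U \<Phi> \<theta> =
            (\<Sum>(d, p, N)\<in>derivs \<Gamma> P. ennreal p * U \<Phi> (extend \<theta> (LProb p) (Nd N)))"
          using 3 by (simp add: sched_eqs_simps)
        also have "\<dots> = (\<Sum>(d, p, N)\<in>derivs \<Gamma> P. ennreal p * 1)"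
        proof (intro sum.cong refl, clarify)
          fix d p N assume "(d, p, N) \<in> derivs \<Gamma> P"
          then have "extend \<theta> (LProb p) (Nd N) \<in> comps \<Gamma> s0"
            using True 3 by (auto intro: comps_prob)
          then show "ennreal p * U \<Phi> (extend \<theta> (LProb p) (Nd N)) = ennreal p * 1"
            by (simp add: U_def)
        qed
        finally show ?thesis
          using st True by (simp add: stochastic_def weighted_sum_def U_def)
      qed
    qed (simp add: U_def)
  qed
  with \<theta> show ?thesis by (simp add: U_def)
qed

text \<open>The witness \<open>W\<close> consists of the ends of histories from which the scheduler
  still succeeds with probability 1. Success probability is a least solution, hence lies below every
  pre-fixed point, and the game values, read as a function of word set and history, form
  one.\<close>

lemma almost_sure_if_sched:
  assumes s0: "s0 \<in> procs" and \<sigma>: "\<sigma> \<in> sched \<Gamma> s0"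
    and prob: "sched_prob \<Gamma> \<sigma> (weak_words a) C (empty_comp s0) = 1"
  shows "almost_sure \<Gamma> C s0 a"
proof -
  define good where "good \<theta> n \<longleftrightarrow> \<theta> \<in> comps \<Gamma> s0 \<and> sched_prob \<Gamma> \<sigma> (weak_words n) C \<theta> = 1" for \<theta> n
  define W where "W t n \<longleftrightarrow> (\<exists>\<theta>. good \<theta> n \<and> last_state \<theta> = t)" for t n
  define V where "V = reach_value \<Gamma> W C"
  \<comment> \<open>The infimum recovers \<open>n\<close> from the word set without inverting
    \<open>weak_words\<close>. The value \<open>top\<close> at all other arguments makes their
    inequalities trivial.\<close>
  define U where "U \<Phi> \<theta> = (if \<theta> \<in> comps \<Gamma> s0 \<and> sched_prob \<Gamma> \<sigma> \<Phi> C \<theta> = 1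
     then (INF n\<in>{n. \<Phi> = weak_words n}. V (last_state \<theta>) n) else top)" for \<Phi> \<theta>
  have U: "U (weak_words n) \<theta> \<le> V (last_state \<theta>) n" if "good \<theta> n" for n \<theta>
    using that by (auto simp: U_def good_def intro!: INF_lower)
  have W: "W (last_state \<theta>) n" if "good \<theta> n" for \<theta> n
    using that unfolding W_def by blast
  have U_le: "sched_eqs \<Gamma> \<sigma> C U (weak_words n) \<theta> \<le> V (last_state \<theta>) n" if good: "good \<theta> n" for n \<theta>
  proof -
    have \<theta>: "\<theta> \<in> comps \<Gamma> s0" "sched_prob \<Gamma> \<sigma> (weak_words n) C \<theta> = 1"
      using good by (auto simp: good_def)
    show ?thesis
    using \<sigma> \<theta>(1)
  proof (cases rule: sched_cases)
    case 1
    with \<theta>(2) have "n = Tau \<and> last_state \<theta> \<in> C"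
      by (auto simp: sched_prob_halt Nil_in_weak_words split: if_splits)
    then show ?thesis
      using 1 W[OF good] by (simp add: sched_eqs_simps V_def reach_value_success)
  next
    case (2 N x P)
    let ?\<theta> = "extend \<theta> (LAct x) (Pr P)"
    from 2 \<theta>(2) have pr: "sched_prob \<Gamma> \<sigma> {\<alpha>. x # \<alpha> \<in> weak_words n} C ?\<theta> = 1"
      by (simp add: sched_prob_fire)
    then have x: "x \<in> {Tau, n}" by (auto simp: weak_words_deriv sched_prob_no_words split: if_splits)
    have "good ?\<theta> (needs_after n x)"
      using pr x 2 \<theta>(1) by (auto simp: good_def weak_words_deriv intro: comps_move)
    then have "U (weak_words (needs_after n x)) ?\<theta> \<le> V (Pr P) (needs_after n x)"
      using U by fastforce
    also have "\<dots> \<le> V (Nd N) n"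
      unfolding V_def using 2 x W[OF good] by (intro reach_value_move) auto
    finally show ?thesis
      using 2 x by (simp add: sched_eqs_simps weak_words_deriv)
  next
    case (3 P)
    have P: "wf_pterm P" using comps_procs[OF \<theta>(1) s0] 3 wf by simp
    then have st: "stochastic \<Gamma> P" by (intro stochastic wf)
    let ?\<theta> = "\<lambda>p N. extend \<theta> (LProb p) (Nd N)"
    have next_comp: "?\<theta> p N \<in> comps \<Gamma> s0" if "(d, p, N) \<in> derivs \<Gamma> P" for d p N
      using that \<theta>(1) 3 by (auto intro: comps_prob)
    have "(case x of (d, p, N) \<Rightarrow> sched_prob \<Gamma> \<sigma> (weak_words n) C (?\<theta> p N)) = 1"
      if "x \<in> derivs \<Gamma> P" for x
    proof (rule ennreal_convex_sum_eq_1[where A = "derivs \<Gamma> P" and w = "\<lambda>x. fst (snd x)"])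
      show "(\<Sum>x\<in>derivs \<Gamma> P. ennreal (fst (snd x)) *
        (case x of (d, p, N) \<Rightarrow> sched_prob \<Gamma> \<sigma> (weak_words n) C (?\<theta> p N))) = 1"
        using \<theta>(2) 3 sched_prob_continue[of \<theta> P \<sigma> \<Gamma> "weak_words n" C] by (simp add: case_prod_beta)
      show "(\<Sum>x\<in>derivs \<Gamma> P. ennreal (fst (snd x))) = 1"
        using st by (simp add: stochastic_def weighted_sum_def case_prod_beta)
    qed (use that st next_comp in \<open>auto simp: stochastic_def intro!: sched_prob_le_1[OF s0 \<sigma>]\<close>)
    then have g: "good (?\<theta> p N) n" if "(d, p, N) \<in> derivs \<Gamma> P" for d p N
      using that next_comp by (fastforce simp: good_def)
    have "sched_eqs \<Gamma> \<sigma> C U (weak_words n) \<theta> = (\<Sum>(d, p, N)\<in>derivs \<Gamma> P. ennreal p * U (weak_words n) (?\<theta> p N))"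
      using 3 by (simp add: sched_eqs_simps)
    also have "\<dots> \<le> (\<Sum>(d, p, N)\<in>derivs \<Gamma> P. ennreal p * V (Nd N) n)"
      using U[OF g] by (intro sum_mono) (auto intro!: mult_left_mono)
    also have "\<dots> = (\<integral>\<^sup>+u. V u n \<partial>pdist \<Gamma> (Pr P))"
      using P by (simp add: nn_integral_dist[OF wf] weighted_sum_def)
    also have "\<dots> \<le> V (Pr P) n"
      unfolding V_def
    proof (rule reach_value_prob)
      show "W (Pr P) n" using W[OF good] 3 by simp
      show "W u n" if "u \<in> set_pmf (pdist \<Gamma> (Pr P))" for u
        using that P W[OF g] by (auto simp: set_dist_Pr[OF wf] derivs_def)
    qed
    finally show ?thesis using 3 by simp
  qed
  qed
  have "sched_prob \<Gamma> \<sigma> \<Phi> C \<theta> \<le> U \<Phi> \<theta>" for \<Phi> \<theta>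
  proof (rule sched_prob_lowerbound)
    show "sched_eqs \<Gamma> \<sigma> C U \<Phi> \<theta> \<le> U \<Phi> \<theta>" for \<Phi> \<theta>
    proof (cases "\<theta> \<in> comps \<Gamma> s0 \<and> sched_prob \<Gamma> \<sigma> \<Phi> C \<theta> = 1")
      case True
      have "sched_eqs \<Gamma> \<sigma> C U \<Phi> \<theta> \<le> (INF n\<in>{n. \<Phi> = weak_words n}. V (last_state \<theta>) n)"
      proof (rule INF_greatest)
        fix n assume "n \<in> {n. \<Phi> = weak_words n}"
        then show "sched_eqs \<Gamma> \<sigma> C U \<Phi> \<theta> \<le> V (last_state \<theta>) n"
          using True U_le[of \<theta> n] by (simp add: good_def)
      qed
      also have "\<dots> = U \<Phi> \<theta>" unfolding U_def if_P[OF True] ..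
      finally show ?thesis .
    next
      case False
      then show ?thesis unfolding U_def by (simp only: if_False top_greatest)
    qed
  qed
  then have "1 \<le> V (last_state \<theta>) n" if "good \<theta> n" for \<theta> n
    using that U[OF that] unfolding good_def by (metis order_trans)
  then have "1 \<le> V t n" if "W t n" for t n
    using that unfolding W_def by blast
  moreover have "good (empty_comp s0) a"
    using prob by (simp add: good_def comps.intros)
  then have "W s0 a" using W by fastforce
  moreover have "t \<in> procs" if "W t n" for t n
    using that comps_procs s0 unfolding W_def good_def by blast
  ultimately show ?thesis
    unfolding V_def by (intro almost_sure_coinduct[where W = W])
qed

text \<open>The scheduler remembers the remaining requirement \<open>n\<close> and a number \<open>k\<close> of rounds, and makes
  the moves that are optimal for \<open>k\<close> rounds. When the value for the remaining rounds is 0, it starts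
  again with a number of rounds for which the value is at least 1/2. So success occurs with
  probability at least \<open>\<gamma> + (1 - \<gamma>) / 2\<close> if \<open>\<gamma>\<close> is the infimum over all histories at which it has just
  started again, whence \<open>\<gamma> = 1\<close>.\<close>

lemma sched_if_almost_sure:
  assumes init: "almost_sure \<Gamma> C s0 n0"
  shows "\<exists>\<sigma>\<in>sched \<Gamma> s0. sched_prob \<Gamma> \<sigma> (weak_words n0) C (empty_comp s0) = 1"
proof -
  define W where "W = almost_sure \<Gamma> C"
  define V where "V = game_rounds \<Gamma> W C"
  \<comment> \<open>The value 1 on \<open>W\<close> is a supremum over finite numbers of rounds, so
    some number of rounds yields at least 1/2. Any constant strictly between 0 and 1 would
    serve.\<close>
  define K where "K s n = (SOME k. ennreal (1/2) \<le> V k s n)" for s n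
  have half: "ennreal (1/2) < 1"
    using ennreal_lessI[of 1 "1/2"] by simp
  have K: "ennreal (1/2) \<le> V (K s n) s n" if "W s n" for s n
  proof -
    have "ennreal (1/2) < (SUP k. V k s n)"
      using almost_sure_value(2)[of \<Gamma> C s n] that half by (simp add: V_def W_def flip: reach_value_SUP)
    then obtain k where "ennreal (1/2) \<le> V k s n"
      by (auto simp: less_SUP_iff intro: less_imp_le)
    then show ?thesis unfolding K_def by (rule someI)
  qed
  \<comment> \<open>A move uses up one round. The attempt counts as failed when the state reached
    has value 0 for the rounds that are left, in particular when none is left.\<close>
  define upd where "upd = (\<lambda>(n, k) (l, t). let n' = (case l of LAct x \<Rightarrow> needs_after n x | LProb p \<Rightarrow> n)
      in (n', if V (k - 1) t n' = 0 then K t n' else k - 1))"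
  define mem where "mem \<theta> = foldl upd (n0, K s0 n0) (snd \<theta>)" for \<theta> :: "('a, 'c, 'd) comp"
  define best where "best N n k x P \<longleftrightarrow> (x, P) \<in> moves \<Gamma> N \<and> x \<in> {Tau, n} \<and>
      V (k - 1) (Pr P) (needs_after n x) = V k (Nd N) n" for N n k x P
  define fire where "fire N n k = (SOME D. \<exists>x P. D = Fire x P \<and> best N n k x P)" for N n k
  \<comment> \<open>Halting without success is a mere default: the estimate \<open>lower\<close>
    concerns histories of positive value, and there a best move exists at each nondeterministic
    state short of success.\<close>
  define \<sigma> where "\<sigma> \<theta> = (case mem \<theta> of (n, k) \<Rightarrow>
      if n = Tau \<and> last_state \<theta> \<in> C then Halt
      else case last_state \<theta> of Pr P \<Rightarrow> Continue
        | Nd N \<Rightarrow> if \<exists>x P. best N n k x P then fire N n k else Halt)" for \<theta>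
  have fire: "\<exists>x P. fire N n k = Fire x P \<and> best N n k x P" if "\<exists>x P. best N n k x P" for N n k
    unfolding fire_def using that by (intro someI_ex[where P = "\<lambda>D. \<exists>x P. D = Fire x P \<and> best N n k x P"]) blast
  have sched: "\<sigma> \<in> sched \<Gamma> s0"
    unfolding sched_def
  proof (intro CollectI ballI)
    fix \<theta>
    obtain n k where mem: "mem \<theta> = (n, k)" by (cases "mem \<theta>")
    show "case last_state \<theta> of
        Nd N \<Rightarrow> \<sigma> \<theta> = Halt \<or> (\<exists>a P. atrans \<Gamma> N a P \<and> \<sigma> \<theta> = Fire a P)
      | Pr P \<Rightarrow> \<sigma> \<theta> = Halt \<or> \<sigma> \<theta> = Continue"
    proof (cases "last_state \<theta>")
      case (Nd N)
      show ?thesis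
      proof (cases "\<sigma> \<theta> = Halt")
        case False
        then have "\<exists>x P. best N n k x P" and \<sigma>: "\<sigma> \<theta> = fire N n k"
          using Nd by (auto simp: \<sigma>_def mem split: if_splits)
        from fire[OF this(1)] show ?thesis
          using Nd \<sigma> by (auto simp: best_def moves_def)
      qed (simp add: Nd)
    qed (simp add: \<sigma>_def mem)
  qed
  have s0: "s0 \<in> procs" using almost_sure_value(1)[OF init] .
  define h where "h \<theta> = sched_prob \<Gamma> \<sigma> (weak_words (fst (mem \<theta>))) C \<theta>" for \<theta>
  define renew where "renew = {\<theta> \<in> comps \<Gamma> s0. W (last_state \<theta>) (fst (mem \<theta>)) \<and>
      mem \<theta> = (fst (mem \<theta>), K (last_state \<theta>) (fst (mem \<theta>)))}"
  define \<gamma> where "\<gamma> = (INF \<theta>\<in>renew. h \<theta>)"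
  define g where "g = enn2real \<gamma>"
  have init_renew: "empty_comp s0 \<in> renew"
    using init by (simp add: renew_def mem_def W_def comps.intros)
  have h_le_1: "h \<theta> \<le> 1" if "\<theta> \<in> comps \<Gamma> s0" for \<theta>
    unfolding h_def by (rule sched_prob_le_1[OF s0 sched that])
  have "\<gamma> \<le> 1"
    unfolding \<gamma>_def using init_renew h_le_1
    by (intro INF_lower2[OF init_renew]) (auto simp: renew_def)
  then have \<gamma>: "\<gamma> = ennreal g" and g: "0 \<le> g" "g \<le> 1"
    unfolding g_def by (auto simp: less_top[symmetric] top_unique enn2real_leI intro!: ennreal_enn2real[symmetric])
  define \<delta> where "\<delta> = ennreal (1 - g)"
  have \<gamma>\<delta>: "\<gamma> + \<delta> = 1"
    using g by (simp add: \<gamma> \<delta>_def flip: ennreal_plus)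
  have mem_extend: "mem (extend \<theta> l t) = upd (mem \<theta>) (l, t)" for \<theta> l t
    by (simp add: mem_def extend_def)
  have V_W: "W s n" if "V k s n \<noteq> 0" for k s n
    using that by (cases k) (auto simp: V_def game_round_def split: if_splits)
  \<comment> \<open>The current attempt succeeds with probability at least \<open>V k\<close>, which
    is worth \<open>\<gamma> + \<delta> = 1\<close>, and otherwise ends in a restart, worth at least
    \<open>\<gamma>\<close>. The bound is affine in \<open>V k\<close> and therefore survives
    averaging over probabilistic branches.\<close>
  have lower: "\<gamma> + V k (last_state \<theta>) n * \<delta> \<le> h \<theta>"
    if "\<theta> \<in> comps \<Gamma> s0" "mem \<theta> = (n, k)" "V k (last_state \<theta>) n \<noteq> 0" for \<theta> n k
    using that
  proof (induction k arbitrary: \<theta> n)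
    case 0
    then show ?case by (simp add: V_def)
  next
    case (Suc k)
    note \<theta> = Suc.prems
    have W: "W (last_state \<theta>) n" using V_W \<theta>(3) .
    have V_Suc: "V (Suc k) = game_round \<Gamma> W C (V k)" by (simp add: V_def)
    have after: "\<gamma> + V k t n' * \<delta> \<le> h (extend \<theta> l t)"
      if "extend \<theta> l t \<in> comps \<Gamma> s0" "W t n'" "n' = (case l of LAct x \<Rightarrow> needs_after n x | LProb p \<Rightarrow> n)" for l t n'
    proof (cases "V k t n' = 0")
      case True
      then have "extend \<theta> l t \<in> renew"
        using that \<theta>(2) by (simp add: renew_def mem_extend upd_def Let_def)
      then have "\<gamma> \<le> h (extend \<theta> l t)" unfolding \<gamma>_def by (rule INF_lower)
      with True show ?thesis by simp
    next
      case False
      have "mem (extend \<theta> l t) = (n', k)"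
        using False \<theta>(2) that(3) by (simp add: mem_extend upd_def Let_def)
      from Suc.IH[OF that(1) this] False show ?thesis by simp
    qed
    show ?case
    proof (cases "n = Tau \<and> last_state \<theta> \<in> C")
      case True
      then have "V (Suc k) (last_state \<theta>) n = 1" using W by (simp add: V_Suc game_round_def)
      moreover have "h \<theta> = 1"
        using True \<theta>(2) by (simp add: h_def \<sigma>_def sched_prob_halt Nil_in_weak_words)
      ultimately show ?thesis by (simp add: \<gamma>\<delta>)
    next
      case no_success: False
      show ?thesis
      proof (cases "last_state \<theta>")
        case (Nd N)
        let ?A = "{(x, P). (x, P) \<in> moves \<Gamma> N \<and> x \<in> {Tau, n}}"
        let ?f = "\<lambda>(x, P). V k (Pr P) (needs_after n x)"
        have SUP: "V (Suc k) (Nd N) n = (SUP y\<in>?A. ?f y)"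
          using W no_success Nd by (auto simp: V_Suc game_round_def)
        have fin: "finite (?f ` ?A)"
        proof (rule finite_imageI, rule finite_subset)
          show "finite (moves \<Gamma> N)"
            using comps_procs[OF \<theta>(1) s0] Nd by (auto intro: finite_moves wf)
        qed auto
        have "?A \<noteq> {}"
        proof
          assume "?A = {}"
          then have "V (Suc k) (Nd N) n = 0" unfolding SUP \<open>?A = {}\<close> by (simp add: bot_ennreal)
          with \<theta>(3) Nd show False by simp
        qed
        with fin have "(SUP y\<in>?A. ?f y) \<in> ?f ` ?A"
          by (subst Max_Sup[symmetric]) (auto intro!: Max_in)
        then have "\<exists>x P. best N n (Suc k) x P"
          unfolding SUP[symmetric] by (force simp: best_def)
        from fire[OF this] obtain x P where xP: "fire N n (Suc k) = Fire x P" "best N n (Suc k) x P"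
          by blast
        then have \<sigma>: "\<sigma> \<theta> = Fire x P"
          using no_success Nd \<theta>(2) by (auto simp: \<sigma>_def)
        have x: "x \<in> {Tau, n}" "atrans \<Gamma> N x P" "V k (Pr P) (needs_after n x) = V (Suc k) (Nd N) n"
          using xP(2) by (auto simp: best_def moves_def)
        let ?\<theta> = "extend \<theta> (LAct x) (Pr P)"
        have comp: "?\<theta> \<in> comps \<Gamma> s0" using \<theta>(1) Nd x(2) by (rule comps_move)
        have "\<gamma> + V (Suc k) (last_state \<theta>) n * \<delta> = \<gamma> + V k (Pr P) (needs_after n x) * \<delta>"
          using x Nd by simp
        also have "\<dots> \<le> h ?\<theta>"
          using comp x(3) \<theta>(3) Nd V_W[of k "Pr P" "needs_after n x"] by (intro after) auto
        also have "h ?\<theta> = h \<theta>"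
          using Nd \<sigma> x(1) \<theta>(2) by (auto simp: h_def sched_prob_fire weak_words_deriv mem_extend upd_def Let_def)
        finally show ?thesis .
      next
        case (Pr P)
        have P: "wf_pterm P" using comps_procs[OF \<theta>(1) s0] Pr by simp
        have \<sigma>: "\<sigma> \<theta> = Continue"
          using no_success Pr \<theta>(2) by (auto simp: \<sigma>_def)
        have V: "V (Suc k) (Pr P) n = (\<integral>\<^sup>+u. V k u n \<partial>pdist \<Gamma> (Pr P))"
          and succ: "\<And>u. u \<in> set_pmf (pdist \<Gamma> (Pr P)) \<Longrightarrow> W u n"
          using \<theta>(3) no_success Pr by (auto simp: V_Suc game_round_def split: if_splits)
        let ?\<theta> = "\<lambda>p N. extend \<theta> (LProb p) (Nd N)"
        have "\<gamma> + V (Suc k) (last_state \<theta>) n * \<delta> = (\<integral>\<^sup>+u. \<gamma> + V k u n * \<delta> \<partial>pdist \<Gamma> (Pr P))"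
          by (simp add: Pr V nn_integral_add nn_integral_multc)
        also have "\<dots> = (\<Sum>(d, p, N)\<in>derivs \<Gamma> P. ennreal p * (\<gamma> + V k (Nd N) n * \<delta>))"
          by (simp add: nn_integral_dist[OF wf P] weighted_sum_def)
        also have "\<dots> \<le> (\<Sum>(d, p, N)\<in>derivs \<Gamma> P. ennreal p * h (?\<theta> p N))"
        proof (intro sum_mono, clarify)
          fix d p N assume d: "(d, p, N) \<in> derivs \<Gamma> P"
          have "W (Nd N) n"
            using d P by (intro succ) (auto simp: set_dist_Pr[OF wf] derivs_def)
          then show "ennreal p * (\<gamma> + V k (Nd N) n * \<delta>) \<le> ennreal p * h (?\<theta> p N)"
            using comps_prob[OF \<theta>(1) Pr d] by (intro mult_left_mono after) auto
        qed
        also have "\<dots> = h \<theta>"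
          using Pr \<sigma> \<theta>(2) by (simp add: h_def sched_prob_continue mem_extend upd_def case_prod_beta)
        finally show ?thesis .
      qed
    qed
  qed
  have "\<gamma> + ennreal (1/2) * \<delta> \<le> (INF \<theta>\<in>renew. h \<theta>)"
  proof (rule INF_greatest)
    fix \<theta> assume \<theta>: "\<theta> \<in> renew"
    define n where "n = fst (mem \<theta>)"
    have W: "W (last_state \<theta>) n" and mem: "mem \<theta> = (n, K (last_state \<theta>) n)" and comp: "\<theta> \<in> comps \<Gamma> s0"
      using \<theta> by (auto simp: renew_def n_def)
    have "V (K (last_state \<theta>) n) (last_state \<theta>) n \<noteq> 0"
      using K[OF W] by (auto simp: ennreal_eq_0_iff)
    from lower[OF comp mem this] K[OF W]
    show "\<gamma> + ennreal (1/2) * \<delta> \<le> h \<theta>"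
      by (meson add_left_mono mult_right_mono order_trans zero_le)
  qed
  then have "\<gamma> + ennreal (1/2) * \<delta> \<le> \<gamma>"
    by (simp only: flip: \<gamma>_def)
  then have "ennreal (g + (1/2) * (1 - g)) \<le> ennreal g"
    using g unfolding \<gamma> \<delta>_def by (subst ennreal_plus) (auto simp: ennreal_mult)
  then have "g + (1/2) * (1 - g) \<le> g" using g by (simp add: ennreal_le_iff)
  with g have "\<gamma> = 1" by (simp add: \<gamma>)
  then have "1 \<le> h (empty_comp s0)"
    using INF_lower[OF init_renew, of h] by (simp add: \<gamma>_def)
  moreover have "h (empty_comp s0) \<le> 1" by (intro h_le_1 comps.intros)
  ultimately show ?thesis
    using sched by (intro bexI[of _ \<sigma>]) (auto simp: h_def mem_def)
qed

end

section \<open>Bisimulations\<close>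

text \<open>The ability of \<open>t\<close> to answer an \<open>a\<close>-transition into \<open>C\<close> that is made by a state of the \<open>B\<close>-class of
  \<open>t\<close>. In the branching case the paper has the source \<open>s\<close> of that transition in place of \<open>t\<close> in
  \<open>(t, t_bar) \<in> B\<close>, which is the same since \<open>(s, t) \<in> B\<close>.\<close>

definition match ::
  "('a, 'c, 'd) env \<Rightarrow> bool \<Rightarrow> ('a, 'c, 'd) proc rel \<Rightarrow> ('a, 'c, 'd) proc set
    \<Rightarrow> ('a, 'c, 'd) proc \<Rightarrow> 'a act \<Rightarrow> bool" where
  "match \<Gamma> weak B C t a =
     (if weak then almost_sure \<Gamma> C t a
      else a = Tau \<and> t \<in> C \<or>
        (\<exists>t_bar t'. silent_reach \<Gamma> t t_bar \<and> step \<Gamma> t_bar (LAct a) t' \<and> (t, t_bar) \<in> B \<and> t' \<in> C))"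

text \<open>The equality of class probabilities is stated as the existence of a coupling inside
  \<open>B\<close>. Couplings pass along maps, products and relational composition by general
  rules.\<close>

definition bisim :: "('a, 'c, 'd) env \<Rightarrow> bool \<Rightarrow> ('a, 'c, 'd) proc rel \<Rightarrow> bool" where
  "bisim \<Gamma> weak B \<longleftrightarrow> equiv procs B \<and>
     (\<forall>s t. (s, t) \<in> B \<longrightarrow> (\<forall>a s'. step \<Gamma> s (LAct a) s' \<longrightarrow> match \<Gamma> weak B (B `` {s'}) t a) \<and>
        rel_pmf (\<lambda>x y. (x, y) \<in> B) (pdist \<Gamma> s) (pdist \<Gamma> t))"

definition bisimilarity :: "('a, 'c, 'd) env \<Rightarrow> bool \<Rightarrow> ('a, 'c, 'd) proc rel" where
  "bisimilarity \<Gamma> weak = \<Union>{B. bisim \<Gamma> weak B}"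

text \<open>Reduction to equivalences on the whole type: the elements outside \<open>A\<close>
  become singleton classes, and these have measure 0 because both supports lie in
  \<open>A\<close>.\<close>

lemma rel_pmf_iff_quotient:
  assumes B: "equiv A B" and p: "set_pmf p \<subseteq> A" and q: "set_pmf q \<subseteq> A"
  shows "rel_pmf (\<lambda>x y. (x, y) \<in> B) p q \<longleftrightarrow> (\<forall>C\<in>A // B. measure p C = measure q C)"
proof -
  define R where "R x y \<longleftrightarrow> (x, y) \<in> B \<or> x = y" for x y
  have sub: "B \<subseteq> A \<times> A" and refl: "refl_on A B" and sym: "sym B" and trans: "trans B"
    using B by (auto elim: equivE)
  have "equivp R"
    using sym trans by (auto simp: R_def intro!: equivpI reflpI sympI transpI dest: symD transD)
  have "rel_pmf (\<lambda>x y. (x, y) \<in> B) p q \<longleftrightarrow> rel_pmf R p q"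
    using p refl by (auto simp: R_def refl_on_def elim!: pmf.rel_mono_strong)
  also have "\<dots> \<longleftrightarrow> (\<forall>C\<in>UNIV // {(x, y). R x y}. measure p C = measure q C)"
    by (rule rel_pmf_iff_equivp) fact
  also have "\<dots> \<longleftrightarrow> (\<forall>C\<in>A // B. measure p C = measure q C)"
  proof (intro iffI ballI)
    fix C assume *: "\<forall>C\<in>UNIV // {(x, y). R x y}. measure p C = measure q C" and "C \<in> A // B"
    then obtain x where x: "x \<in> A" "C = B `` {x}" by (auto elim: quotientE)
    then have "C = {(x, y). R x y} `` {x}" using refl by (auto simp: R_def refl_on_def)
    then have "C \<in> UNIV // {(x, y). R x y}" by (simp only: quotientI UNIV_I)
    with * show "measure p C = measure q C" by blast
  next
    fix C assume *: "\<forall>C\<in>A // B. measure p C = measure q C" and "C \<in> UNIV // {(x, y). R x y}"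
    then obtain x where x: "C = {(x, y). R x y} `` {x}" by (auto elim: quotientE)
    show "measure p C = measure q C"
    proof (cases "x \<in> A")
      case True
      then have "C = B `` {x}" unfolding x using refl by (auto simp: R_def refl_on_def)
      then have "C \<in> A // B" using True by (auto intro: quotientI)
      with * show ?thesis by blast
    next
      case False
      then have "C = {x}" unfolding x using sub by (auto simp: R_def)
      with False p q have "pmf p x = 0" "pmf q x = 0" by (auto simp: set_pmf_iff)
      with \<open>C = {x}\<close> show ?thesis by (simp add: measure_pmf_single)
    qed
  qed
  finally show ?thesis .
qed

lemma match_stay: "t \<in> procs \<Longrightarrow> t \<in> C \<Longrightarrow> match \<Gamma> weak B C t Tau"
  by (simp add: match_def almost_sure_success)

lemma silent_reach_step: "step \<Gamma> s (LAct Tau) s' \<Longrightarrow> silent_reach \<Gamma> s s'"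
  by (auto simp: silent_reach_def silent_step_def)

lemma silent_reach_trans: "silent_reach \<Gamma> s t \<Longrightarrow> silent_reach \<Gamma> t u \<Longrightarrow> silent_reach \<Gamma> s u"
  by (simp add: silent_reach_def)

lemma bisim_procs: "bisim \<Gamma> weak B \<Longrightarrow> (s, t) \<in> B \<Longrightarrow> s \<in> procs \<and> t \<in> procs"
  by (auto simp: bisim_def elim: equivE)

lemma bisimilarityI: "bisim \<Gamma> weak B \<Longrightarrow> (s, t) \<in> B \<Longrightarrow> (s, t) \<in> bisimilarity \<Gamma> weak"
  by (auto simp: bisimilarity_def)

lemma bisim_subset: "bisim \<Gamma> weak B \<Longrightarrow> B \<subseteq> bisimilarity \<Gamma> weak"
  by (auto simp: bisimilarity_def)

context
  fixes \<Gamma> :: "('a, 'c, 'd) env"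
  assumes wf: "wf_env \<Gamma>"
begin

section \<open>Agreement of \<open>bisim\<close> with the two given notions of bisimulation\<close>

lemma step_prob_eq_pmf:
  assumes "s \<in> procs"
  shows "step_prob \<Gamma> s u = pmf (pdist \<Gamma> s) u"
proof (cases s)
  case (Nd N)
  then show ?thesis by (simp add: pmf_return)
next
  case (Pr P)
  then have P: "wf_pterm P" using assms by simp
  show ?thesis
  proof (cases u)
    case (Nd N)
    let ?A = "{(d, p). ptrans \<Gamma> P d p N}"
    have fin: "finite (derivs \<Gamma> P)" and pos: "\<And>d p N. ptrans \<Gamma> P d p N \<Longrightarrow> 0 < p"
      using stochastic[OF P wf] by (auto simp: stochastic_def derivs_def)
    have "ennreal (pmf (pdist \<Gamma> s) u) = (\<integral>\<^sup>+x. indicator {u} x \<partial>pdist \<Gamma> (Pr P))"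
      by (simp add: emeasure_pmf_single Pr)
    also have "\<dots> = (\<Sum>(d, p, M)\<in>derivs \<Gamma> P. ennreal p * indicator {u} (Nd M))"
      unfolding nn_integral_dist[OF wf P] weighted_sum_def ..
    also have "\<dots> = (\<Sum>(d, p, M)\<in>(\<lambda>(d, p). (d, p, N)) ` ?A. ennreal p * indicator {u} (Nd M))"
      using fin by (intro sum.mono_neutral_right) (auto simp: derivs_def Nd indicator_def)
    also have "\<dots> = (\<Sum>(d, p)\<in>?A. ennreal p)"
      by (subst sum.reindex) (auto simp: inj_on_def Nd case_prod_beta)
    also have "\<dots> = ennreal (\<Sum>(d, p)\<in>?A. p)"
      using pos by (subst sum_ennreal[symmetric]) (auto simp: case_prod_beta intro: less_imp_le)
    also have "(\<Sum>(d, p)\<in>?A. p) = step_prob \<Gamma> s u" by (simp add: Pr Nd)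
    finally have "ennreal (pmf (pdist \<Gamma> s) u) = ennreal (step_prob \<Gamma> s u)" .
    moreover have "0 \<le> step_prob \<Gamma> s u"
      using pos by (auto simp: Pr Nd intro!: sum_nonneg dest: less_imp_le)
    ultimately show ?thesis by (simp add: ennreal_inj)
  next
    case (Pr Q)
    then show ?thesis
      using set_dist[OF wf assms, of u] \<open>s = _\<close> by (auto simp: set_pmf_iff)
  qed
qed

lemma finite_set_pdist: "s \<in> procs \<Longrightarrow> finite (set_pmf (pdist \<Gamma> s))"
proof (cases s)
  case (Pr P)
  assume "s \<in> procs"
  then have P: "wf_pterm P" using Pr by simp
  have "set_pmf (pdist \<Gamma> s) = (\<lambda>(d, p, N). Nd N) ` derivs \<Gamma> P"
    by (force simp: Pr set_dist_Pr[OF wf P] derivs_def image_iff)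
  then show ?thesis using stochastic[OF P wf] by (simp add: stochastic_def)
qed simp

lemma class_prob_eq_measure:
  assumes "s \<in> procs"
  shows "class_prob \<Gamma> s C = measure (pdist \<Gamma> s) C"
proof -
  have "class_prob \<Gamma> s C = (\<Sum>\<^sub>\<infinity>u\<in>C \<inter> set_pmf (pdist \<Gamma> s). pmf (pdist \<Gamma> s) u)"
    unfolding class_prob_def step_prob_eq_pmf[OF assms]
    by (rule infsum_cong_neutral) (auto simp: set_pmf_iff)
  also have "\<dots> = measure (pdist \<Gamma> s) (C \<inter> set_pmf (pdist \<Gamma> s))"
    using finite_set_pdist[OF assms] by (simp add: measure_measure_pmf_finite)
  finally show ?thesis by (simp add: measure_Int_set_pmf)
qed

lemma class_prob_iff_rel_pmf:
  assumes "equiv procs B" "s \<in> procs" "t \<in> procs"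
  shows "(\<forall>C\<in>procs // B. class_prob \<Gamma> s C = class_prob \<Gamma> t C) \<longleftrightarrow>
    rel_pmf (\<lambda>x y. (x, y) \<in> B) (pdist \<Gamma> s) (pdist \<Gamma> t)"
  using assms set_dist[OF wf]
  by (subst rel_pmf_iff_quotient[OF assms(1)]) (auto simp: class_prob_eq_measure)

lemma almost_sure_iff_sched: "s \<in> procs \<Longrightarrow> almost_sure \<Gamma> C s a \<longleftrightarrow>
    (\<exists>\<sigma>\<in>sched \<Gamma> s. sched_prob \<Gamma> \<sigma> (weak_words a) C (empty_comp s) = 1)"
  using almost_sure_if_sched[OF wf] sched_if_almost_sure[OF wf] by blast

lemma bisim_weak_iff: "bisim \<Gamma> True B \<longleftrightarrow> weak_prob_bisimulation \<Gamma> B"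
proof (cases "equiv procs B")
  case True
  have "(\<forall>a s'. step \<Gamma> s (LAct a) s' \<longrightarrow> match \<Gamma> True B (B `` {s'}) t a) \<and>
        rel_pmf (\<lambda>x y. (x, y) \<in> B) (pdist \<Gamma> s) (pdist \<Gamma> t) \<longleftrightarrow>
      (\<forall>a s'. step \<Gamma> s (LAct a) s' \<longrightarrow>
        (\<exists>\<sigma>\<in>sched \<Gamma> t. sched_prob \<Gamma> \<sigma> (weak_words a) (B `` {s'}) (empty_comp t) = 1)) \<and>
      (\<forall>C\<in>procs // B. class_prob \<Gamma> s C = class_prob \<Gamma> t C)" if "(s, t) \<in> B" for s t
  proof -
    have "s \<in> procs" "t \<in> procs" using that True by (auto elim: equivE)
    with class_prob_iff_rel_pmf[OF True this] show ?thesis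
      by (simp add: match_def almost_sure_iff_sched)
  qed
  with True show ?thesis
    by (simp add: bisim_def weak_prob_bisimulation_def Ball_def)
qed (simp add: bisim_def weak_prob_bisimulation_def)

lemma bisim_branching_iff: "bisim \<Gamma> False B \<longleftrightarrow> prob_branching_bisimulation \<Gamma> B"
proof (cases "equiv procs B")
  case True
  have "(\<forall>a s'. step \<Gamma> s (LAct a) s' \<longrightarrow> match \<Gamma> False B (B `` {s'}) t a) \<and>
        rel_pmf (\<lambda>x y. (x, y) \<in> B) (pdist \<Gamma> s) (pdist \<Gamma> t) \<longleftrightarrow>
      (\<forall>a s'. step \<Gamma> s (LAct a) s' \<longrightarrow> a = Tau \<and> (s', t) \<in> B \<or>
        (\<exists>t_bar t'. silent_reach \<Gamma> t t_bar \<and> step \<Gamma> t_bar (LAct a) t' \<and> (s, t_bar) \<in> B \<and> (s', t') \<in> B)) \<and>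
      (\<forall>C\<in>procs // B. class_prob \<Gamma> s C = class_prob \<Gamma> t C)" if "(s, t) \<in> B" for s t
  proof -
    have "s \<in> procs" "t \<in> procs" using that True by (auto elim: equivE)
    moreover have "(t, u) \<in> B \<longleftrightarrow> (s, u) \<in> B" for u
      using that True by (auto elim!: equivE dest: symD transD)
    ultimately show ?thesis
      using class_prob_iff_rel_pmf[OF True, of s t] by (simp add: match_def)
  qed
  with True show ?thesis
    by (simp add: bisim_def prob_branching_bisimulation_def Ball_def)
qed (simp add: bisim_def prob_branching_bisimulation_def)

lemma weak_prob_bisimilarity_eq: "weak_prob_bisimilarity \<Gamma> = bisimilarity \<Gamma> True"
  by (simp add: weak_prob_bisimilarity_def bisimilarity_def bisim_weak_iff)

lemma prob_branching_bisimilarity_eq: "prob_branching_bisimilarity \<Gamma> = bisimilarity \<Gamma> False"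
  by (simp add: prob_branching_bisimilarity_def bisimilarity_def bisim_branching_iff)

section \<open>Bisimilarity as the largest bisimulation\<close>

lemma match_mono: "match \<Gamma> weak B C t a \<Longrightarrow> B \<subseteq> B' \<Longrightarrow> C \<subseteq> C' \<Longrightarrow> match \<Gamma> weak B' C' t a"
  by (cases weak) (auto simp: match_def almost_sure_mono[OF wf])

lemma match_step:
  assumes "t \<in> procs" "step \<Gamma> t (LAct a) t'" "t' \<in> C" "(t, t) \<in> B"
  shows "match \<Gamma> weak B C t a"
proof (cases weak)
  case True
  from assms(2) obtain N P where "t = Nd N" "t' = Pr P" "atrans \<Gamma> N a P" by (auto elim: step.cases)
  with True assms show ?thesis by (auto simp: match_def intro: almost_sure_move[OF wf])
next
  case False
  with assms show ?thesis by (auto simp: match_def silent_reach_def)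
qed

lemma step_prob_iff: "Pr P \<in> procs \<Longrightarrow> (\<exists>p. step \<Gamma> (Pr P) (LProb p) u) \<longleftrightarrow> u \<in> set_pmf (pdist \<Gamma> (Pr P))"
  by (auto simp: set_dist_Pr[OF wf] intro: step.intros elim!: step.cases)

lemma silent_step_cases:
  assumes "silent_step \<Gamma> s s'" "s \<in> procs"
  obtains "step \<Gamma> s (LAct Tau) s'" | P where "s = Pr P" "s' \<in> set_pmf (pdist \<Gamma> s)"
proof -
  consider "step \<Gamma> s (LAct Tau) s'" | p where "step \<Gamma> s (LProb p) s'"
    using assms(1) by (auto simp: silent_step_def)
  then show thesis
  proof cases
    case (2 p)
    then obtain P where "s = Pr P" by (auto elim: step.cases)
    with 2 assms(2) that(2) step_prob_iff show thesis by blast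
  qed (rule that(1))
qed

lemma silent_reach_pdist:
  assumes "s \<in> procs" "u \<in> set_pmf (pdist \<Gamma> s)"
  shows "silent_reach \<Gamma> s u"
proof (cases s)
  case (Nd N)
  with assms show ?thesis by (simp add: silent_reach_def)
next
  case (Pr P)
  with assms step_prob_iff[of P u] obtain p where "step \<Gamma> s (LProb p) u" by auto
  then show ?thesis
    unfolding silent_reach_def by (intro r_into_rtranclp) (auto simp: silent_step_def)
qed

lemma silent_reach_procs: "silent_reach \<Gamma> s t \<Longrightarrow> s \<in> procs \<Longrightarrow> t \<in> procs"
  unfolding silent_reach_def
  by (induction rule: rtranclp_induct) (auto simp: silent_step_def dest: step_procs[OF wf])

lemma bisim_silent_reach:
  assumes B: "bisim \<Gamma> False B" and "silent_reach \<Gamma> s s'" "(s, t) \<in> B"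
  shows "\<exists>t'. silent_reach \<Gamma> t t' \<and> (s', t') \<in> B"
  using assms(2)[unfolded silent_reach_def] assms(3)
proof (induction rule: rtranclp_induct)
  case base
  then show ?case by (auto simp: silent_reach_def)
next
  case (step u u')
  then obtain v where v: "silent_reach \<Gamma> t v" "(u, v) \<in> B" by blast
  have uv: "u \<in> procs" "v \<in> procs" using bisim_procs[OF B v(2)] by auto
  from step(2) uv(1) show ?case
  proof (cases rule: silent_step_cases)
    case 1
    with B v(2) have "match \<Gamma> False B (B `` {u'}) v Tau" by (auto simp: bisim_def)
    then consider "(u', v) \<in> B" | w w' where "silent_reach \<Gamma> v w" "step \<Gamma> w (LAct Tau) w'" "(u', w') \<in> B"
      by (auto simp: match_def)
    then show ?thesis
    proof cases
      case 2
      then have "silent_reach \<Gamma> t w'"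
        using v(1) silent_reach_step silent_reach_trans by blast
      with 2 show ?thesis by blast
    qed (use v in blast)
  next
    case (2 P)
    have "rel_pmf (\<lambda>x y. (x, y) \<in> B) (pdist \<Gamma> u) (pdist \<Gamma> v)"
      using B v(2) by (auto simp: bisim_def)
    from rel_pmf_imp_rel_set[OF this] 2 obtain v' where "v' \<in> set_pmf (pdist \<Gamma> v)" "(u', v') \<in> B"
      by (auto simp: rel_set_def)
    then show ?thesis
      using silent_reach_pdist[OF uv(2)] v(1) silent_reach_trans by blast
  qed
qed

text \<open>The relation \<open>T\<close> is kept apart from \<open>B\<close> because the lemma is
  needed for the transitive closure of all bisimulations before that closure is known to be a
  bisimulation.\<close>

lemma match_transfer:
  assumes B: "bisim \<Gamma> weak B" and tu: "(t, u) \<in> B"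
    and T: "B \<subseteq> T" "sym T" "trans T" "T `` C \<subseteq> C"
    and m: "match \<Gamma> weak T C t a"
  shows "match \<Gamma> weak T C u a"
proof (cases weak)
  case True
  have "almost_sure \<Gamma> C u (id a)"
  proof (rule almost_sure_transfer[OF wf, where S = B and a = a and C = C and lam = id and ?n0.0 = a and ?s0.0 = t])
    show "almost_sure \<Gamma> (B `` {s'}) t (id x)" if "(s, t) \<in> B" "step \<Gamma> s (LAct x) s'" "x \<in> {Tau, a}" for s t x s'
      using that B True by (auto simp: bisim_def match_def)
  qed (use B T m tu True bisim_procs[OF B] in \<open>auto simp: match_def bisim_def\<close>)
  with True show ?thesis by (simp add: match_def)
next
  case False
  with m consider "a = Tau" "t \<in> C" | t_bar t' where
      "silent_reach \<Gamma> t t_bar" "step \<Gamma> t_bar (LAct a) t'" "(t, t_bar) \<in> T" "t' \<in> C"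
    by (auto simp: match_def)
  then show ?thesis
  proof cases
    case 1
    then show ?thesis using tu T False by (auto simp: match_def)
  next
    case 2
    from bisim_silent_reach[OF _ 2(1) tu] B False
    obtain u_bar where u: "silent_reach \<Gamma> u u_bar" "(t_bar, u_bar) \<in> B" by auto
    have T_u: "(u, u_bar) \<in> T"
      using tu u(2) 2(3) T by (meson subsetD symD transD)
    from B u(2) 2(2) have "match \<Gamma> False B (B `` {t'}) u_bar a"
      using False by (auto simp: bisim_def)
    then consider "a = Tau" "(t', u_bar) \<in> B" | v v' where "silent_reach \<Gamma> u_bar v"
        "step \<Gamma> v (LAct a) v'" "(u_bar, v) \<in> B" "(t', v') \<in> B"
      by (auto simp: match_def)
    then show ?thesis
    proof cases
      case 1
      \<comment> \<open>The final answer is a stutter. As \<open>C\<close> is closed under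
        \<open>T\<close>, it contains \<open>u_bar\<close> and with it \<open>u\<close>, so
        \<open>u\<close> may stay from the beginning.\<close>
      then have "u_bar \<in> C" using 2(4) T by auto
      then have "u \<in> C" using T_u T by (auto dest: symD)
      with 1 False show ?thesis by (simp add: match_def)
    next
      case v: 2
      have "silent_reach \<Gamma> u v" "(u, v) \<in> T" "v' \<in> C"
        using u(1) v(1) T_u v(3,4) T 2(4) by (auto intro: silent_reach_trans dest: transD)
      with v(2) False show ?thesis by (auto simp: match_def)
    qed
  qed
qed

lemma bisim_Id_on: "bisim \<Gamma> weak (Id_on procs)"
proof -
  have "equiv procs (Id_on procs)" by (auto intro!: equivI refl_onI symI transI)
  moreover have "match \<Gamma> weak (Id_on procs) (Id_on procs `` {s'}) t a"
    if "(s, t) \<in> Id_on procs" "step \<Gamma> s (LAct a) s'" for s t a s'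
    using that step_procs[OF wf] by (intro match_step[where t' = s']) (auto simp: Id_on_def)
  moreover have "rel_pmf (\<lambda>x y. (x, y) \<in> Id_on procs) (pdist \<Gamma> s) (pdist \<Gamma> s)" if "s \<in> procs" for s
    using set_dist[OF wf that] by (intro rel_pmf_reflI) auto
  ultimately show ?thesis by (auto simp: bisim_def)
qed

text \<open>The closure \<open>U\<^sup>+\<close> of the union is shown to be a bisimulation by
  induction along a chain: an answer of one member of the chain is carried to the next by
  \<open>match_transfer\<close>. By maximality, \<open>U\<^sup>+\<close> is then the union
  itself.\<close>

lemma bisim_bisimilarity: "bisim \<Gamma> weak (bisimilarity \<Gamma> weak)"
proof -
  define U where "U = bisimilarity \<Gamma> weak"
  have Id: "Id_on procs \<subseteq> U"
    using bisim_Id_on unfolding U_def bisimilarity_def by blast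
  have U_procs: "U \<subseteq> procs \<times> procs"
    using bisim_procs by (fastforce simp: U_def bisimilarity_def)
  have "sym U"
  proof (rule symI)
    fix x y assume "(x, y) \<in> U"
    then obtain B where "bisim \<Gamma> weak B" "(x, y) \<in> B" by (auto simp: U_def bisimilarity_def)
    moreover from this have "(y, x) \<in> B" by (auto simp: bisim_def elim: equivE dest: symD)
    ultimately show "(y, x) \<in> U" by (auto simp: U_def bisimilarity_def)
  qed
  then have sym: "sym (U\<^sup>+)" by (rule sym_trancl)
  have trans: "trans (U\<^sup>+)" by simp
  have equiv: "equiv procs (U\<^sup>+)"
  proof (rule equivI)
    show "U\<^sup>+ \<subseteq> procs \<times> procs" using U_procs by (rule trancl_subset_Sigma)
    show "refl_on procs (U\<^sup>+)" using Id by (auto simp: refl_on_def)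
  qed (use sym trans in auto)
  have "(\<forall>a s'. step \<Gamma> s (LAct a) s' \<longrightarrow> match \<Gamma> weak (U\<^sup>+) (U\<^sup>+ `` {s'}) t a) \<and>
      rel_pmf (\<lambda>x y. (x, y) \<in> U\<^sup>+) (pdist \<Gamma> s) (pdist \<Gamma> t)" if "(s, t) \<in> U\<^sup>+" for s t
    using that
  proof (induction rule: trancl_induct)
    case (base t)
    then obtain B where B: "bisim \<Gamma> weak B" "(s, t) \<in> B" by (auto simp: U_def bisimilarity_def)
    then have sub: "B \<subseteq> U\<^sup>+" by (auto simp: U_def bisimilarity_def)
    have "match \<Gamma> weak (U\<^sup>+) (U\<^sup>+ `` {s'}) t a" if "step \<Gamma> s (LAct a) s'" for a s'
    proof (rule match_mono)
      show "match \<Gamma> weak B (B `` {s'}) t a" using B that by (auto simp: bisim_def)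
    qed (use sub in auto)
    moreover have "rel_pmf (\<lambda>x y. (x, y) \<in> U\<^sup>+) (pdist \<Gamma> s) (pdist \<Gamma> t)"
      by (rule pmf.rel_mono_strong[of "\<lambda>x y. (x, y) \<in> B"]) (use B sub in \<open>auto simp: bisim_def\<close>)
    ultimately show ?case by blast
  next
    case (step t u)
    then obtain B where B: "bisim \<Gamma> weak B" "(t, u) \<in> B" by (auto simp: U_def bisimilarity_def)
    then have sub: "B \<subseteq> U\<^sup>+" by (auto simp: U_def bisimilarity_def)
    have "match \<Gamma> weak (U\<^sup>+) (U\<^sup>+ `` {s'}) u a" if "step \<Gamma> s (LAct a) s'" for a s'
      by (rule match_transfer[OF B sub sym trans]) (use step.IH that trans in \<open>auto dest: transD\<close>)
    moreover have "rel_pmf (\<lambda>x y. (x, y) \<in> U\<^sup>+) (pdist \<Gamma> s) (pdist \<Gamma> u)"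
    proof -
      have "rel_pmf (\<lambda>x y. (x, y) \<in> B) (pdist \<Gamma> t) (pdist \<Gamma> u)"
        using B by (auto simp: bisim_def)
      then have "rel_pmf ((\<lambda>x y. (x, y) \<in> U\<^sup>+) OO (\<lambda>x y. (x, y) \<in> B)) (pdist \<Gamma> s) (pdist \<Gamma> u)"
        using step.IH by (auto simp: pmf.rel_compp)
      then show ?thesis
        by (rule pmf.rel_mono_strong) (use sub in \<open>auto dest: trancl_trans\<close>)
    qed
    ultimately show ?case by blast
  qed
  with equiv have "bisim \<Gamma> weak (U\<^sup>+)" by (auto simp: bisim_def)
  then have "U\<^sup>+ \<subseteq> U" by (auto simp: U_def bisimilarity_def)
  then have "U\<^sup>+ = U" by auto
  with \<open>bisim \<Gamma> weak (U\<^sup>+)\<close> show ?thesis by (simp add: U_def)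
qed

lemma bisimilarity_procs: "(s, t) \<in> bisimilarity \<Gamma> weak \<Longrightarrow> s \<in> procs \<and> t \<in> procs"
  using bisim_procs[OF bisim_bisimilarity] .

lemma bisimilarity_refl: "s \<in> procs \<Longrightarrow> (s, s) \<in> bisimilarity \<Gamma> weak"
  using bisim_bisimilarity[of weak] by (auto simp: bisim_def refl_on_def elim: equivE)

lemma bisimilarity_sym: "(s, t) \<in> bisimilarity \<Gamma> weak \<Longrightarrow> (t, s) \<in> bisimilarity \<Gamma> weak"
  using bisim_bisimilarity[of weak] by (auto simp: bisim_def elim: equivE dest: symD)

lemma bisimilarity_trans: "(s, t) \<in> bisimilarity \<Gamma> weak \<Longrightarrow> (t, u) \<in> bisimilarity \<Gamma> weak
    \<Longrightarrow> (s, u) \<in> bisimilarity \<Gamma> weak"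
  using bisim_bisimilarity[of weak] unfolding bisim_def by (meson equivE transD)

lemma bisimilarity_step: "(s, t) \<in> bisimilarity \<Gamma> weak \<Longrightarrow> step \<Gamma> s (LAct a) s' \<Longrightarrow>
    match \<Gamma> weak (bisimilarity \<Gamma> weak) (bisimilarity \<Gamma> weak `` {s'}) t a"
  using bisim_bisimilarity[of weak] by (auto simp: bisim_def)

lemma bisimilarity_pdist: "(s, t) \<in> bisimilarity \<Gamma> weak \<Longrightarrow>
    rel_pmf (\<lambda>x y. (x, y) \<in> bisimilarity \<Gamma> weak) (pdist \<Gamma> s) (pdist \<Gamma> t)"
  using bisim_bisimilarity[of weak] by (auto simp: bisim_def)

lemma bisimilarity_match:
  assumes "(t, u) \<in> bisimilarity \<Gamma> weak" "match \<Gamma> weak (bisimilarity \<Gamma> weak) (bisimilarity \<Gamma> weak `` {v}) t a"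
  shows "match \<Gamma> weak (bisimilarity \<Gamma> weak) (bisimilarity \<Gamma> weak `` {v}) u a"
proof (rule match_transfer[OF bisim_bisimilarity assms(1) subset_refl _ _ _ assms(2)])
  show "sym (bisimilarity \<Gamma> weak)" "trans (bisimilarity \<Gamma> weak)"
    using bisim_bisimilarity[of weak] by (auto simp: bisim_def elim: equivE)
  show "bisimilarity \<Gamma> weak `` (bisimilarity \<Gamma> weak `` {v}) \<subseteq> bisimilarity \<Gamma> weak `` {v}"
    using bisimilarity_trans by blast
qed

end

section \<open>Congruence by lifting\<close>

lemma step_act_iff: "step \<Gamma> s (LAct a) t \<longleftrightarrow> (\<exists>N P. s = Nd N \<and> t = Pr P \<and> atrans \<Gamma> N a P)"
  by (subst step.simps) auto

lemma step_prob_label_iff: "step \<Gamma> s (LProb p) t \<longleftrightarrow> (\<exists>P d N. s = Pr P \<and> t = Nd N \<and> ptrans \<Gamma> P d p N)"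
  by (subst step.simps) auto

lemma res_eq_iff [simp]: "res s L = res t M \<longleftrightarrow> s = t \<and> L = M"
  by (cases s; cases t) auto

lemma hide_eq_iff [simp]: "hide s L = hide t M \<longleftrightarrow> s = t \<and> L = M"
  by (cases s; cases t) auto

lemma res_neq_hide [simp]: "res s L \<noteq> hide t M" "hide t M \<noteq> res s L"
  by (cases s; cases t; auto)+

lemma par_eq_iff: "same_kind s1 s2 \<Longrightarrow> same_kind t1 t2 \<Longrightarrow>
    par s1 L s2 = par t1 M t2 \<longleftrightarrow> s1 = t1 \<and> L = M \<and> s2 = t2"
  by (cases s1; cases s2; cases t1; cases t2) auto

lemma res_procs [simp]: "res s L \<in> procs \<longleftrightarrow> s \<in> procs"
  by (cases s) auto

lemma hide_procs [simp]: "hide s L \<in> procs \<longleftrightarrow> s \<in> procs"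
  by (cases s) auto

lemma par_procs: "same_kind s t \<Longrightarrow> par s L t \<in> procs \<longleftrightarrow> s \<in> procs \<and> t \<in> procs"
  by (cases s; cases t) auto

lemma same_kind_refl [simp]: "same_kind s s"
  and same_kind_res [simp]: "same_kind (res s L) t \<longleftrightarrow> same_kind s t" "same_kind s (res t L) \<longleftrightarrow> same_kind s t"
  and same_kind_hide [simp]: "same_kind (hide s L) t \<longleftrightarrow> same_kind s t" "same_kind s (hide t L) \<longleftrightarrow> same_kind s t"
  by (cases s; cases t; auto)+

lemma same_kind_par: "same_kind s t \<Longrightarrow> same_kind s (par s L t)"
  by (cases s; cases t) auto

lemma step_res_iff: "step \<Gamma> (res s L) (LAct a) t \<longleftrightarrow>
    (\<exists>s'. t = res s' L \<and> step \<Gamma> s (LAct a) s' \<and> a \<notin> Obs ` L)"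
proof -
  have "Pr (PRes P L) = res s' L \<longleftrightarrow> s' = Pr P" for P s' by (cases s') auto
  then show ?thesis by (cases s) (auto simp: step_act_iff atrans_NRes)
qed

lemma step_hide_iff: "step \<Gamma> (hide s L) (LAct a) t \<longleftrightarrow>
    (\<exists>b s'. t = hide s' L \<and> step \<Gamma> s (LAct b) s' \<and> a = (if b \<in> Obs ` L then Tau else b))"
  by (cases s) (auto simp: step_act_iff atrans_NHide split del: if_split, metis hide.simps(2))

lemma step_par_iff: "same_kind s1 s2 \<Longrightarrow> step \<Gamma> (par s1 L s2) (LAct a) t \<longleftrightarrow>
    (\<exists>N1 N2. s1 = Nd N1 \<and> s2 = Nd N2 \<and>
      ((\<exists>s'. step \<Gamma> s1 (LAct a) s' \<and> a \<notin> Obs ` L \<and> t = par s' L (Pr (PDirac N2))) \<or>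
       (\<exists>s'. step \<Gamma> s2 (LAct a) s' \<and> a \<notin> Obs ` L \<and> t = par (Pr (PDirac N1)) L s') \<or>
       (\<exists>s1' s2'. step \<Gamma> s1 (LAct a) s1' \<and> step \<Gamma> s2 (LAct a) s2' \<and> a \<in> Obs ` L \<and> t = par s1' L s2')))"
  by (cases s1; cases s2) (auto simp: step_act_iff atrans_NPar, metis par.simps(2))

text \<open>A relation \<open>S\<close> between base states and the states obtained from them by a context: if the
  moves of a context state are reflected by matching moves of its base state and the moves of the
  base state are simulated, then bisimilar base states give bisimilar context states.\<close>

locale lifting =
  fixes \<Gamma> :: "('a, 'c, 'd) env" and weak :: bool and S :: "('a, 'c, 'd) proc rel"
    and lam :: "'a act \<Rightarrow> 'a act" and ok :: "'a act \<Rightarrow> bool"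
  assumes wf: "wf_env \<Gamma>"
    and S_procs: "(x, y) \<in> S \<Longrightarrow> x \<in> procs \<and> y \<in> procs \<and> same_kind x y"
    and S_pdist: "(x, y) \<in> S \<Longrightarrow> rel_pmf (\<lambda>u v. (u, v) \<in> S) (pdist \<Gamma> x) (pdist \<Gamma> y)"
    and S_base: "(x, y) \<in> S \<Longrightarrow> (x', y) \<in> S \<Longrightarrow> (x, x') \<in> bisimilarity \<Gamma> weak"
    and reflected: "(x, y) \<in> S \<Longrightarrow> step \<Gamma> y (LAct a) y' \<Longrightarrow>
      \<exists>b x'. ok b \<and> lam b = a \<and> (x', y') \<in> S \<and> match \<Gamma> weak (bisimilarity \<Gamma> weak) (bisimilarity \<Gamma> weak `` {x'}) x b"
    and simulated: "(x, y) \<in> S \<Longrightarrow> step \<Gamma> x (LAct b) x' \<Longrightarrow> ok b \<Longrightarrow> \<exists>y'. step \<Gamma> y (LAct (lam b)) y' \<and> (x', y') \<in> S"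
    and ok_Tau: "ok Tau" and lam_Tau: "lam Tau = Tau"
begin

abbreviation base_eqv where "base_eqv \<equiv> bisimilarity \<Gamma> weak"

lemma simulated_silent_reach:
  assumes "silent_reach \<Gamma> x x'" "(x, y) \<in> S"
  shows "\<exists>y'. silent_reach \<Gamma> y y' \<and> (x', y') \<in> S"
  using assms(1)[unfolded silent_reach_def]
proof (induction rule: rtranclp_induct)
  case base
  then show ?case using assms(2) by (auto simp: silent_reach_def)
next
  case (step u u')
  then obtain v where v: "silent_reach \<Gamma> y v" "(u, v) \<in> S" by blast
  note uv = S_procs[OF v(2)]
  from silent_step_cases[OF wf step(2) uv[THEN conjunct1]]
  consider "step \<Gamma> u (LAct Tau) u'" | P where "u = Pr P" "u' \<in> set_pmf (pdist \<Gamma> u)" by blast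
  then show ?case
  proof cases
    case 1
    from simulated[OF v(2) 1 ok_Tau] obtain v' where "step \<Gamma> v (LAct Tau) v'" "(u', v') \<in> S"
      by (auto simp: lam_Tau)
    then show ?thesis using v(1) silent_reach_step silent_reach_trans by blast
  next
    case (2 P)
    from rel_pmf_imp_rel_set[OF S_pdist[OF v(2)]] 2 obtain v'
      where "v' \<in> set_pmf (pdist \<Gamma> v)" "(u', v') \<in> S"
      by (auto simp: rel_set_def)
    then show ?thesis
      using uv v(1) silent_reach_pdist[OF wf] silent_reach_trans by blast
  qed
qed

text \<open>Moves of the base are simulated step by step, so an answer of \<open>x\<close> becomes
  an answer of \<open>y\<close>. The assumption on \<open>B\<close> serves the branching case, where
  the intermediate context state must be related to \<open>y\<close>.\<close>

lemma simulated_match: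
  assumes xy: "(x, y) \<in> S" and m: "match \<Gamma> weak base_eqv C x b" and b: "ok b"
    and B: "\<And>x' y'. (x', y') \<in> S \<Longrightarrow> (x, x') \<in> base_eqv \<Longrightarrow> (y, y') \<in> B"
  shows "match \<Gamma> weak B (S `` C) y (lam b)"
proof (cases weak)
  case True
  have "almost_sure \<Gamma> (S `` C) y (lam b)"
  proof (rule almost_sure_transfer[OF wf, where S = S and a = b and C = C and lam = lam and ?n0.0 = b and ?s0.0 = x])
    show "almost_sure \<Gamma> (S `` {s'}) t (lam a)"
      if "(s, t) \<in> S" "step \<Gamma> s (LAct a) s'" "a \<in> {Tau, b}" for s t a s'
    proof -
      have "ok a" using that(3) b ok_Tau by auto
      from simulated[OF that(1,2) this] obtain t' where "step \<Gamma> t (LAct (lam a)) t'" "(s', t') \<in> S" by blast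
      then show ?thesis
        using S_procs[OF that(1)] by (auto simp: step_act_iff intro!: almost_sure_move[OF wf])
    qed
  qed (use S_procs S_pdist lam_Tau m True xy in \<open>auto simp: match_def\<close>)
  with True show ?thesis by (simp add: match_def)
next
  case False
  with m consider "b = Tau" "x \<in> C" | u x' where
      "silent_reach \<Gamma> x u" "step \<Gamma> u (LAct b) x'" "(x, u) \<in> base_eqv" "x' \<in> C"
    by (auto simp: match_def)
  then show ?thesis
  proof cases
    case 1
    then show ?thesis using xy False by (auto simp: match_def lam_Tau)
  next
    case 2
    from simulated_silent_reach[OF 2(1) xy] obtain v where v: "silent_reach \<Gamma> y v" "(u, v) \<in> S" by blast
    from simulated[OF v(2) 2(2) b] obtain y' where "step \<Gamma> v (LAct (lam b)) y'" "(x', y') \<in> S" by blast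
    with v B[OF v(2) 2(3)] 2(4) False show ?thesis by (auto simp: match_def)
  qed
qed

text \<open>A move of \<open>y1\<close> is reflected to an answer of its base \<open>x1\<close>,
  carried to \<open>x2\<close> by bisimilarity, and lifted again to \<open>y2\<close>. One context
  state may have several bases; \<open>S_base\<close> makes them bisimilar and thereby the candidate
  relation transitive.\<close>

lemma lifted_bisimilar:
  assumes "(x1, y1) \<in> S" "(x2, y2) \<in> S" "(x1, x2) \<in> base_eqv"
  shows "(y1, y2) \<in> base_eqv"
proof -
  define B where "B = {(y1, y2). \<exists>x1 x2. (x1, y1) \<in> S \<and> (x2, y2) \<in> S \<and> (x1, x2) \<in> base_eqv} \<union> Id_on procs"
  have B_I: "(y1, y2) \<in> B" if "(x1, y1) \<in> S" "(x2, y2) \<in> S" "(x1, x2) \<in> base_eqv" for x1 x2 y1 y2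
    using that unfolding B_def by blast
  have B_cases: "(y1, y2) \<in> B \<Longrightarrow> (\<exists>x1 x2. (x1, y1) \<in> S \<and> (x2, y2) \<in> S \<and> (x1, x2) \<in> base_eqv) \<or> y1 = y2 \<and> y1 \<in> procs"
    for y1 y2 unfolding B_def by auto
  have "equiv procs B"
  proof (rule equivI)
    show "B \<subseteq> procs \<times> procs" using S_procs by (auto simp: B_def)
    show "refl_on procs B" by (auto simp: B_def refl_on_def)
    show "sym B" by (auto simp: B_def intro!: symI dest: bisimilarity_sym[OF wf])
    show "trans B"
    proof (rule transI)
      fix y1 y2 y3 assume 12: "(y1, y2) \<in> B" and 23: "(y2, y3) \<in> B"
      show "(y1, y3) \<in> B"
      proof (cases "y1 = y2 \<or> y2 = y3")
        case True
        then show ?thesis using 12 23 by auto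
      next
        case False
        then obtain x1 x2 x2' x3 where "(x1, y1) \<in> S" "(x2, y2) \<in> S" "(x1, x2) \<in> base_eqv"
            "(x2', y2) \<in> S" "(x3, y3) \<in> S" "(x2', x3) \<in> base_eqv"
          using B_cases[OF 12] B_cases[OF 23] by blast
        moreover from this have "(x1, x3) \<in> base_eqv"
          by (meson S_base bisimilarity_trans[OF wf])
        ultimately show ?thesis by (blast intro: B_I)
      qed
    qed
  qed
  moreover have "match \<Gamma> weak B (B `` {y1'}) y2 a"
    if "(x1, y1) \<in> S" "(x2, y2) \<in> S" "(x1, x2) \<in> base_eqv" "step \<Gamma> y1 (LAct a) y1'" for x1 x2 y1 y2 a y1'
  proof -
    from reflected[OF that(1,4)] obtain b x1' where b: "ok b" "lam b = a" "(x1', y1') \<in> S"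
      "match \<Gamma> weak base_eqv (base_eqv `` {x1'}) x1 b" by blast
    have "match \<Gamma> weak base_eqv (base_eqv `` {x1'}) x2 b"
      using bisimilarity_match[OF wf that(3) b(4)] .
    from simulated_match[OF that(2) this b(1), of B] that(2)
    have "match \<Gamma> weak B (S `` (base_eqv `` {x1'})) y2 (lam b)" by (blast intro: B_I)
    then show ?thesis
      unfolding b(2) by (rule match_mono[OF wf]) (use b(3) in \<open>auto intro: B_I\<close>)
  qed
  moreover have "match \<Gamma> weak B (B `` {y'}) y a" if "y \<in> procs" "step \<Gamma> y (LAct a) y'" for y a y'
    using that step_procs[OF wf] by (intro match_step[OF wf, where t' = y']) (auto simp: B_def)
  moreover have "rel_pmf (\<lambda>u v. (u, v) \<in> B) (pdist \<Gamma> y1) (pdist \<Gamma> y2)"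
    if "(x1, y1) \<in> S" "(x2, y2) \<in> S" "(x1, x2) \<in> base_eqv" for x1 x2 y1 y2
  proof -
    have "rel_pmf (\<lambda>u v. (v, u) \<in> S) (pdist \<Gamma> y1) (pdist \<Gamma> x1)"
      using S_pdist[OF that(1)] pmf.rel_flip[of "\<lambda>u v. (u, v) \<in> S"] by (simp add: conversep_iff[abs_def])
    moreover have "rel_pmf (\<lambda>u v. (u, v) \<in> base_eqv) (pdist \<Gamma> x1) (pdist \<Gamma> x2)"
      using bisimilarity_pdist[OF wf that(3)] .
    moreover note S_pdist[OF that(2)]
    ultimately have "rel_pmf ((\<lambda>u v. (v, u) \<in> S) OO (\<lambda>u v. (u, v) \<in> base_eqv) OO (\<lambda>u v. (u, v) \<in> S)) (pdist \<Gamma> y1) (pdist \<Gamma> y2)"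
      unfolding pmf.rel_compp by blast
    then show ?thesis by (rule pmf.rel_mono_strong) (auto intro: B_I)
  qed
  moreover have "rel_pmf (\<lambda>u v. (u, v) \<in> B) (pdist \<Gamma> y) (pdist \<Gamma> y)" if "y \<in> procs" for y
    using set_dist[OF wf that] by (intro rel_pmf_reflI) (auto simp: B_def)
  ultimately have "bisim \<Gamma> weak B"
    unfolding bisim_def by (blast dest: B_cases)
  then show ?thesis using B_I[OF assms] by (rule bisimilarityI)
qed

lemma lifted_match:
  assumes "(x, y) \<in> S" "(x', y') \<in> S" "ok b" "match \<Gamma> weak base_eqv (base_eqv `` {x'}) x b"
  shows "match \<Gamma> weak base_eqv (base_eqv `` {y'}) y (lam b)"
proof (rule match_mono[OF wf])
  show "match \<Gamma> weak base_eqv (S `` (base_eqv `` {x'})) y (lam b)"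
    using assms lifted_bisimilar by (intro simulated_match) auto
  show "S `` (base_eqv `` {x'}) \<subseteq> base_eqv `` {y'}"
    using assms(2) lifted_bisimilar by blast
qed simp

end

context
  fixes \<Gamma> :: "('a, 'c, 'd) env"
  assumes wf: "wf_env \<Gamma>"
begin

text \<open>A probabilistic state has no action moves and answers those of its only possible target
  by drawing that target first. Two different related states therefore never both have action
  moves.\<close>

lemma bisimilar_if_pdist_return:
  assumes "s \<in> procs" "pdist \<Gamma> s = return_pmf (Nd N)"
  shows "(s, Nd N) \<in> bisimilarity \<Gamma> weak"
proof -
  define B where "B = {(s, t). s \<in> procs \<and> t \<in> procs \<and>
     (s = t \<or> pdist \<Gamma> s = pdist \<Gamma> t \<and> (\<exists>N. return_pmf (Nd N) = pdist \<Gamma> s))}"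
  have "equiv procs B"
    by (rule equivI) (auto simp: B_def refl_on_def intro!: symI transI)
  moreover have "match \<Gamma> weak B (B `` {s'}) t a" if B: "(s, t) \<in> B" and st: "step \<Gamma> s (LAct a) s'" for s t a s'
  proof (cases t)
    case (Nd M)
    with B st have "s = t" by (auto simp: B_def step_act_iff)
    with B st show ?thesis
      using step_procs[OF wf] by (intro match_step[OF wf, where t' = s']) (auto simp: B_def)
  next
    case (Pr P)
    from st obtain N Q where N: "s = Nd N" "s' = Pr Q" "atrans \<Gamma> N a Q" by (auto simp: step_act_iff)
    have t: "pdist \<Gamma> t = return_pmf s" "s \<in> procs" "t \<in> procs" "s' \<in> procs"
      using B N Pr st step_procs[OF wf st] by (auto simp: B_def)
    show ?thesis
    proof (cases weak)
      case True
      have "almost_sure \<Gamma> (B `` {s'}) (Nd N) a"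
        using N t by (intro almost_sure_move[OF wf]) (auto simp: B_def)
      with t N Pr have "almost_sure \<Gamma> (B `` {s'}) (Pr P) a"
        by (intro almost_sure_prob[OF wf]) auto
      with True Pr show ?thesis by (simp add: match_def)
    next
      case False
      have "silent_reach \<Gamma> t s" using t by (intro silent_reach_pdist[OF wf]) auto
      moreover have "(t, s) \<in> B" using B by (auto simp: B_def)
      moreover have "(s', s') \<in> B" using t by (auto simp: B_def)
      ultimately show ?thesis using False st by (auto simp: match_def)
    qed
  qed
  moreover have "rel_pmf (\<lambda>x y. (x, y) \<in> B) (pdist \<Gamma> s) (pdist \<Gamma> t)" if "(s, t) \<in> B" for s t
  proof -
    have "pdist \<Gamma> t = pdist \<Gamma> s" "s \<in> procs" using that by (auto simp: B_def)
    then show ?thesis using set_dist[OF wf] by (auto simp: B_def intro!: rel_pmf_reflI)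
  qed
  ultimately have "bisim \<Gamma> weak B" by (auto simp: bisim_def)
  moreover have "(s, Nd N) \<in> B"
    using assms set_dist[OF wf assms(1), of "Nd N"] by (auto simp: B_def)
  ultimately show ?thesis by (rule bisimilarityI)
qed

text \<open>Applied whenever a component stays idle in a parallel composition and turns from
  \<open>Nd N\<close> into \<open>Pr (PDirac N)\<close>.\<close>

lemma res_PDirac_bisimilar:
  "wf_nterm N \<Longrightarrow> (res (Pr (PDirac N)) L, res (Nd N) L) \<in> bisimilarity \<Gamma> weak"
  using bisimilar_if_pdist_return[of "res (Pr (PDirac N)) L" "NRes N L"]
  by (simp add: pdist_PDirac[OF wf] pdist_PRes[OF wf])

end

section \<open>Unwinding of the security properties\<close>

inductive_cases occurs_nE:
  "occurs_n \<Gamma> a NZero" "occurs_n \<Gamma> a (NPrefix b P)" "occurs_n \<Gamma> a (NPlus N1 N2)"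
  "occurs_n \<Gamma> a (NPar N1 L N2)" "occurs_n \<Gamma> a (NRes N L)" "occurs_n \<Gamma> a (NHide N L)" "occurs_n \<Gamma> a (NConst K)"
inductive_cases occurs_pE:
  "occurs_p \<Gamma> a (PChoice xs)" "occurs_p \<Gamma> a (PPar P1 L P2)" "occurs_p \<Gamma> a (PRes P L)"
  "occurs_p \<Gamma> a (PHide P L)" "occurs_p \<Gamma> a (PConst K')"

lemma occurs_PDirac: "occurs_p \<Gamma> a (PDirac N) \<longleftrightarrow> occurs_n \<Gamma> a N"
  by (auto elim: occurs_pE intro: occurs_n_occurs_p.intros)

text \<open>A silent move may stem from hiding instead of a prefix, hence the exception.\<close>

lemma atrans_occurs: "atrans \<Gamma> N a P \<Longrightarrow> a = Tau \<or> occurs_n \<Gamma> a N"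
  by (induction rule: atrans.induct) (auto intro: occurs_n_occurs_p.intros)

lemma atrans_occurs_target: "atrans \<Gamma> N a P \<Longrightarrow> occurs_p \<Gamma> b P \<Longrightarrow> occurs_n \<Gamma> b N"
proof (induction rule: atrans.induct)
  case (4 N1 a P1 L N2)
  then show ?case by (auto elim!: occurs_pE(2) simp: occurs_PDirac intro: occurs_n_occurs_p.intros)
next
  case (5 N1 a P1 L N2)
  then show ?case by (auto elim!: occurs_pE(2) simp: occurs_PDirac intro: occurs_n_occurs_p.intros)
next
  case (6 N1 a P1 N2 P2 L)
  then show ?case by (auto elim!: occurs_pE(2) intro: occurs_n_occurs_p.intros)
next
  case (7 N a P L)
  then show ?case by (auto elim!: occurs_pE(3) intro: occurs_n_occurs_p.intros)
next
  case (8 N a P L)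
  then show ?case by (auto elim!: occurs_pE(4) intro: occurs_n_occurs_p.intros)
next
  case (9 N a P L)
  then show ?case by (auto elim!: occurs_pE(4) intro: occurs_n_occurs_p.intros)
qed (auto intro: occurs_n_occurs_p.intros)

lemma ptrans_occurs_target: "ptrans \<Gamma> P d p N \<Longrightarrow> occurs_n \<Gamma> b N \<Longrightarrow> occurs_p \<Gamma> b P"
proof (induction rule: ptrans.induct)
  case (1 j xs p N)
  then have "(p, N) \<in> set xs" by (metis nth_mem)
  with 1 show ?case by (auto intro: occurs_n_occurs_p.intros)
next
  case (2 P1 d1 p1 N1 P2 d2 p2 N2 L)
  then show ?case by (auto elim!: occurs_nE(4) intro: occurs_n_occurs_p.intros)
next
  case (3 P d p N L)
  then show ?case by (auto elim!: occurs_nE(5) intro: occurs_n_occurs_p.intros)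
next
  case (4 P d p N L)
  then show ?case by (auto elim!: occurs_nE(6) intro: occurs_n_occurs_p.intros)
next
  case (5 K d p N)
  then show ?case by (auto intro: occurs_n_occurs_p.intros)
qed

lemma step_occurs: "step \<Gamma> s l t \<Longrightarrow> occurs \<Gamma> b t \<Longrightarrow> occurs \<Gamma> b s"
  by (auto elim!: step.cases dest: atrans_occurs_target ptrans_occurs_target)

text \<open>Without the added states \<open>PDirac N\<close>, reachability is plain closure under
  \<open>step\<close> and has its induction principle.\<close>

definition reach0 :: "('a, 'c, 'd) env \<Rightarrow> ('a, 'c, 'd) proc \<Rightarrow> ('a, 'c, 'd) proc set" where
  "reach0 \<Gamma> E = last_state ` comps \<Gamma> E"

lemma reach_eq: "reach \<Gamma> E = reach0 \<Gamma> E \<union> {Pr (PDirac N) | N. Nd N \<in> reach0 \<Gamma> E}"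
  by (simp add: reach_def reach0_def)

lemma reach0_self: "E \<in> reach0 \<Gamma> E"
  unfolding reach0_def by (rule image_eqI[OF _ comps.intros(1)]) simp

lemma reach0_step: "s \<in> reach0 \<Gamma> E \<Longrightarrow> step \<Gamma> s l t \<Longrightarrow> t \<in> reach0 \<Gamma> E"
  unfolding reach0_def by (auto intro!: image_eqI[OF _ comps.intros(2)])

lemma reach0_subset:
  assumes "E \<in> X" "\<And>s l t. s \<in> X \<Longrightarrow> step \<Gamma> s l t \<Longrightarrow> t \<in> X"
  shows "reach0 \<Gamma> E \<subseteq> X"
proof -
  have "last_state \<theta> \<in> X" if "\<theta> \<in> comps \<Gamma> E" for \<theta>
    using that by induction (use assms in auto)
  then show ?thesis by (auto simp: reach0_def)
qed

lemma reach_self: "E \<in> reach \<Gamma> E"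
  by (simp add: reach_eq reach0_self)

lemma Nd_reach_iff: "Nd N \<in> reach \<Gamma> E \<longleftrightarrow> Nd N \<in> reach0 \<Gamma> E"
  by (auto simp: reach_eq)

lemma reach_PDirac: "Nd N \<in> reach \<Gamma> E \<Longrightarrow> Pr (PDirac N) \<in> reach \<Gamma> E"
  by (auto simp: reach_eq)

lemma reach_step:
  assumes "s \<in> reach \<Gamma> E" "step \<Gamma> s l t"
  shows "t \<in> reach \<Gamma> E"
  using assms(1) unfolding reach_eq
proof
  assume "s \<in> {Pr (PDirac N) | N. Nd N \<in> reach0 \<Gamma> E}"
  then obtain N where N: "s = Pr (PDirac N)" "Nd N \<in> reach0 \<Gamma> E" by blast
  with assms(2) have "t = Nd N"
    by (auto elim!: step.cases ptransE(1))
  with N show "t \<in> reach0 \<Gamma> E \<union> {Pr (PDirac N) | N. Nd N \<in> reach0 \<Gamma> E}" by simp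
qed (use assms(2) reach0_step in blast)

lemma rel_pmf_map_same:
  "(\<And>u. u \<in> set_pmf p \<Longrightarrow> R (f u) (g u)) \<Longrightarrow> rel_pmf R (map_pmf f p) (map_pmf g p)"
  by (simp add: pmf.rel_map rel_pmf_reflI)

definition high_matched ::
  "('a, 'c, 'd) env \<Rightarrow> bool \<Rightarrow> 'a set \<Rightarrow> ('a, 'c, 'd) proc \<Rightarrow> ('a, 'c, 'd) proc \<Rightarrow> bool" where
  "high_matched \<Gamma> weak AH s t \<longleftrightarrow>
     match \<Gamma> weak (bisimilarity \<Gamma> weak) (bisimilarity \<Gamma> weak `` {res t AH}) (res s AH) Tau"

definition high_bisimilar ::
  "('a, 'c, 'd) env \<Rightarrow> bool \<Rightarrow> 'a set \<Rightarrow> ('a, 'c, 'd) proc \<Rightarrow> ('a, 'c, 'd) proc \<Rightarrow> bool" where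
  "high_bisimilar \<Gamma> weak AH s t \<longleftrightarrow> (res s AH, res t AH) \<in> bisimilarity \<Gamma> weak"

definition unwinding ::
  "('a, 'c, 'd) env \<Rightarrow> 'a set \<Rightarrow> (('a, 'c, 'd) proc \<Rightarrow> ('a, 'c, 'd) proc \<Rightarrow> bool) \<Rightarrow> ('a, 'c, 'd) proc \<Rightarrow> bool" where
  "unwinding \<Gamma> AH Q E \<longleftrightarrow>
     (\<forall>s h t. s \<in> reach \<Gamma> E \<longrightarrow> h \<in> AH \<longrightarrow> step \<Gamma> s (LAct (Obs h)) t \<longrightarrow> Q s t)"

text \<open>The states added to \<open>reach\<close> by convention are probabilistic and have no
  action moves, so only \<open>reach0\<close> has to be examined.\<close>

lemma unwindingI:
  assumes "reach0 \<Gamma> E \<subseteq> X" "\<And>s h t. s \<in> X \<Longrightarrow> h \<in> AH \<Longrightarrow> step \<Gamma> s (LAct (Obs h)) t \<Longrightarrow> Q s t"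
  shows "unwinding \<Gamma> AH Q E"
proof -
  have "s \<in> reach0 \<Gamma> E" if "s \<in> reach \<Gamma> E" "step \<Gamma> s (LAct (Obs h)) t" for s h t
    using that by (auto simp: step_act_iff Nd_reach_iff)
  then show ?thesis using assms unfolding unwinding_def by blast
qed

context
  fixes \<Gamma> :: "('a, 'c, 'd) env" and AH :: "'a set" and weak :: bool
  assumes wf: "wf_env \<Gamma>"
begin

abbreviation eqv where "eqv \<equiv> bisimilarity \<Gamma> weak"

lemma reach_procs: "E \<in> procs \<Longrightarrow> reach \<Gamma> E \<subseteq> procs"
proof -
  assume "E \<in> procs"
  then have "reach0 \<Gamma> E \<subseteq> procs" by (rule reach0_subset) (rule step_procs[OF wf])
  then show ?thesis by (auto simp: reach_eq dest: subsetD)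
qed

lemma reach_pdist: "s \<in> reach \<Gamma> E \<Longrightarrow> E \<in> procs \<Longrightarrow> u \<in> set_pmf (pdist \<Gamma> s) \<Longrightarrow> u \<in> reach \<Gamma> E"
proof (cases s)
  case (Pr P)
  assume s: "s \<in> reach \<Gamma> E" "E \<in> procs" "u \<in> set_pmf (pdist \<Gamma> s)"
  then have "Pr P \<in> procs" using reach_procs[of E] Pr by auto
  then obtain p where "step \<Gamma> s (LProb p) u" using step_prob_iff[OF wf, of P u] s(3) Pr by auto
  with s show ?thesis by (auto intro: reach_step)
qed simp

lemma PDirac_eqv: "Nd N \<in> procs \<Longrightarrow> (res (Pr (PDirac N)) L, res (Nd N) L) \<in> eqv"
  by (rule res_PDirac_bisimilar[OF wf]) simp

lemma hide_reflected:
  assumes E: "E \<in> procs" and U: "unwinding \<Gamma> AH (high_matched \<Gamma> weak AH) E" and X: "X \<in> reach \<Gamma> E"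
    and y: "step \<Gamma> (hide X AH) (LAct a) y'"
  shows "\<exists>X'\<in>reach \<Gamma> E. y' = hide X' AH \<and> match \<Gamma> weak eqv (eqv `` {res X' AH}) (res X AH) a"
proof -
  from y obtain b X' where b: "y' = hide X' AH" "step \<Gamma> X (LAct b) X'" "a = (if b \<in> Obs ` AH then Tau else b)"
    by (auto simp: step_hide_iff)
  have X': "X' \<in> reach \<Gamma> E" using X b(2) by (rule reach_step)
  have procs: "X \<in> procs" "X' \<in> procs" using X X' reach_procs[OF E] by auto
  have "match \<Gamma> weak eqv (eqv `` {res X' AH}) (res X AH) a"
  proof (cases "b \<in> Obs ` AH")
    case True
    with U X b show ?thesis by (auto simp: unwinding_def high_matched_def)
  next
    case False
    with procs b show ?thesis
      by (intro match_step[OF wf, where t' = "res X' AH"])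
        (auto simp: step_res_iff bisimilarity_refl[OF wf])
  qed
  with b X' show ?thesis by blast
qed

lemma pdist_res_rel:
  assumes "E \<in> procs" "X \<in> reach \<Gamma> E" "pdist \<Gamma> y = map_pmf f (pdist \<Gamma> X)"
    "\<And>u. u \<in> reach \<Gamma> E \<Longrightarrow> (res u AH, f u) \<in> S"
  shows "rel_pmf (\<lambda>u v. (u, v) \<in> S) (pdist \<Gamma> (res X AH)) (pdist \<Gamma> y)"
proof -
  have "X \<in> procs" using assms reach_procs by auto
  then show ?thesis
    using assms by (auto simp: pdist_res[OF wf] intro!: rel_pmf_map_same reach_pdist)
qed

lemma hide_bisimilar:
  assumes E: "E \<in> procs" and U: "unwinding \<Gamma> AH (high_matched \<Gamma> weak AH) E" and X: "X \<in> reach \<Gamma> E"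
  shows "(res X AH, hide X AH) \<in> eqv"
proof -
  \<comment> \<open>The trivial context is included so that \<open>lifted_bisimilar\<close> compares
    \<open>res X AH\<close> itself with \<open>hide X AH\<close>.\<close>
  define S where "S = {(res X AH, y) | X y. X \<in> reach \<Gamma> E \<and> y \<in> {res X AH, hide X AH}}"
  note procs = subsetD[OF reach_procs[OF E]]
  have SI: "(res X AH, res X AH) \<in> S" "(res X AH, hide X AH) \<in> S" if "X \<in> reach \<Gamma> E" for X
    using that by (auto simp: S_def)
  interpret lifting \<Gamma> weak S id "\<lambda>_. True"
  proof
    show "x \<in> procs \<and> y \<in> procs \<and> same_kind x y" if "(x, y) \<in> S" for x y
      using that procs by (auto simp: S_def)
    show "(x, x') \<in> eqv" if "(x, y) \<in> S" "(x', y) \<in> S" for x x' y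
      using that procs by (auto simp: S_def bisimilarity_refl[OF wf])
    show "rel_pmf (\<lambda>u v. (u, v) \<in> S) (pdist \<Gamma> x) (pdist \<Gamma> y)" if "(x, y) \<in> S" for x y
    proof -
      from that obtain X where X: "X \<in> reach \<Gamma> E" "x = res X AH" "y = res X AH \<or> y = hide X AH"
        by (auto simp: S_def)
      have "rel_pmf (\<lambda>u v. (u, v) \<in> S) (pdist \<Gamma> (res X AH)) (pdist \<Gamma> (res X AH))"
        by (rule pdist_res_rel[OF E X(1), where f = "\<lambda>u. res u AH"])
          (simp_all add: pdist_res[OF wf] procs[OF X(1)] SI)
      moreover have "rel_pmf (\<lambda>u v. (u, v) \<in> S) (pdist \<Gamma> (res X AH)) (pdist \<Gamma> (hide X AH))"
        by (rule pdist_res_rel[OF E X(1), where f = "\<lambda>u. hide u AH"])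
          (simp_all add: pdist_hide[OF wf] procs[OF X(1)] SI)
      ultimately show ?thesis using X(2,3) by auto
    qed
    show "\<exists>b x'. True \<and> id b = a \<and> (x', y') \<in> S \<and> match \<Gamma> weak eqv (eqv `` {x'}) x b"
      if xy: "(x, y) \<in> S" and st: "step \<Gamma> y (LAct a) y'" for x y a y'
    proof -
      from xy obtain X where X: "X \<in> reach \<Gamma> E" "x = res X AH" "y = res X AH \<or> y = hide X AH"
        by (auto simp: S_def)
      from X(3) show ?thesis
      proof
        assume "y = res X AH"
        then obtain X' where X': "y' = res X' AH" "step \<Gamma> X (LAct a) X'" "a \<notin> Obs ` AH"
          using st by (auto simp: step_res_iff)
        then have "X' \<in> reach \<Gamma> E" using X reach_step by blast
        with X X' st \<open>y = _\<close> have "(res X' AH, y') \<in> S" "match \<Gamma> weak eqv (eqv `` {res X' AH}) x a"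
          using procs SI by (auto simp: bisimilarity_refl[OF wf] intro!: match_step[OF wf, where t' = "res X' AH"])
        then show ?thesis by auto
      next
        assume "y = hide X AH"
        then show ?thesis
          using hide_reflected[OF E U X(1), of a y'] st SI(2) X(2) by auto
      qed
    qed
    show "\<exists>y'. step \<Gamma> y (LAct (id b)) y' \<and> (x', y') \<in> S"
      if "(x, y) \<in> S" "step \<Gamma> x (LAct b) x'" True for x y b x'
    proof -
      from that obtain X where X: "X \<in> reach \<Gamma> E" "x = res X AH" "y = res X AH \<or> y = hide X AH"
        by (auto simp: S_def)
      with that obtain X' where X': "x' = res X' AH" "step \<Gamma> X (LAct b) X'" "b \<notin> Obs ` AH"
        by (auto simp: step_res_iff)
      then have "X' \<in> reach \<Gamma> E" using X reach_step by blast
      note S' = SI[OF this]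
      have "step \<Gamma> (res X AH) (LAct b) (res X' AH)" "step \<Gamma> (hide X AH) (LAct b) (hide X' AH)"
        using X' by (auto simp: step_res_iff step_hide_iff)
      with S' X X'(1) show ?thesis by (metis id_apply)
    qed
  qed (use wf in auto)
  show ?thesis
    using lifted_bisimilar[OF SI(1)[OF X] SI(2)[OF X]] procs[OF X] bisimilarity_refl[OF wf] by auto
qed

text \<open>A high move of \<open>s\<close> is a silent move of \<open>hide s AH\<close>, which
  \<open>res s AH\<close> has to match. The property at the target \<open>t\<close> replaces the
  class of \<open>hide t AH\<close> by that of \<open>res t AH\<close>.\<close>

lemma SBSNNI_iff: "E \<in> SBSNNI \<Gamma> AH eqv \<longleftrightarrow> E \<in> procs \<and> unwinding \<Gamma> AH (high_matched \<Gamma> weak AH) E"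
proof
  assume "E \<in> SBSNNI \<Gamma> AH eqv"
  then have E: "E \<in> procs" and ni: "\<And>X. X \<in> reach \<Gamma> E \<Longrightarrow> (res X AH, hide X AH) \<in> eqv"
    by (auto simp: SBSNNI_def BSNNI_def)
  have "high_matched \<Gamma> weak AH s t" if s: "s \<in> reach \<Gamma> E" and h: "h \<in> AH" "step \<Gamma> s (LAct (Obs h)) t" for s h t
  proof -
    have "step \<Gamma> (hide s AH) (LAct Tau) (hide t AH)"
      using h by (fastforce simp: step_hide_iff)
    from bisimilarity_step[OF wf bisimilarity_sym[OF wf ni[OF s]] this]
    have "match \<Gamma> weak eqv (eqv `` {hide t AH}) (res s AH) Tau" .
    moreover have "(res t AH, hide t AH) \<in> eqv" using reach_step[OF s h(2)] by (rule ni)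
    ultimately show ?thesis unfolding high_matched_def
      by (elim match_mono[OF wf]) (auto intro: bisimilarity_trans[OF wf])
  qed
  with E show "E \<in> procs \<and> unwinding \<Gamma> AH (high_matched \<Gamma> weak AH) E" by (auto simp: unwinding_def)
qed (auto simp: SBSNNI_def BSNNI_def hide_bisimilar dest: subsetD[OF reach_procs])

lemma SBNDC_iff: "E \<in> SBNDC \<Gamma> AH eqv \<longleftrightarrow> E \<in> procs \<and> unwinding \<Gamma> AH (high_bisimilar \<Gamma> weak AH) E"
  unfolding SBNDC_def unwinding_def high_bisimilar_def using reach_step[of _ \<Gamma> E] by blast

definition high_proc :: "('a, 'c, 'd) proc \<Rightarrow> bool" where
  "high_proc F \<longleftrightarrow> F \<in> procs \<and> (\<forall>a. occurs \<Gamma> a F \<longrightarrow> a \<in> Obs ` AH)"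

lemma high_proc_step: "high_proc F \<Longrightarrow> step \<Gamma> F l G \<Longrightarrow> high_proc G"
  unfolding high_proc_def using step_procs[OF wf] step_occurs by blast

lemma high_proc_PDirac: "high_proc (Nd N) \<Longrightarrow> high_proc (Pr (PDirac N))"
  by (simp add: high_proc_def occurs_PDirac)

lemma high_proc_label: "high_proc F \<Longrightarrow> step \<Gamma> F (LAct a) G \<Longrightarrow> a = Tau \<or> a \<in> Obs ` AH"
  by (auto simp: high_proc_def step_act_iff dest: atrans_occurs)

lemma high_proc_pdist: "high_proc F \<Longrightarrow> u \<in> set_pmf (pdist \<Gamma> F) \<Longrightarrow> high_proc u"
proof (cases F)
  case (Pr P)
  assume F: "high_proc F" "u \<in> set_pmf (pdist \<Gamma> F)"
  then obtain p where "step \<Gamma> F (LProb p) u"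
    using step_prob_iff[OF wf, of P u] Pr by (auto simp: high_proc_def)
  with F show ?thesis by (auto intro: high_proc_step)
qed simp

lemma set_pdist_same_kind:
  "s \<in> procs \<Longrightarrow> t \<in> procs \<Longrightarrow> u \<in> set_pmf (pdist \<Gamma> s) \<Longrightarrow> v \<in> set_pmf (pdist \<Gamma> t) \<Longrightarrow> same_kind u v"
  using set_dist[OF wf, of s u] set_dist[OF wf, of t v] by auto

lemma par_bisimilar:
  assumes E: "E \<in> procs" and U: "unwinding \<Gamma> AH (high_matched \<Gamma> weak AH) E" and L: "L \<subseteq> AH"
    and X: "X \<in> reach \<Gamma> E" and F: "high_proc F" "same_kind X F"
  shows "(res X AH, res (hide (par X L F) L) AH) \<in> eqv"
proof -
  let ?c = "\<lambda>X F. res (hide (par X L F) L) AH"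
  \<comment> \<open>The reference context is \<open>hide X AH\<close> and not
    \<open>res X AH\<close>: a context \<open>?c X F\<close> may itself be of the form
    \<open>res X' AH\<close> with \<open>X'\<close> reachable, and \<open>S_base\<close> would then
    presuppose the claim. A \<open>hide\<close> is never equal to a \<open>res\<close>.\<close>
  define S where "S = {(res X AH, hide X AH) | X. X \<in> reach \<Gamma> E} \<union>
     {(res X AH, ?c X F) | X F. X \<in> reach \<Gamma> E \<and> high_proc F \<and> same_kind X F}"
  note procs = subsetD[OF reach_procs[OF E]]
  have SI: "(res X AH, hide X AH) \<in> S" if "X \<in> reach \<Gamma> E" for X
    using that by (auto simp: S_def)
  have SI2: "(res X AH, ?c X F) \<in> S" if "X \<in> reach \<Gamma> E" "high_proc F" "same_kind X F" for X F
    using that unfolding S_def by blast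
  have S_cases: "(\<exists>X\<in>reach \<Gamma> E. x = res X AH \<and> y = hide X AH) \<or>
      (\<exists>X\<in>reach \<Gamma> E. \<exists>F. high_proc F \<and> same_kind X F \<and> x = res X AH \<and> y = ?c X F)" if "(x, y) \<in> S" for x y
    using that unfolding S_def by blast
  interpret lifting \<Gamma> weak S id "\<lambda>_. True"
  proof
    show "x \<in> procs \<and> y \<in> procs \<and> same_kind x y" if "(x, y) \<in> S" for x y
      using S_cases[OF that] procs by (auto simp: par_procs high_proc_def same_kind_par)
    show "(x, x') \<in> eqv" if "(x, y) \<in> S" "(x', y) \<in> S" for x x' y
      using S_cases[OF that(1)] S_cases[OF that(2)] procs
      by (auto simp: par_eq_iff bisimilarity_refl[OF wf])
    show "rel_pmf (\<lambda>u v. (u, v) \<in> S) (pdist \<Gamma> x) (pdist \<Gamma> y)" if "(x, y) \<in> S" for x y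
      using S_cases[OF that]
    proof (elim disjE bexE exE conjE)
      fix X assume X: "X \<in> reach \<Gamma> E" "x = res X AH" "y = hide X AH"
      show ?thesis unfolding X(2)
        by (rule pdist_res_rel[OF E X(1), where f = "\<lambda>u. hide u AH"])
          (simp_all add: X(3) pdist_hide[OF wf] procs[OF X(1)] SI)
    next
      fix X F assume X: "X \<in> reach \<Gamma> E" and F: "high_proc F" "same_kind X F" and xy: "x = res X AH" "y = ?c X F"
      have p: "X \<in> procs" "F \<in> procs" "par X L F \<in> procs"
        using X procs F by (auto simp: high_proc_def par_procs)
      have "pdist \<Gamma> x = map_pmf (\<lambda>u. res u AH) (map_pmf fst (pair_pmf (pdist \<Gamma> X) (pdist \<Gamma> F)))"
        using p by (simp add: xy pdist_res[OF wf] map_fst_pair_pmf)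
      moreover have "pdist \<Gamma> y = map_pmf (\<lambda>(u, v). ?c u v) (pair_pmf (pdist \<Gamma> X) (pdist \<Gamma> F))"
        using p F by (simp add: xy pdist_res[OF wf] pdist_hide[OF wf] pdist_par[OF wf] pmf.map_comp o_def case_prod_unfold)
      moreover have "(res u AH, ?c u v) \<in> S" if "u \<in> set_pmf (pdist \<Gamma> X)" "v \<in> set_pmf (pdist \<Gamma> F)" for u v
        using that reach_pdist[OF X E] high_proc_pdist[OF F(1)] set_pdist_same_kind[OF p(1,2)] by (intro SI2) auto
      ultimately show ?thesis
        by (auto simp: pmf.map_comp intro!: rel_pmf_map_same)
    qed
    show "\<exists>b x'. True \<and> id b = a \<and> (x', y') \<in> S \<and> match \<Gamma> weak eqv (eqv `` {x'}) x b"
      if xy: "(x, y) \<in> S" and st: "step \<Gamma> y (LAct a) y'" for x y a y'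
      using S_cases[OF xy]
    proof (elim disjE bexE exE conjE)
      fix X assume X: "X \<in> reach \<Gamma> E" "x = res X AH" "y = hide X AH"
      then show ?thesis
        using hide_reflected[OF E U X(1), of a y'] st SI by auto
    next
      fix X F assume X: "X \<in> reach \<Gamma> E" and F: "high_proc F" "same_kind X F" and xy: "x = res X AH" "y = ?c X F"
      from st xy obtain b z where b: "step \<Gamma> (par X L F) (LAct b) z" "y' = res (hide z L) AH"
          "a = (if b \<in> Obs ` L then Tau else b)" "a \<notin> Obs ` AH"
        by (auto simp: step_res_iff step_hide_iff)
      from b(1)[unfolded step_par_iff[OF F(2)]] obtain N G where NG: "X = Nd N" "F = Nd G"
        and cases: "(\<exists>X'. step \<Gamma> X (LAct b) X' \<and> b \<notin> Obs ` L \<and> z = par X' L (Pr (PDirac G))) \<or>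
          (\<exists>F'. step \<Gamma> F (LAct b) F' \<and> b \<notin> Obs ` L \<and> z = par (Pr (PDirac N)) L F') \<or>
          (\<exists>X' F'. step \<Gamma> X (LAct b) X' \<and> step \<Gamma> F (LAct b) F' \<and> b \<in> Obs ` L \<and> z = par X' L F')"
        by blast
      from cases show ?thesis
      proof (elim disjE exE conjE)
        fix X' assume X': "step \<Gamma> X (LAct b) X'" "b \<notin> Obs ` L" "z = par X' L (Pr (PDirac G))"
        have "X' \<in> reach \<Gamma> E" using X X'(1) by (rule reach_step)
        moreover have "same_kind X' (Pr (PDirac G))" using X'(1) by (auto simp: step_act_iff)
        ultimately have "(res X' AH, y') \<in> S"
          using F NG by (auto simp: b(2) X'(3) intro!: SI2 high_proc_PDirac)
        moreover have "match \<Gamma> weak eqv (eqv `` {res X' AH}) x a"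
          using X' b xy procs[OF X] procs[OF \<open>X' \<in> reach \<Gamma> E\<close>]
          by (intro match_step[OF wf, where t' = "res X' AH"]) (auto simp: step_res_iff bisimilarity_refl[OF wf])
        ultimately show ?thesis by auto
      next
        \<comment> \<open>A visible move of \<open>F\<close> alone is high and blocked by the outer
          restriction, so the move is silent. \<open>X\<close> answers by staying, although its copy
          in the composition has become \<open>PDirac N\<close>.\<close>
        fix F' assume F': "step \<Gamma> F (LAct b) F'" "b \<notin> Obs ` L" "z = par (Pr (PDirac N)) L F'"
        have a: "a = Tau" using high_proc_label[OF F(1) F'(1)] b F'(2) by auto
        have N: "Pr (PDirac N) \<in> reach \<Gamma> E" using X NG by (auto intro: reach_PDirac)
        moreover have "same_kind (Pr (PDirac N)) F'" using F'(1) by (auto simp: step_act_iff)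
        ultimately have "(res (Pr (PDirac N)) AH, y') \<in> S"
          using high_proc_step[OF F(1) F'(1)] by (simp only: b(2) F'(3) SI2)
        moreover have "match \<Gamma> weak eqv (eqv `` {res (Pr (PDirac N)) AH}) x a"
          unfolding a using procs[OF X] NG xy PDirac_eqv[of N AH] by (intro match_stay) auto
        ultimately show ?thesis by auto
      next
        \<comment> \<open>Synchronization on \<open>L\<close> is a high move of \<open>X\<close>
          turned silent by hiding, which is the case covered by the unwinding condition.\<close>
        fix X' F' assume X': "step \<Gamma> X (LAct b) X'" "step \<Gamma> F (LAct b) F'" "b \<in> Obs ` L" "z = par X' L F'"
        have "X' \<in> reach \<Gamma> E" using X X'(1) by (rule reach_step)
        moreover have "same_kind X' F'" using X' by (auto simp: step_act_iff)
        ultimately have "(res X' AH, y') \<in> S"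
          using high_proc_step[OF F(1) X'(2)] by (simp only: b(2) X'(4) SI2)
        moreover have "match \<Gamma> weak eqv (eqv `` {res X' AH}) x a"
          using U X X' L b(3) xy by (auto simp: unwinding_def high_matched_def)
        ultimately show ?thesis by auto
      qed
    qed
    show "\<exists>y'. step \<Gamma> y (LAct (id b)) y' \<and> (x', y') \<in> S"
      if xy: "(x, y) \<in> S" and st: "step \<Gamma> x (LAct b) x'" and True for x y b x'
      using S_cases[OF xy]
    proof (elim disjE bexE exE conjE)
      fix X assume X: "X \<in> reach \<Gamma> E" "x = res X AH" "y = hide X AH"
      with st obtain X' where X': "x' = res X' AH" "step \<Gamma> X (LAct b) X'" "b \<notin> Obs ` AH"
        by (auto simp: step_res_iff)
      then have "X' \<in> reach \<Gamma> E" using X reach_step by blast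
      with SI X X' show ?thesis by (auto simp: step_hide_iff)
    next
      fix X F assume X: "X \<in> reach \<Gamma> E" and F: "high_proc F" "same_kind X F" and xy: "x = res X AH" "y = ?c X F"
      from xy st obtain X' where X': "x' = res X' AH" "step \<Gamma> X (LAct b) X'" "b \<notin> Obs ` AH"
        by (auto simp: step_res_iff)
      from X' F(2) obtain N G where NG: "X = Nd N" "F = Nd G" by (cases F) (auto simp: step_act_iff)
      have "b \<notin> Obs ` L" using X'(3) L by auto
      then have "step \<Gamma> (par X L F) (LAct b) (par X' L (Pr (PDirac G)))"
        using X'(2) F(2) NG by (subst step_par_iff) auto
      then have "step \<Gamma> (hide (par X L F) L) (LAct b) (hide (par X' L (Pr (PDirac G))) L)"
        using \<open>b \<notin> Obs ` L\<close> by (auto simp: step_hide_iff)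
      then have "step \<Gamma> y (LAct b) (?c X' (Pr (PDirac G)))"
        unfolding xy using X'(3) by (auto simp: step_res_iff)
      moreover have "(x', ?c X' (Pr (PDirac G))) \<in> S"
        unfolding X'(1) using reach_step[OF X X'(2)] X'(2) F NG
        by (intro SI2) (auto simp: step_act_iff intro!: high_proc_PDirac)
      ultimately show ?thesis by auto
    qed
  qed (use wf in auto)
  have "(hide X AH, ?c X F) \<in> eqv"
    using lifted_bisimilar[OF SI[OF X] SI2[OF X F]] procs[OF X] bisimilarity_refl[OF wf] by auto
  with hide_bisimilar[OF E U X] show ?thesis by (rule bisimilarity_trans[OF wf])
qed

lemma P_BNDC_iff: "E \<in> P_BNDC \<Gamma> AH eqv \<longleftrightarrow> E \<in> procs \<and> unwinding \<Gamma> AH (high_matched \<Gamma> weak AH) E"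
proof
  assume "E \<in> P_BNDC \<Gamma> AH eqv"
  then have E: "E \<in> procs" and ni: "\<And>X. X \<in> reach \<Gamma> E \<Longrightarrow> X \<in> BNDC \<Gamma> AH eqv"
    by (auto simp: P_BNDC_def)
  have "high_matched \<Gamma> weak AH s t" if s: "s \<in> reach \<Gamma> E" and h: "h \<in> AH" "step \<Gamma> s (LAct (Obs h)) t" for s h t
  proof -
    \<comment> \<open>The test process offers \<open>h\<close> exactly once. Synchronizing on
      \<open>h\<close> and hiding it makes the high move silent, and the remaining process
      \<open>?G\<close> gives again a context to which the property applies, now at
      \<open>t\<close>.\<close>
    let ?F = "Nd (NPrefix (Obs h) (PDirac NZero))" and ?G = "Pr (PDirac NZero)"
    have t: "t \<in> reach \<Gamma> E" using s h(2) by (rule reach_step)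
    have occ: "a \<in> Obs ` AH" if "occurs \<Gamma> a ?F \<or> occurs \<Gamma> a ?G" for a
      using that h(1) by (auto simp: occurs_PDirac elim!: occurs_nE(1,2))
    have kinds: "s \<in> nprocs" "t \<in> pprocs" "?F \<in> nprocs" "?G \<in> pprocs"
      using h(2) s t reach_procs[OF E] by (auto simp: step_act_iff nprocs_def pprocs_def)
    then have FG: "?F \<in> procs" "?G \<in> procs" by (auto simp: procs_def)
    have L: "{h} \<subseteq> AH" using h(1) by simp
    have "(res s AH, res (hide (par s {h} ?F) {h}) AH) \<in> eqv"
      using ni[OF s] FG(1) L occ kinds unfolding BNDC_def by blast
    moreover have "step \<Gamma> (res (hide (par s {h} ?F) {h}) AH) (LAct Tau) (res (hide (par t {h} ?G) {h}) AH)"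
    proof -
      have "step \<Gamma> ?F (LAct (Obs h)) ?G" by (auto simp: step_act_iff atrans_simps)
      moreover have "\<exists>N. s = Nd N" using h(2) by (auto simp: step_act_iff)
      ultimately have "step \<Gamma> (par s {h} ?F) (LAct (Obs h)) (par t {h} ?G)"
        using h(2) by (subst step_par_iff) auto
      then have "step \<Gamma> (hide (par s {h} ?F) {h}) (LAct Tau) (hide (par t {h} ?G) {h})"
        by (force simp: step_hide_iff)
      then show ?thesis by (auto simp: step_res_iff)
    qed
    ultimately have "match \<Gamma> weak eqv (eqv `` {res (hide (par t {h} ?G) {h}) AH}) (res s AH) Tau"
      by (metis bisimilarity_step[OF wf] bisimilarity_sym[OF wf])
    moreover have "(res t AH, res (hide (par t {h} ?G) {h}) AH) \<in> eqv"
      using ni[OF t] FG(2) L occ kinds unfolding BNDC_def by blast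
    ultimately show ?thesis unfolding high_matched_def
      by (elim match_mono[OF wf]) (auto intro: bisimilarity_trans[OF wf])
  qed
  with E show "E \<in> procs \<and> unwinding \<Gamma> AH (high_matched \<Gamma> weak AH) E" by (auto simp: unwinding_def)
next
  assume E: "E \<in> procs \<and> unwinding \<Gamma> AH (high_matched \<Gamma> weak AH) E"
  have "X \<in> BNDC \<Gamma> AH eqv" if X: "X \<in> reach \<Gamma> E" for X
    unfolding BNDC_def
  proof (intro CollectI conjI ballI allI impI)
    show "X \<in> procs" using X E reach_procs by auto
    fix F L
    assume F: "F \<in> procs" "\<forall>a. occurs \<Gamma> a F \<longrightarrow> a \<in> Obs ` AH" and "L \<subseteq> AH"
      and kinds: "X \<in> nprocs \<and> F \<in> nprocs \<or> X \<in> pprocs \<and> F \<in> pprocs"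
    moreover have "same_kind X F" using kinds by (auto simp: nprocs_def pprocs_def)
    ultimately show "(res X AH, res (hide (par X L F) L) AH) \<in> eqv"
      using E X by (intro par_bisimilar) (auto simp: high_proc_def)
  qed
  with E show "E \<in> P_BNDC \<Gamma> AH eqv" by (auto simp: P_BNDC_def)
qed

end

section \<open>Closure under prefix, restriction and hiding\<close>

lemma step_res_context: "step \<Gamma> (res s L) l t \<Longrightarrow> \<exists>s'. t = res s' L \<and> step \<Gamma> s l s'"
proof (cases l)
  case (LProb p)
  assume "step \<Gamma> (res s L) l t"
  with LProb obtain P d N where "s = Pr P" "t = res (Nd N) L" "ptrans \<Gamma> P d p N"
    by (cases s) (auto simp: step_prob_label_iff elim!: ptransE(3))
  with LProb show ?thesis by (blast intro: step.intros)
qed (auto simp: step_res_iff)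

lemma step_hide_context: "step \<Gamma> (hide s L) l t \<Longrightarrow> \<exists>s' l'. t = hide s' L \<and> step \<Gamma> s l' s'"
proof (cases l)
  case (LProb p)
  assume "step \<Gamma> (hide s L) l t"
  with LProb obtain P d N where "s = Pr P" "t = hide (Nd N) L" "ptrans \<Gamma> P d p N"
    by (cases s) (auto simp: step_prob_label_iff elim!: ptransE(4))
  then show ?thesis by (blast intro: step.intros)
qed (auto simp: step_hide_iff)

context
  fixes \<Gamma> :: "('a, 'c, 'd) env" and AH :: "'a set"
  assumes wf: "wf_env \<Gamma>"
begin

text \<open>The lifting pairs \<open>res s AH\<close> with \<open>res (f s) AH\<close>. Here
  \<open>lam\<close> is the effect of \<open>f\<close> on labels and \<open>ok\<close> tells which
  labels pass; both sides are restricted, so only labels outside \<open>AH\<close> count. One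
  interpretation serves both unwinding predicates, by \<open>lifted_bisimilar\<close> and by
  \<open>lifted_match\<close>.\<close>

lemma context_transfer:
  fixes f :: "('a, 'c, 'd) proc \<Rightarrow> ('a, 'c, 'd) proc"
  assumes f: "inj f" "\<And>s. f s \<in> procs \<longleftrightarrow> s \<in> procs" "\<And>s. same_kind s (f s)"
    and pd: "\<And>s. s \<in> procs \<Longrightarrow> pdist \<Gamma> (f s) = map_pmf f (pdist \<Gamma> s)"
    and reflected: "\<And>s a y. step \<Gamma> (f s) (LAct a) y \<Longrightarrow> a \<notin> Obs ` AH \<Longrightarrow>
      \<exists>b s'. y = f s' \<and> step \<Gamma> s (LAct b) s' \<and> lam b = a \<and> ok b \<and> b \<notin> Obs ` AH"
    and simulated: "\<And>s b s'. step \<Gamma> s (LAct b) s' \<Longrightarrow> b \<notin> Obs ` AH \<Longrightarrow> ok b \<Longrightarrow>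
      step \<Gamma> (f s) (LAct (lam b)) (f s') \<and> lam b \<notin> Obs ` AH"
    and Tau: "ok Tau" "lam Tau = Tau" and st: "s \<in> procs" "t \<in> procs"
  shows "high_bisimilar \<Gamma> weak AH s t \<Longrightarrow> high_bisimilar \<Gamma> weak AH (f s) (f t)"
    and "high_matched \<Gamma> weak AH s t \<Longrightarrow> high_matched \<Gamma> weak AH (f s) (f t)"
proof -
  define S where "S = {(res s AH, res (f s) AH) | s. s \<in> procs}"
  have SI: "(res s AH, res (f s) AH) \<in> S" if "s \<in> procs" for s
    using that by (auto simp: S_def)
  interpret lifting \<Gamma> weak S lam ok
  proof
    show "x \<in> procs \<and> y \<in> procs \<and> same_kind x y" if "(x, y) \<in> S" for x y
      using that f by (auto simp: S_def)
    show "(x, x') \<in> bisimilarity \<Gamma> weak" if "(x, y) \<in> S" "(x', y) \<in> S" for x x' y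
      using that by (auto simp: S_def bisimilarity_refl[OF wf] inj_eq[OF f(1)])
    show "rel_pmf (\<lambda>u v. (u, v) \<in> S) (pdist \<Gamma> x) (pdist \<Gamma> y)" if "(x, y) \<in> S" for x y
    proof -
      from that obtain s where s: "s \<in> procs" "x = res s AH" "y = res (f s) AH" by (auto simp: S_def)
      then have "pdist \<Gamma> y = map_pmf (\<lambda>u. res (f u) AH) (pdist \<Gamma> s)"
        using f(2) by (simp add: pdist_res[OF wf] pd pmf.map_comp o_def)
      moreover have "(res u AH, res (f u) AH) \<in> S" if "u \<in> set_pmf (pdist \<Gamma> s)" for u
        using set_dist[OF wf s(1) that] by (intro SI) simp
      ultimately show ?thesis
        using s by (auto simp: pdist_res[OF wf] intro!: rel_pmf_map_same)
    qed
    show "\<exists>b x'. ok b \<and> lam b = a \<and> (x', y') \<in> S \<and>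
        match \<Gamma> weak (bisimilarity \<Gamma> weak) (bisimilarity \<Gamma> weak `` {x'}) x b"
      if "(x, y) \<in> S" "step \<Gamma> y (LAct a) y'" for x y a y'
    proof -
      from that(1) obtain s where s: "s \<in> procs" "x = res s AH" "y = res (f s) AH" by (auto simp: S_def)
      with that(2) obtain z where z: "y' = res z AH" "step \<Gamma> (f s) (LAct a) z" "a \<notin> Obs ` AH"
        by (auto simp: step_res_iff)
      from reflected[OF z(2,3)] obtain b s' where b: "z = f s'" "step \<Gamma> s (LAct b) s'" "lam b = a" "ok b" "b \<notin> Obs ` AH"
        by blast
      have s': "s' \<in> procs" using step_procs[OF wf b(2) s(1)] .
      have "match \<Gamma> weak (bisimilarity \<Gamma> weak) (bisimilarity \<Gamma> weak `` {res s' AH}) x b"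
        using b s s' by (intro match_step[OF wf, where t' = "res s' AH"]) (auto simp: step_res_iff bisimilarity_refl[OF wf])
      then show ?thesis using b z SI[OF s'] by auto
    qed
    show "\<exists>y'. step \<Gamma> y (LAct (lam b)) y' \<and> (x', y') \<in> S"
      if "(x, y) \<in> S" "step \<Gamma> x (LAct b) x'" "ok b" for x y b x'
    proof -
      from that(1) obtain s where s: "s \<in> procs" "x = res s AH" "y = res (f s) AH" by (auto simp: S_def)
      with that(2) obtain s' where s': "x' = res s' AH" "step \<Gamma> s (LAct b) s'" "b \<notin> Obs ` AH"
        by (auto simp: step_res_iff)
      have "step \<Gamma> y (LAct (lam b)) (res (f s') AH)"
        using simulated[OF s'(2,3) that(3)] s by (auto simp: step_res_iff)
      moreover have "(x', res (f s') AH) \<in> S"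
        using SI step_procs[OF wf s'(2) s(1)] s' by simp
      ultimately show ?thesis by blast
    qed
  qed (use wf Tau in auto)
  show "high_bisimilar \<Gamma> weak AH (f s) (f t)" if "high_bisimilar \<Gamma> weak AH s t"
    using lifted_bisimilar[OF SI[OF st(1)] SI[OF st(2)]] that by (simp add: high_bisimilar_def)
  show "high_matched \<Gamma> weak AH (f s) (f t)" if "high_matched \<Gamma> weak AH s t"
    using lifted_match[OF SI[OF st(1)] SI[OF st(2)] Tau(1)] that by (simp add: high_matched_def Tau)
qed

lemma unwinding_context:
  fixes f :: "('a, 'c, 'd) proc \<Rightarrow> ('a, 'c, 'd) proc"
  assumes E: "E \<in> procs" and U: "unwinding \<Gamma> AH Q E"
    and f_step: "\<And>s l t. step \<Gamma> (f s) l t \<Longrightarrow> \<exists>s' l'. t = f s' \<and> step \<Gamma> s l' s'"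
    and f_high: "\<And>s h t. step \<Gamma> (f s) (LAct (Obs h)) t \<Longrightarrow> h \<in> AH \<Longrightarrow>
      \<exists>s'. t = f s' \<and> step \<Gamma> s (LAct (Obs h)) s'"
    and Q: "\<And>s t. s \<in> procs \<Longrightarrow> t \<in> procs \<Longrightarrow> Q s t \<Longrightarrow> Q (f s) (f t)"
  shows "unwinding \<Gamma> AH Q (f E)"
proof (rule unwindingI)
  show "reach0 \<Gamma> (f E) \<subseteq> f ` reach \<Gamma> E"
    using f_step reach_step by (intro reach0_subset) (blast intro: reach_self)+
  fix s h t assume "s \<in> f ` reach \<Gamma> E" and h: "h \<in> AH" "step \<Gamma> s (LAct (Obs h)) t"
  then obtain X where X: "X \<in> reach \<Gamma> E" "s = f X" by blast
  with f_high h obtain X' where X': "t = f X'" "step \<Gamma> X (LAct (Obs h)) X'" by blast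
  have "Q X X'" using U X(1) h(1) X'(2) by (auto simp: unwinding_def)
  moreover have "X \<in> procs" using X(1) reach_procs[OF wf E] by auto
  ultimately show "Q s t"
    unfolding X(2) X'(1) using step_procs[OF wf X'(2)] by (intro Q)
qed

lemma unwinding_res:
  assumes "E \<in> procs" "unwinding \<Gamma> AH Q E" "Q \<in> {high_matched \<Gamma> weak AH, high_bisimilar \<Gamma> weak AH}"
  shows "unwinding \<Gamma> AH Q (res E L)"
proof (rule unwinding_context[OF assms(1,2)])
  show "Q (res s L) (res t L)" if "s \<in> procs" "t \<in> procs" "Q s t" for s t
    using assms(3) that context_transfer[of "\<lambda>s. res s L" id "\<lambda>b. b \<notin> Obs ` L" s t weak]
    by (auto simp: inj_def pdist_res[OF wf] step_res_iff)
qed (use step_res_context in \<open>blast+\<close>)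

text \<open>Disjointness of \<open>L\<close> and \<open>AH\<close> ensures that no high move is made
  silent by the context: the restricted base could not make such a move.\<close>

lemma unwinding_hide:
  assumes "E \<in> procs" "unwinding \<Gamma> AH Q E" "Q \<in> {high_matched \<Gamma> weak AH, high_bisimilar \<Gamma> weak AH}"
    and L: "L \<inter> AH = {}"
  shows "unwinding \<Gamma> AH Q (hide E L)"
proof (rule unwinding_context[OF assms(1,2)])
  let ?lam = "\<lambda>b. if b \<in> Obs ` L then Tau else b"
  have reflected: "\<exists>b s'. y = hide s' L \<and> step \<Gamma> s (LAct b) s' \<and> ?lam b = a \<and> True \<and> b \<notin> Obs ` AH"
    if "step \<Gamma> (hide s L) (LAct a) y" "a \<notin> Obs ` AH" for s a y
    using that L by (auto simp: step_hide_iff split: if_splits)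
  have simulated: "step \<Gamma> (hide s L) (LAct (?lam b)) (hide s' L) \<and> ?lam b \<notin> Obs ` AH"
    if "step \<Gamma> s (LAct b) s'" "b \<notin> Obs ` AH" for s b s'
    using that by (auto simp: step_hide_iff)
  show "Q (hide s L) (hide t L)" if "s \<in> procs" "t \<in> procs" "Q s t" for s t
    using assms(3) that context_transfer[of "\<lambda>s. hide s L" ?lam "\<lambda>_. True" s t weak, OF _ _ _ _ reflected simulated]
    by (auto simp: inj_def pdist_hide[OF wf])
  show "\<exists>s'. t = hide s' L \<and> step \<Gamma> s (LAct (Obs h)) s'"
    if "step \<Gamma> (hide s L) (LAct (Obs h)) t" for s h t
    using that by (auto simp: step_hide_iff split: if_splits)
qed (rule step_hide_context)

text \<open>The prefix adds one state, whose only move is not high, so the condition is not tested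
  at that state.\<close>

lemma unwinding_prefix:
  assumes U: "unwinding \<Gamma> AH Q (Pr P)" and a: "a \<notin> Obs ` AH"
  shows "unwinding \<Gamma> AH Q (Nd (NPrefix a P))"
proof (rule unwindingI)
  show "reach0 \<Gamma> (Nd (NPrefix a P)) \<subseteq> insert (Nd (NPrefix a P)) (reach \<Gamma> (Pr P))"
  proof (rule reach0_subset)
    fix s l t assume "s \<in> insert (Nd (NPrefix a P)) (reach \<Gamma> (Pr P))" and st: "step \<Gamma> s l t"
    then consider "s = Nd (NPrefix a P)" | "s \<in> reach \<Gamma> (Pr P)" by blast
    then show "t \<in> insert (Nd (NPrefix a P)) (reach \<Gamma> (Pr P))"
    proof cases
      case 1
      then have "t = Pr P" using st by (auto elim!: step.cases simp: atrans_simps)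
      then show ?thesis by (simp add: reach_self)
    next
      case 2
      then show ?thesis using reach_step st by blast
    qed
  qed simp
  show "Q s t" if "s \<in> insert (Nd (NPrefix a P)) (reach \<Gamma> (Pr P))" "h \<in> AH" "step \<Gamma> s (LAct (Obs h)) t" for s h t
    using that U a by (auto simp: unwinding_def step_act_iff atrans_simps)
qed

end

section \<open>Closure under parallel composition\<close>

text \<open>The flag makes one statement cover the moves of the left and of the right component.\<close>

definition beside ::
  "'a set \<Rightarrow> 'a set \<Rightarrow> bool \<Rightarrow> ('a, 'c, 'd) proc \<Rightarrow> ('a, 'c, 'd) proc \<Rightarrow> ('a, 'c, 'd) proc" where
  "beside AH L b s t = res (if b then par s L t else par t L s) AH"

lemma same_kind_sym: "same_kind s t \<Longrightarrow> same_kind t s"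
  by (auto simp: same_kind_def)

lemma beside_flip: "beside AH L (\<not> b) s t = beside AH L b t s"
  by (simp add: beside_def)

lemma beside_step:
  assumes "step \<Gamma> (Nd N) (LAct a) s'" "a \<notin> Obs ` L" "a \<notin> Obs ` AH"
  shows "step \<Gamma> (beside AH L b (Nd N) (Nd M)) (LAct a) (beside AH L b s' (Pr (PDirac M)))"
proof -
  have "step \<Gamma> (par (Nd N) L (Nd M)) (LAct a) (par s' L (Pr (PDirac M)))"
    "step \<Gamma> (par (Nd M) L (Nd N)) (LAct a) (par (Pr (PDirac M)) L s')"
    by (subst step_par_iff, simp, use assms(1,2) in blast)+
  then show ?thesis
    using assms(3) by (auto simp: beside_def step_res_iff)
qed

context
  fixes \<Gamma> :: "('a, 'c, 'd) env" and AH L :: "'a set"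
  assumes wf: "wf_env \<Gamma>"
begin

abbreviation beqv where "beqv \<equiv> bisimilarity \<Gamma> False"

lemma beside_pdist:
  assumes "s \<in> procs" "t \<in> procs" "same_kind s t" "u \<in> set_pmf (pdist \<Gamma> s)" "v \<in> set_pmf (pdist \<Gamma> t)"
  shows "beside AH L b u v \<in> set_pmf (pdist \<Gamma> (beside AH L b s t))"
  using assms same_kind_sym[OF assms(3)]
  by (cases b) (force simp: beside_def pdist_res[OF wf] pdist_par[OF wf] par_procs image_iff)+

lemma beside_procs: "same_kind s t \<Longrightarrow> beside AH L b s t \<in> procs \<longleftrightarrow> s \<in> procs \<and> t \<in> procs"
  by (auto simp: beside_def par_procs same_kind_sym)

lemma silent_reach_res:
  assumes "silent_reach \<Gamma> (res s AH) z" "s \<in> procs"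
  shows "\<exists>u\<in>procs. z = res u AH"
  using assms(1)[unfolded silent_reach_def]
proof (induction rule: rtranclp_induct)
  case (step y z)
  then obtain u where u: "u \<in> procs" "y = res u AH" by blast
  from step(2) obtain l where "step \<Gamma> (res u AH) l z" unfolding u by (auto simp: silent_step_def)
  from step_res_context[OF this] u(1) show ?case using step_procs[OF wf] by blast
qed (use assms in blast)

text \<open>Both components must be of the same kind, so the idle one alternates between
  \<open>Nd T\<close> and \<open>Pr (PDirac T)\<close> while the other moves.\<close>

lemma beside_silent_reach:
  assumes "silent_reach \<Gamma> (res (Nd N) AH) z" "wf_nterm N" "wf_nterm T"
  shows "\<exists>u\<in>procs. z = res u AH \<and>
    silent_reach \<Gamma> (beside AH L b (Nd N) (Nd T))
      (beside AH L b u (case u of Nd _ \<Rightarrow> Nd T | Pr _ \<Rightarrow> Pr (PDirac T)))"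
  using assms(1)[unfolded silent_reach_def]
proof (induction rule: rtranclp_induct)
  case base
  then show ?case using assms by (intro bexI[of _ "Nd N"]) (auto simp: silent_reach_def)
next
  case (step y z)
  then obtain u where u: "u \<in> procs" "y = res u AH"
      and r: "silent_reach \<Gamma> (beside AH L b (Nd N) (Nd T))
        (beside AH L b u (case u of Nd _ \<Rightarrow> Nd T | Pr _ \<Rightarrow> Pr (PDirac T)))"
    by blast
  have "y \<in> procs" using u by simp
  from silent_step_cases[OF wf step(2) this]
  consider "step \<Gamma> y (LAct Tau) z" | P where "y = Pr P" "z \<in> set_pmf (pdist \<Gamma> y)" by blast
  then show ?case
  proof cases
    case 1
    then obtain u' where u': "z = res u' AH" "step \<Gamma> u (LAct Tau) u'" unfolding u by (auto simp: step_res_iff)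
    then obtain M Q where M: "u = Nd M" "u' = Pr Q" by (auto simp: step_act_iff)
    have "silent_reach \<Gamma> (beside AH L b u (Nd T)) (beside AH L b u' (Pr (PDirac T)))"
      using u'(2) unfolding M by (intro silent_reach_step beside_step) auto
    with r M have "silent_reach \<Gamma> (beside AH L b (Nd N) (Nd T)) (beside AH L b u' (Pr (PDirac T)))"
      by (auto intro: silent_reach_trans)
    then show ?thesis using u' M step_procs[OF wf u'(2) u(1)] by (intro bexI[of _ u']) auto
  next
    case (2 P)
    then obtain Q where Q: "u = Pr Q" using u(2) by (cases u) auto
    from 2(2) obtain v where v: "v \<in> set_pmf (pdist \<Gamma> u)" "z = res v AH"
      unfolding u(2) pdist_res[OF wf u(1)] by auto
    obtain M where M: "v = Nd M" "v \<in> procs" using set_dist[OF wf u(1) v(1)] by blast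
    have "silent_reach \<Gamma> (beside AH L b u (Pr (PDirac T))) (beside AH L b v (Nd T))"
      using u(1) Q assms(3) v(1)
      by (intro silent_reach_pdist[OF wf] beside_pdist) (auto simp: beside_procs pdist_PDirac[OF wf])
    with r Q have "silent_reach \<Gamma> (beside AH L b (Nd N) (Nd T)) (beside AH L b v (Nd T))"
      by (auto intro: silent_reach_trans)
    then show ?thesis using v M by (intro bexI[of _ v]) auto
  qed
qed

lemma beside_silent_reach_Nd:
  assumes "silent_reach \<Gamma> (res (Nd N) AH) (res (Nd M) AH)" "wf_nterm N" "wf_nterm T"
  shows "silent_reach \<Gamma> (beside AH L b (Nd N) (Nd T)) (beside AH L b (Nd M) (Nd T))"
  using beside_silent_reach[OF assms, of b] by (auto simp del: res.simps)

lemma silent_reach_Pr_Nd: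
  assumes "silent_reach \<Gamma> (res (Pr P) AH) (res (Nd M) AH)" "wf_pterm P"
  shows "\<exists>T. Nd T \<in> set_pmf (pdist \<Gamma> (Pr P)) \<and> silent_reach \<Gamma> (res (Nd T) AH) (res (Nd M) AH)"
  using assms(1)[unfolded silent_reach_def]
proof (cases rule: converse_rtranclpE)
  case (step y)
  have "res (Pr P) AH \<in> procs" using assms(2) by simp
  from silent_step_cases[OF wf step(1) this] have "y \<in> set_pmf (pdist \<Gamma> (res (Pr P) AH))"
    by (auto simp: step_act_iff)
  then obtain u where u: "u \<in> set_pmf (pdist \<Gamma> (Pr P))" "y = res u AH"
    using assms(2) by (auto simp: pdist_res[OF wf] simp del: res.simps)
  then obtain T where "u = Nd T" using set_dist[OF wf, of "Pr P" u] assms(2) by auto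
  with u step(2) show ?thesis by (auto simp: silent_reach_def)
qed simp

text \<open>A coupling with a point mass relates the whole support to that point. So a draw from a
  state bisimilar to a nondeterministic one does not change its class.\<close>

lemma pdist_Nd_bisimilar:
  assumes "(res (Nd N) AH, res t AH) \<in> beqv" "t \<in> procs" "v \<in> set_pmf (pdist \<Gamma> t)"
  shows "(res v AH, res t AH) \<in> beqv"
proof -
  have "rel_pmf (\<lambda>x y. (x, y) \<in> beqv) (return_pmf (res (Nd N) AH)) (pdist \<Gamma> (res t AH))"
    using bisimilarity_pdist[OF wf assms(1)] by simp
  then have "(res (Nd N) AH, res v AH) \<in> beqv"
    using assms(2,3) by (simp add: rel_pmf_return_pmf1 pdist_res[OF wf])
  then show ?thesis
    using assms(1) by (meson bisimilarity_sym[OF wf] bisimilarity_trans[OF wf])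
qed

text \<open>If both components are probabilistic, the first move is a joint draw and the partner
  cannot remain idle. Any draw of the partner will do, as its class is preserved by
  \<open>pdist_Nd_bisimilar\<close>.\<close>

lemma beside_advance_one:
  assumes kind: "same_kind s t" and s: "s \<in> procs" and t: "t \<in> procs"
    and r: "silent_reach \<Gamma> (res s AH) (res (Nd M) AH)" and N: "(res (Nd N) AH, res t AH) \<in> beqv"
  shows "\<exists>N'. wf_nterm N' \<and> silent_reach \<Gamma> (beside AH L b s t) (beside AH L b (Nd M) (Nd N')) \<and>
    (res (Nd N') AH, res t AH) \<in> beqv"
proof (cases s)
  case (Nd S)
  with kind obtain T where T: "t = Nd T" by (cases t) auto
  have "(res t AH, res t AH) \<in> beqv" using t by (intro bisimilarity_refl[OF wf]) simp
  with beside_silent_reach_Nd[of S M T b] r s t Nd T show ?thesis by auto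
next
  case (Pr P)
  with kind obtain Q where Q: "t = Pr Q" by (cases t) auto
  from silent_reach_Pr_Nd[of P M] r s Pr obtain S where S: "Nd S \<in> set_pmf (pdist \<Gamma> s)"
    "silent_reach \<Gamma> (res (Nd S) AH) (res (Nd M) AH)" by auto
  obtain v where v: "v \<in> set_pmf (pdist \<Gamma> t)" using set_pmf_not_empty by fastforce
  then obtain N' where N': "v = Nd N'" "wf_nterm N'" using set_dist[OF wf t] by force
  have "silent_reach \<Gamma> (beside AH L b s t) (beside AH L b (Nd S) v)"
    using S(1) v s t kind by (intro silent_reach_pdist[OF wf] beside_pdist) (auto simp: beside_procs)
  moreover have "silent_reach \<Gamma> (beside AH L b (Nd S) v) (beside AH L b (Nd M) v)"
    using S set_dist[OF wf s S(1)] N' unfolding N'(1) by (intro beside_silent_reach_Nd) auto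
  ultimately show ?thesis
    using N' pdist_Nd_bisimilar[OF N t v] by (auto intro: silent_reach_trans)
qed

text \<open>After a joint draw, if one is needed, the components advance one after the other, each
  with the other one idle.\<close>

lemma beside_advance_both:
  assumes kind: "same_kind s t" and s: "s \<in> procs" and t: "t \<in> procs"
    and r: "silent_reach \<Gamma> (res s AH) (res (Nd M) AH)" "silent_reach \<Gamma> (res t AH) (res (Nd K) AH)"
  shows "silent_reach \<Gamma> (beside AH L b s t) (beside AH L b (Nd M) (Nd K))"
proof -
  have Nd_Nd: "silent_reach \<Gamma> (beside AH L b (Nd S) (Nd T)) (beside AH L b (Nd M) (Nd K))"
    if "silent_reach \<Gamma> (res (Nd S) AH) (res (Nd M) AH)" "silent_reach \<Gamma> (res (Nd T) AH) (res (Nd K) AH)"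
      "wf_nterm S" "wf_nterm T" for S T
  proof -
    have "Nd M \<in> procs" using silent_reach_procs[OF wf that(1)] that(3) by simp
    then have "silent_reach \<Gamma> (beside AH L b (Nd M) (Nd T)) (beside AH L b (Nd M) (Nd K))"
      using beside_silent_reach_Nd[OF that(2,4), of M "\<not> b"] by (simp add: beside_flip)
    with beside_silent_reach_Nd[OF that(1,3,4)] show ?thesis by (rule silent_reach_trans)
  qed
  show ?thesis
  proof (cases s)
    case (Nd S)
    with kind obtain T where "t = Nd T" by (cases t) auto
    with Nd r s t show ?thesis by (auto intro!: Nd_Nd)
  next
    case (Pr P)
    with kind obtain Q where Q: "t = Pr Q" by (cases t) auto
    from silent_reach_Pr_Nd[of P M] r(1) s Pr obtain S where S: "Nd S \<in> set_pmf (pdist \<Gamma> s)"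
      "silent_reach \<Gamma> (res (Nd S) AH) (res (Nd M) AH)" by auto
    from silent_reach_Pr_Nd[of Q K] r(2) t Q obtain T where T: "Nd T \<in> set_pmf (pdist \<Gamma> t)"
      "silent_reach \<Gamma> (res (Nd T) AH) (res (Nd K) AH)" by auto
    have "silent_reach \<Gamma> (beside AH L b s t) (beside AH L b (Nd S) (Nd T))"
      using S(1) T(1) s t kind by (intro silent_reach_pdist[OF wf] beside_pdist) (auto simp: beside_procs)
    moreover have "silent_reach \<Gamma> (beside AH L b (Nd S) (Nd T)) (beside AH L b (Nd M) (Nd K))"
      using S T set_dist[OF wf s S(1)] set_dist[OF wf t T(1)] by (intro Nd_Nd) auto
    ultimately show ?thesis by (rule silent_reach_trans)
  qed
qed

definition beside_rel :: "('a, 'c, 'd) proc rel" where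
  "beside_rel = {(beside AH L True s1 s2, beside AH L True t1 t2) | s1 s2 t1 t2.
     same_kind s1 s2 \<and> same_kind t1 t2 \<and> (res s1 AH, res t1 AH) \<in> beqv \<and> (res s2 AH, res t2 AH) \<in> beqv} \<union> Id_on procs"

lemma beside_relI:
  assumes "same_kind s1 s2" "same_kind t1 t2" "(res s1 AH, res t1 AH) \<in> beqv" "(res s2 AH, res t2 AH) \<in> beqv"
  shows "(beside AH L b s1 s2, beside AH L b t1 t2) \<in> beside_rel"
proof (cases b)
  case True
  then show ?thesis using assms unfolding beside_rel_def by (simp only: True) blast
next
  case False
  then have "beside AH L b s1 s2 = beside AH L True s2 s1" "beside AH L b t1 t2 = beside AH L True t2 t1"
    by (simp_all add: beside_def)
  moreover have "same_kind s2 s1" "same_kind t2 t1" using assms by (auto dest: same_kind_sym)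
  ultimately show ?thesis using assms(3,4) unfolding beside_rel_def by (simp only:) blast
qed

text \<open>The branching condition enters here: \<open>t1\<close> reaches the source of its answer
  within its own class and the partner keeps its class meanwhile, so the pair remains related.
  Besides the bisimulation clause, the lemma with \<open>a = Tau\<close> gives the unwinding
  condition for compositions.\<close>

lemma beside_match_alone:
  assumes m: "match \<Gamma> False beqv (beqv `` {res (Pr P) AH}) (res t1 AH) a"
    and a: "a \<notin> Obs ` L" "a \<notin> Obs ` AH"
    and N: "(res (Nd N) AH, res t2 AH) \<in> beqv" and t: "t1 \<in> procs" "same_kind t1 t2"
  shows "match \<Gamma> False beside_rel (beside_rel `` {beside AH L b (Pr P) (Pr (PDirac N))}) (beside AH L b t1 t2) a"
proof -
  have t2: "t2 \<in> procs" and wfN: "wf_nterm N" using bisimilarity_procs[OF wf N] by auto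
  have D: "(res (Pr (PDirac M)) AH, res (Nd M) AH) \<in> beqv" if "wf_nterm M" for M
    using res_PDirac_bisimilar[OF wf that] .
  from m consider "a = Tau" "(res (Pr P) AH, res t1 AH) \<in> beqv" | z z' where
      "silent_reach \<Gamma> (res t1 AH) z" "step \<Gamma> z (LAct a) z'" "(res t1 AH, z) \<in> beqv" "(res (Pr P) AH, z') \<in> beqv"
    by (auto simp: match_def)
  then show ?thesis
  proof cases
    case 1
    then have "(beside AH L b (Pr P) (Pr (PDirac N)), beside AH L b t1 t2) \<in> beside_rel"
      using t bisimilarity_trans[OF wf D[OF wfN] N] by (intro beside_relI) auto
    with 1 show ?thesis by (simp add: match_def)
  next
    case 2
    from silent_reach_res[OF 2(1) t(1)] obtain u where u: "u \<in> procs" "z = res u AH" by blast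
    with 2(2) obtain u' where u': "z' = res u' AH" "step \<Gamma> u (LAct a) u'" by (auto simp: step_res_iff)
    then obtain M Q where MQ: "u = Nd M" "u' = Pr Q" by (auto simp: step_act_iff)
    from beside_advance_one[OF t(2) t(1) t2 _ N, of M b] 2(1) u MQ obtain N' where N': "wf_nterm N'"
      "silent_reach \<Gamma> (beside AH L b t1 t2) (beside AH L b (Nd M) (Nd N'))"
      "(res (Nd N') AH, res t2 AH) \<in> beqv" by auto
    have "step \<Gamma> (beside AH L b (Nd M) (Nd N')) (LAct a) (beside AH L b (Pr Q) (Pr (PDirac N')))"
      using u'(2) MQ a by (intro beside_step) auto
    moreover have "(beside AH L b t1 t2, beside AH L b (Nd M) (Nd N')) \<in> beside_rel"
      using t 2(3) u MQ bisimilarity_sym[OF wf N'(3)] by (intro beside_relI) auto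
    moreover have "(beside AH L b (Pr P) (Pr (PDirac N)), beside AH L b (Pr Q) (Pr (PDirac N'))) \<in> beside_rel"
    proof (rule beside_relI)
      show "(res (Pr (PDirac N)) AH, res (Pr (PDirac N')) AH) \<in> beqv"
        using D[OF wfN] D[OF N'(1)] N N'(3)
        by (meson bisimilarity_sym[OF wf] bisimilarity_trans[OF wf])
    qed (use 2(4) u' MQ in auto)
    ultimately show ?thesis using N'(2) by (auto simp: match_def)
  qed
qed

text \<open>A synchronizing label is visible, so neither answer is a stutter. Both components first
  advance to states ready for \<open>a\<close> within their classes and then synchronize.\<close>

lemma beside_match_sync:
  assumes m: "match \<Gamma> False beqv (beqv `` {res s1 AH}) (res t1 AH) a"
      "match \<Gamma> False beqv (beqv `` {res s2 AH}) (res t2 AH) a"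
    and a: "a \<in> Obs ` L" "a \<notin> Obs ` AH" and s: "same_kind s1 s2"
    and t: "t1 \<in> procs" "t2 \<in> procs" "same_kind t1 t2"
  shows "match \<Gamma> False beside_rel (beside_rel `` {beside AH L True s1 s2}) (beside AH L True t1 t2) a"
proof -
  have reach: "\<exists>M Q. silent_reach \<Gamma> (res t AH) (res (Nd M) AH) \<and> step \<Gamma> (Nd M) (LAct a) (Pr Q) \<and>
      (res t AH, res (Nd M) AH) \<in> beqv \<and> (res s AH, res (Pr Q) AH) \<in> beqv"
    if m: "match \<Gamma> False beqv (beqv `` {res s AH}) (res t AH) a" and t: "t \<in> procs" for s t
  proof -
    from m a(1) obtain z z' where z: "silent_reach \<Gamma> (res t AH) z" "step \<Gamma> z (LAct a) z'"
        "(res t AH, z) \<in> beqv" "(res s AH, z') \<in> beqv"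
      by (auto simp: match_def)
    from silent_reach_res[OF z(1) t] obtain u where u: "z = res u AH" by blast
    with z(2) obtain u' where u': "z' = res u' AH" "step \<Gamma> u (LAct a) u'" by (auto simp: step_res_iff)
    then obtain M Q where "u = Nd M" "u' = Pr Q" by (auto simp: step_act_iff)
    with z u u' show ?thesis by blast
  qed
  from reach[OF m(1) t(1)] obtain M1 Q1 where 1: "silent_reach \<Gamma> (res t1 AH) (res (Nd M1) AH)"
    "step \<Gamma> (Nd M1) (LAct a) (Pr Q1)" "(res t1 AH, res (Nd M1) AH) \<in> beqv" "(res s1 AH, res (Pr Q1) AH) \<in> beqv"
    by blast
  from reach[OF m(2) t(2)] obtain M2 Q2 where 2: "silent_reach \<Gamma> (res t2 AH) (res (Nd M2) AH)"
    "step \<Gamma> (Nd M2) (LAct a) (Pr Q2)" "(res t2 AH, res (Nd M2) AH) \<in> beqv" "(res s2 AH, res (Pr Q2) AH) \<in> beqv"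
    by blast
  have "step \<Gamma> (par (Nd M1) L (Nd M2)) (LAct a) (par (Pr Q1) L (Pr Q2))"
    by (subst step_par_iff, simp, use 1(2) 2(2) a(1) in blast)
  then have "step \<Gamma> (beside AH L True (Nd M1) (Nd M2)) (LAct a) (beside AH L True (Pr Q1) (Pr Q2))"
    unfolding beside_def if_True step_res_iff using a(2) by blast
  moreover have "silent_reach \<Gamma> (beside AH L True t1 t2) (beside AH L True (Nd M1) (Nd M2))"
    using beside_advance_both[OF t(3,1,2) 1(1) 2(1)] .
  moreover have "(beside AH L True t1 t2, beside AH L True (Nd M1) (Nd M2)) \<in> beside_rel"
    using t 1(3) 2(3) by (intro beside_relI) auto
  moreover have "(beside AH L True s1 s2, beside AH L True (Pr Q1) (Pr Q2)) \<in> beside_rel"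
    using s 1(4) 2(4) by (intro beside_relI) auto
  ultimately show ?thesis by (auto simp: match_def)
qed

text \<open>Comparing the restricted components suffices: in a step of the composition a component
  moves with the label of the whole, so the outer restriction already excludes its high
  moves.\<close>

lemma bisim_beside_rel: "bisim \<Gamma> False beside_rel"
proof -
  have cases: "(\<exists>s1 s2 t1 t2. x = beside AH L True s1 s2 \<and> y = beside AH L True t1 t2 \<and> same_kind s1 s2 \<and>
      same_kind t1 t2 \<and> (res s1 AH, res t1 AH) \<in> beqv \<and> (res s2 AH, res t2 AH) \<in> beqv) \<or> x = y \<and> x \<in> procs"
    if "(x, y) \<in> beside_rel" for x y
    using that unfolding beside_rel_def by auto
  have procs: "s \<in> procs \<and> t \<in> procs" if "(res s AH, res t AH) \<in> beqv" for s t
    using bisimilarity_procs[OF wf that] by simp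
  have inj: "s1 = t1 \<and> s2 = t2" if "beside AH L True s1 s2 = beside AH L True t1 t2" "same_kind s1 s2" "same_kind t1 t2"
    for s1 s2 t1 t2 :: "('a, 'c, 'd) proc"
    using that by (simp add: beside_def par_eq_iff)
  have "equiv procs beside_rel"
  proof (rule equivI)
    show "beside_rel \<subseteq> procs \<times> procs"
      using cases procs by (fastforce simp: beside_procs)
    show "refl_on procs beside_rel" by (auto simp: refl_on_def beside_rel_def)
    show "sym beside_rel"
    proof (rule symI)
      fix x y assume "(x, y) \<in> beside_rel"
      from cases[OF this] show "(y, x) \<in> beside_rel"
        using \<open>(x, y) \<in> beside_rel\<close> by (auto intro!: beside_relI dest: bisimilarity_sym[OF wf])
    qed
    show "trans beside_rel"
    proof (rule transI)
      fix x y z assume xy: "(x, y) \<in> beside_rel" and yz: "(y, z) \<in> beside_rel"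
      show "(x, z) \<in> beside_rel"
      proof (cases "x = y \<or> y = z")
        case True
        then show ?thesis using xy yz by auto
      next
        case False
        with cases[OF xy] cases[OF yz] obtain s1 s2 t1 t2 t1' t2' u1 u2 where
          *: "x = beside AH L True s1 s2" "y = beside AH L True t1 t2" "same_kind s1 s2" "same_kind t1 t2"
            "(res s1 AH, res t1 AH) \<in> beqv" "(res s2 AH, res t2 AH) \<in> beqv"
            "y = beside AH L True t1' t2'" "z = beside AH L True u1 u2" "same_kind t1' t2'" "same_kind u1 u2"
            "(res t1' AH, res u1 AH) \<in> beqv" "(res t2' AH, res u2 AH) \<in> beqv"
          by blast
        then have "t1' = t1" "t2' = t2" using inj by metis+
        with * show ?thesis by (auto intro!: beside_relI intro: bisimilarity_trans[OF wf])
      qed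
    qed
  qed
  moreover have "match \<Gamma> False beside_rel (beside_rel `` {x'}) y a"
    if xy: "(x, y) \<in> beside_rel" and st: "step \<Gamma> x (LAct a) x'" for x y a x'
    using cases[OF xy]
  proof (elim disjE exE conjE)
    fix s1 s2 t1 t2
    assume *: "x = beside AH L True s1 s2" "y = beside AH L True t1 t2" "same_kind s1 s2" "same_kind t1 t2"
            "(res s1 AH, res t1 AH) \<in> beqv" "(res s2 AH, res t2 AH) \<in> beqv"
    from st *(1) obtain w where w: "x' = res w AH" "step \<Gamma> (par s1 L s2) (LAct a) w" "a \<notin> Obs ` AH"
      by (auto simp: beside_def step_res_iff)
    from w(2)[unfolded step_par_iff[OF *(3)]] obtain N1 N2 where N: "s1 = Nd N1" "s2 = Nd N2"
      and c: "(\<exists>s'. step \<Gamma> s1 (LAct a) s' \<and> a \<notin> Obs ` L \<and> w = par s' L (Pr (PDirac N2))) \<or>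
       (\<exists>s'. step \<Gamma> s2 (LAct a) s' \<and> a \<notin> Obs ` L \<and> w = par (Pr (PDirac N1)) L s') \<or>
       (\<exists>s1' s2'. step \<Gamma> s1 (LAct a) s1' \<and> step \<Gamma> s2 (LAct a) s2' \<and> a \<in> Obs ` L \<and> w = par s1' L s2')"
      by blast
    have m: "match \<Gamma> False beqv (beqv `` {res s' AH}) (res t AH) a"
      if "step \<Gamma> s (LAct a) s'" "(res s AH, res t AH) \<in> beqv" for s s' t
      using that w(3) by (intro bisimilarity_step[OF wf that(2)]) (auto simp: step_res_iff)
    note t = procs[OF *(5)] procs[OF *(6)]
    from c show ?thesis
    proof (elim disjE exE conjE)
      fix s' assume s': "step \<Gamma> s1 (LAct a) s'" "a \<notin> Obs ` L" "w = par s' L (Pr (PDirac N2))"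
      then obtain P where P: "s' = Pr P" by (auto simp: step_act_iff)
      have "match \<Gamma> False beside_rel (beside_rel `` {beside AH L True (Pr P) (Pr (PDirac N2))}) (beside AH L True t1 t2) a"
        using m[OF s'(1) *(5)] s'(2) w(3) * t N P by (intro beside_match_alone) auto
      then show ?thesis by (simp add: w(1) s'(3) *(2) P beside_def)
    next
      fix s' assume s': "step \<Gamma> s2 (LAct a) s'" "a \<notin> Obs ` L" "w = par (Pr (PDirac N1)) L s'"
      then obtain P where P: "s' = Pr P" by (auto simp: step_act_iff)
      have "match \<Gamma> False beside_rel (beside_rel `` {beside AH L False (Pr P) (Pr (PDirac N1))}) (beside AH L False t2 t1) a"
        using m[OF s'(1) *(6)] s'(2) w(3) * t N P same_kind_sym by (intro beside_match_alone) auto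
      then show ?thesis by (simp add: w(1) s'(3) *(2) P beside_def)
    next
      fix s1' s2' assume s': "step \<Gamma> s1 (LAct a) s1'" "step \<Gamma> s2 (LAct a) s2'" "a \<in> Obs ` L" "w = par s1' L s2'"
      then have "same_kind s1' s2'" by (auto simp: step_act_iff)
      then have "match \<Gamma> False beside_rel (beside_rel `` {beside AH L True s1' s2'}) (beside AH L True t1 t2) a"
        using m[OF s'(1) *(5)] m[OF s'(2) *(6)] s' w(3) * t by (intro beside_match_sync) auto
      then show ?thesis by (simp add: w(1) s'(4) *(2) beside_def)
    qed
  next
    assume "x = y" "x \<in> procs"
    with st show ?thesis
      using step_procs[OF wf st] by (intro match_step[OF wf, where t' = x']) (auto simp: beside_rel_def)
  qed
  moreover have "rel_pmf (\<lambda>u v. (u, v) \<in> beside_rel) (pdist \<Gamma> x) (pdist \<Gamma> y)" if xy: "(x, y) \<in> beside_rel" for x y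
    using cases[OF xy]
  proof (elim disjE exE conjE)
    fix s1 s2 t1 t2
    assume *: "x = beside AH L True s1 s2" "y = beside AH L True t1 t2" "same_kind s1 s2" "same_kind t1 t2"
            "(res s1 AH, res t1 AH) \<in> beqv" "(res s2 AH, res t2 AH) \<in> beqv"
    have pd: "pdist \<Gamma> (beside AH L True s t) = map_pmf (\<lambda>(u, v). beside AH L True u v) (pair_pmf (pdist \<Gamma> s) (pdist \<Gamma> t))"
      if "s \<in> procs" "t \<in> procs" "same_kind s t" for s t
      using that by (simp add: beside_def pdist_res[OF wf] pdist_par[OF wf] par_procs pmf.map_comp o_def case_prod_unfold)
    have rel: "rel_pmf (\<lambda>u v. (res u AH, res v AH) \<in> beqv) (pdist \<Gamma> s) (pdist \<Gamma> t)" if "(res s AH, res t AH) \<in> beqv" for s t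
      using bisimilarity_pdist[OF wf that] procs[OF that] by (simp add: pdist_res[OF wf] pmf.rel_map)
    note p = procs[OF *(5)] procs[OF *(6)]
    have "rel_pmf (rel_prod (\<lambda>u v. (res u AH, res v AH) \<in> beqv) (\<lambda>u v. (res u AH, res v AH) \<in> beqv))
        (pair_pmf (pdist \<Gamma> s1) (pdist \<Gamma> s2)) (pair_pmf (pdist \<Gamma> t1) (pdist \<Gamma> t2))"
      using rel[OF *(5)] rel[OF *(6)] by (simp add: rel_pmf_rel_prod)
    then have "rel_pmf (\<lambda>z z'. (case z of (u, v) \<Rightarrow> beside AH L True u v, case z' of (u, v) \<Rightarrow> beside AH L True u v) \<in> beside_rel)
        (pair_pmf (pdist \<Gamma> s1) (pdist \<Gamma> s2)) (pair_pmf (pdist \<Gamma> t1) (pdist \<Gamma> t2))"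
      by (rule pmf.rel_mono_strong)
        (use p in \<open>auto intro!: beside_relI elim: set_pdist_same_kind[OF wf, rotated 2]\<close>)
    then show ?thesis
      using p * by (simp add: pd pmf.rel_map)
  next
    assume "x = y" "x \<in> procs"
    then show ?thesis using set_dist[OF wf] by (auto intro!: rel_pmf_reflI simp: beside_rel_def)
  qed
  ultimately show ?thesis by (simp add: bisim_def)
qed

lemma beside_bisimilar:
  assumes "same_kind s1 s2" "same_kind t1 t2" "(res s1 AH, res t1 AH) \<in> beqv" "(res s2 AH, res t2 AH) \<in> beqv"
  shows "(beside AH L b s1 s2, beside AH L b t1 t2) \<in> beqv"
  using bisimilarityI[OF bisim_beside_rel beside_relI[OF assms]] .

text \<open>The idle component becomes \<open>PDirac N\<close>, a state that \<open>reach\<close>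
  contains by its convention.\<close>

lemma reach0_par:
  assumes "same_kind E1 E2"
  shows "reach0 \<Gamma> (par E1 L E2) \<subseteq> {par s L t | s t. s \<in> reach \<Gamma> E1 \<and> t \<in> reach \<Gamma> E2 \<and> same_kind s t}"
    (is "_ \<subseteq> ?X")
proof (rule reach0_subset)
  show "par E1 L E2 \<in> ?X" using assms reach_self by blast
  fix x l y assume "x \<in> ?X" and st: "step \<Gamma> x l y"
  then obtain s t where x: "x = par s L t" "s \<in> reach \<Gamma> E1" "t \<in> reach \<Gamma> E2" "same_kind s t" by blast
  have XI: "par s' L t' \<in> ?X" if "s' \<in> reach \<Gamma> E1" "t' \<in> reach \<Gamma> E2" "same_kind s' t'" for s' t'
    using that by blast
  show "y \<in> ?X"
  proof (cases l)
    case (LAct a)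
    from st[unfolded x(1) LAct step_par_iff[OF x(4)]] obtain N1 N2 where N: "s = Nd N1" "t = Nd N2"
      and c: "(\<exists>s'. step \<Gamma> s (LAct a) s' \<and> a \<notin> Obs ` L \<and> y = par s' L (Pr (PDirac N2))) \<or>
       (\<exists>t'. step \<Gamma> t (LAct a) t' \<and> a \<notin> Obs ` L \<and> y = par (Pr (PDirac N1)) L t') \<or>
       (\<exists>s' t'. step \<Gamma> s (LAct a) s' \<and> step \<Gamma> t (LAct a) t' \<and> a \<in> Obs ` L \<and> y = par s' L t')"
      by blast
    have D: "Pr (PDirac N1) \<in> reach \<Gamma> E1" "Pr (PDirac N2) \<in> reach \<Gamma> E2"
      using x N by (auto intro: reach_PDirac)
    have Pr: "\<exists>P. u' = Pr P" if "step \<Gamma> u (LAct a) u'" for u u' using that by (auto simp: step_act_iff)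
    from c show ?thesis
    proof (elim disjE exE conjE)
      fix s' assume s': "step \<Gamma> s (LAct a) s'" "y = par s' L (Pr (PDirac N2))"
      then show ?thesis unfolding s'(2) using D reach_step[OF x(2) s'(1)] Pr[OF s'(1)] by (intro XI) auto
    next
      fix t' assume t': "step \<Gamma> t (LAct a) t'" "y = par (Pr (PDirac N1)) L t'"
      then show ?thesis unfolding t'(2) using D reach_step[OF x(3) t'(1)] Pr[OF t'(1)] by (intro XI) auto
    next
      fix s' t' assume s': "step \<Gamma> s (LAct a) s'" "step \<Gamma> t (LAct a) t'" "y = par s' L t'"
      then show ?thesis unfolding s'(3)
        using reach_step[OF x(2) s'(1)] reach_step[OF x(3) s'(2)] Pr[OF s'(1)] Pr[OF s'(2)]
        by (intro XI) auto
    qed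
  next
    case (LProb p)
    with st x obtain P1 P2 where P: "s = Pr P1" "t = Pr P2" by (cases s; cases t) (auto simp: step_prob_label_iff)
    with st x(1) LProb obtain p1 d1 M1 p2 d2 M2 where M: "y = par (Nd M1) L (Nd M2)"
      "ptrans \<Gamma> P1 d1 p1 M1" "ptrans \<Gamma> P2 d2 p2 M2"
      by (auto simp: step_prob_label_iff elim!: ptransE(2))
    then have st': "step \<Gamma> s (LProb p1) (Nd M1)" "step \<Gamma> t (LProb p2) (Nd M2)"
      using P by (auto intro: step.intros)
    show ?thesis unfolding M(1)
      using reach_step[OF x(2) st'(1)] reach_step[OF x(3) st'(2)] by (intro XI) auto
  qed
qed

text \<open>Every high move keeps each component in its class after restriction, even if both move
  at once. Hence synchronization on high actions is harmless and \<open>L\<close> is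
  arbitrary.\<close>

lemma unwinding_par_bisimilar:
  assumes E: "E1 \<in> procs" "E2 \<in> procs" "same_kind E1 E2"
    and U: "unwinding \<Gamma> AH (high_bisimilar \<Gamma> False AH) E1" "unwinding \<Gamma> AH (high_bisimilar \<Gamma> False AH) E2"
  shows "unwinding \<Gamma> AH (high_bisimilar \<Gamma> False AH) (par E1 L E2)"
proof (rule unwindingI[OF reach0_par[OF E(3)]])
  fix x h y
  assume "x \<in> {par s L t | s t. s \<in> reach \<Gamma> E1 \<and> t \<in> reach \<Gamma> E2 \<and> same_kind s t}"
    and h: "h \<in> AH" and st: "step \<Gamma> x (LAct (Obs h)) y"
  then obtain s t where x: "x = par s L t" "s \<in> reach \<Gamma> E1" "t \<in> reach \<Gamma> E2" "same_kind s t" by blast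
  have p: "s \<in> procs" "t \<in> procs" using x reach_procs[OF wf] E by auto
  from st[unfolded x(1) step_par_iff[OF x(4)]] obtain N1 N2 where N: "s = Nd N1" "t = Nd N2"
    and c: "(\<exists>s'. step \<Gamma> s (LAct (Obs h)) s' \<and> y = par s' L (Pr (PDirac N2))) \<or>
       (\<exists>t'. step \<Gamma> t (LAct (Obs h)) t' \<and> y = par (Pr (PDirac N1)) L t') \<or>
       (\<exists>s' t'. step \<Gamma> s (LAct (Obs h)) s' \<and> step \<Gamma> t (LAct (Obs h)) t' \<and> y = par s' L t')"
    by blast
  have D: "(res (Nd M) AH, res (Pr (PDirac M)) AH) \<in> beqv" if "wf_nterm M" for M
    using bisimilarity_sym[OF wf res_PDirac_bisimilar[OF wf that]] .
  have b: "(res s AH, res s' AH) \<in> beqv" if "step \<Gamma> s (LAct (Obs h)) s'" for s'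
    using U(1) x h that by (auto simp: unwinding_def high_bisimilar_def)
  have b': "(res t AH, res t' AH) \<in> beqv" if "step \<Gamma> t (LAct (Obs h)) t'" for t'
    using U(2) x h that by (auto simp: unwinding_def high_bisimilar_def)
  have "\<exists>s' t'. y = par s' L t' \<and> same_kind s' t' \<and> (res s AH, res s' AH) \<in> beqv \<and> (res t AH, res t' AH) \<in> beqv"
    using c
  proof (elim disjE exE conjE)
    fix s' assume s': "step \<Gamma> s (LAct (Obs h)) s'" "y = par s' L (Pr (PDirac N2))"
    then show ?thesis using b[OF s'(1)] D[of N2] p N
      by (intro exI[of _ s'] exI[of _ "Pr (PDirac N2)"]) (auto simp: step_act_iff)
  next
    fix t' assume t': "step \<Gamma> t (LAct (Obs h)) t'" "y = par (Pr (PDirac N1)) L t'"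
    then show ?thesis using b'[OF t'(1)] D[of N1] p N
      by (intro exI[of _ "Pr (PDirac N1)"] exI[of _ t']) (auto simp: step_act_iff)
  next
    fix s' t' assume s': "step \<Gamma> s (LAct (Obs h)) s'" "step \<Gamma> t (LAct (Obs h)) t'" "y = par s' L t'"
    then show ?thesis using b[OF s'(1)] b'[OF s'(2)]
      by (intro exI[of _ s'] exI[of _ t']) (auto simp: step_act_iff)
  qed
  then obtain s' t' where "y = par s' L t'" "same_kind s' t'" "(res s AH, res s' AH) \<in> beqv" "(res t AH, res t' AH) \<in> beqv"
    by blast
  then show "high_bisimilar \<Gamma> False AH x y"
    using beside_bisimilar[OF x(4), of s' t' True] by (simp add: high_bisimilar_def x(1) beside_def)
qed

text \<open>Disjointness of \<open>L\<close> and \<open>AH\<close> means that a high move is made by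
  one component alone, whose silent match \<open>beside_match_alone\<close> carries over to the
  composition.\<close>

lemma unwinding_par_matched:
  assumes E: "E1 \<in> procs" "E2 \<in> procs" "same_kind E1 E2" and L: "L \<inter> AH = {}"
    and U: "unwinding \<Gamma> AH (high_matched \<Gamma> False AH) E1" "unwinding \<Gamma> AH (high_matched \<Gamma> False AH) E2"
  shows "unwinding \<Gamma> AH (high_matched \<Gamma> False AH) (par E1 L E2)"
proof (rule unwindingI[OF reach0_par[OF E(3)]])
  fix x h y
  assume "x \<in> {par s L t | s t. s \<in> reach \<Gamma> E1 \<and> t \<in> reach \<Gamma> E2 \<and> same_kind s t}"
    and h: "h \<in> AH" and st: "step \<Gamma> x (LAct (Obs h)) y"
  then obtain s t where x: "x = par s L t" "s \<in> reach \<Gamma> E1" "t \<in> reach \<Gamma> E2" "same_kind s t" by blast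
  have p: "s \<in> procs" "t \<in> procs" using x reach_procs[OF wf] E by auto
  have "Obs h \<notin> Obs ` L" using L h by auto
  with st[unfolded x(1) step_par_iff[OF x(4)]] obtain N1 N2 where N: "s = Nd N1" "t = Nd N2"
    and c: "(\<exists>s'. step \<Gamma> s (LAct (Obs h)) s' \<and> y = par s' L (Pr (PDirac N2))) \<or>
       (\<exists>t'. step \<Gamma> t (LAct (Obs h)) t' \<and> y = par (Pr (PDirac N1)) L t')"
    by blast
  have refl: "(res s AH, res s AH) \<in> beqv" "(res t AH, res t AH) \<in> beqv"
    using p by (auto intro!: bisimilarity_refl[OF wf])
  have mono: "high_matched \<Gamma> False AH x y"
    if "match \<Gamma> False beside_rel (beside_rel `` {res y AH}) (res x AH) Tau"
    unfolding high_matched_def using bisim_subset[OF bisim_beside_rel]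
    by (intro match_mono[OF wf that]) auto
  from c show "high_matched \<Gamma> False AH x y"
  proof (elim disjE exE conjE)
    fix s' assume s': "step \<Gamma> s (LAct (Obs h)) s'" "y = par s' L (Pr (PDirac N2))"
    then obtain P where P: "s' = Pr P" by (auto simp: step_act_iff)
    have "high_matched \<Gamma> False AH s s'" using U(1) x(2) h s'(1) by (auto simp: unwinding_def)
    then have "match \<Gamma> False beside_rel (beside_rel `` {beside AH L True (Pr P) (Pr (PDirac N2))}) (beside AH L True s t) Tau"
      using refl x(4) p N P by (intro beside_match_alone) (auto simp: high_matched_def)
    then show ?thesis by (intro mono) (simp add: s'(2) P x(1) beside_def)
  next
    fix t' assume t': "step \<Gamma> t (LAct (Obs h)) t'" "y = par (Pr (PDirac N1)) L t'"
    then obtain P where P: "t' = Pr P" by (auto simp: step_act_iff)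
    have "high_matched \<Gamma> False AH t t'" using U(2) x(3) h t'(1) by (auto simp: unwinding_def)
    then have "match \<Gamma> False beside_rel (beside_rel `` {beside AH L False (Pr P) (Pr (PDirac N1))}) (beside AH L False t s) Tau"
      using refl same_kind_sym[OF x(4)] p N P by (intro beside_match_alone) (auto simp: high_matched_def)
    then show ?thesis by (intro mono) (simp add: t'(2) P x(1) beside_def)
  qed
qed

end

theorem theorem4p5:
  fixes \<Gamma> :: "('a :: countable, 'c, 'd) env"
    and AH AL :: "'a set"
    and R :: "('a, 'c, 'd) proc rel"
    and Sec :: "('a, 'c, 'd) proc rel \<Rightarrow> ('a, 'c, 'd) proc set"
    and E E1 E2 :: "('a, 'c, 'd) proc"
  assumes "wf_env \<Gamma>"
    and "AH \<inter> AL = {}" and "AH \<union> AL = UNIV"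
    and "E1 \<in> nprocs \<and> E2 \<in> nprocs \<or> E1 \<in> pprocs \<and> E2 \<in> pprocs"
    and "E \<in> procs"
    and "R \<in> {weak_prob_bisimilarity \<Gamma>, prob_branching_bisimilarity \<Gamma>}"
    and "Sec \<in> {SBSNNI \<Gamma> AH, P_BNDC \<Gamma> AH, SBNDC \<Gamma> AH}"
  shows "(\<forall>a P. E = Pr P \<longrightarrow> a \<in> Obs ` AL \<union> {Tau} \<longrightarrow> E \<in> Sec R \<longrightarrow> Nd (NPrefix a P) \<in> Sec R)
    \<and> (R = prob_branching_bisimilarity \<Gamma> \<longrightarrow>
        (\<forall>L. (Sec \<in> {SBSNNI \<Gamma> AH, P_BNDC \<Gamma> AH} \<and> L \<subseteq> AL \<or> Sec = SBNDC \<Gamma> AH) \<longrightarrow>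
          E1 \<in> Sec R \<longrightarrow> E2 \<in> Sec R \<longrightarrow> par E1 L E2 \<in> Sec R))
    \<and> (\<forall>L. E \<in> Sec R \<longrightarrow> res E L \<in> Sec R)
    \<and> (\<forall>L\<subseteq>AL. E \<in> Sec R \<longrightarrow> hide E L \<in> Sec R)"
proof -
  note wf = \<open>wf_env \<Gamma>\<close>
  note iffs = SBSNNI_iff[OF wf] P_BNDC_iff[OF wf] SBNDC_iff[OF wf]
  obtain weak where R: "R = bisimilarity \<Gamma> weak"
    using assms(6) weak_prob_bisimilarity_eq[OF wf] prob_branching_bisimilarity_eq[OF wf] by auto
  \<comment> \<open>Each of the three properties is unwinding for one of two predicates, so prefix,
    restriction and hiding are treated for a generic \<open>Q\<close>.\<close>
  obtain Q where Q: "Q \<in> {high_matched \<Gamma> weak AH, high_bisimilar \<Gamma> weak AH}"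
    and Sec: "\<And>F. F \<in> Sec R \<longleftrightarrow> F \<in> procs \<and> unwinding \<Gamma> AH Q F"
    using assms(7) that[of "high_matched \<Gamma> weak AH"] that[of "high_bisimilar \<Gamma> weak AH"]
    unfolding R by (auto simp: iffs)
  have "Nd (NPrefix a P) \<in> Sec R" if "E = Pr P" "a \<in> Obs ` AL \<union> {Tau}" "E \<in> Sec R" for a P
    using that assms(2) unwinding_prefix[OF wf, of AH Q P a] by (auto simp: Sec)
  moreover have "par E1 L E2 \<in> Sec R"
    if branching: "R = prob_branching_bisimilarity \<Gamma>"
      and L: "Sec \<in> {SBSNNI \<Gamma> AH, P_BNDC \<Gamma> AH} \<and> L \<subseteq> AL \<or> Sec = SBNDC \<Gamma> AH"
      and E12: "E1 \<in> Sec R" "E2 \<in> Sec R" for L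
  proof -
    have kind: "same_kind E1 E2" using assms(4) by (auto simp: nprocs_def pprocs_def)
    \<comment> \<open>The flag \<open>weak\<close> is not determined by \<open>R\<close>, as the two
      bisimilarities might coincide. The characterizations are therefore used again with the flag
      \<open>False\<close>.\<close>
    have R': "R = bisimilarity \<Gamma> False"
      unfolding branching by (rule prob_branching_bisimilarity_eq[OF wf])
    have procs: "E1 \<in> procs" "E2 \<in> procs" "par E1 L E2 \<in> procs"
      using E12 kind by (simp_all add: Sec par_procs)
    from L show ?thesis
    proof
      assume *: "Sec \<in> {SBSNNI \<Gamma> AH, P_BNDC \<Gamma> AH} \<and> L \<subseteq> AL"
      then have Sec': "F \<in> Sec R \<longleftrightarrow> F \<in> procs \<and> unwinding \<Gamma> AH (high_matched \<Gamma> False AH) F" for F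
        unfolding R' by (auto simp: iffs)
      have "L \<inter> AH = {}" using * assms(2) by blast
      then show ?thesis
        using E12 procs unwinding_par_matched[OF wf procs(1,2) kind] by (simp add: Sec')
    next
      assume "Sec = SBNDC \<Gamma> AH"
      then show ?thesis
        using E12 procs unwinding_par_bisimilar[OF wf procs(1,2) kind] unfolding R' by (simp add: iffs)
    qed
  qed
  moreover have "res E L \<in> Sec R" if "E \<in> Sec R" for L
    using that unwinding_res[OF wf _ _ Q] by (simp add: Sec)
  moreover have "hide E L \<in> Sec R" if "E \<in> Sec R" "L \<subseteq> AL" for L
    using that assms(2) unwinding_hide[OF wf _ _ Q, of E L] by (auto simp: Sec)
  ultimately show ?thesis by blast
qed

end
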